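(* Let $X$ be a $\mathbb{Z}$-tree and let $Ends(X)$ be the set of all its ends. Then for every monotone action $G\curvearrowright X$ of a group $G$ by homeomorphisms, the induced action of $G$ on the compact space $\widehat{X}:=X\cup Ends(X)$ is Rosenthal representable.
   Context: A pretree is a pair $(X,R)$ with $X$ a set and $R$ a ternary relation on $X$ (write $\langle a,b,c\rangle$ for $(a,b,c)\in R$) such that: (B1) $\langle a,b,c\rangle\Rightarrow\langle c,b,a\rangle$; (B2) $\langle a,b,c\rangle\wedge\langle a,c,b\rangle\Leftrightarrow b=c$; (B3) $\langle a,b,c\rangle\Rightarrow\langle a,b,d\rangle\vee\langle d,b,c\rangle$. Put $[u,v]=\{x\in X:\langle u,x,v\rangle\}$. The pretree is a median pretree if $[a,b]\cap[a,c]\cap[b,c]\neq\emptyset$ for all $a,b,c$ (then this set is a singleton). The shadow topology $\tau_s$ on a pretree $X$ has as a subbase of closed sets the family of all $S^v_u=\{x\in X:u\in[x,v]\}$, $u\ne v$. A $\mathbb{Z}$-tree is a median pretree in which all intervals $[u,v]$ are finite (it is the vertex set of a simplicial tree, with $u\neq v$ adjacent iff $[u,v]=\{u,v\}$). It is equipped with its shadow topology. An end of $X$ is an equivalence class of rays, a ray being a sequence $x_0,x_1,\dots$ of distinct points with consecutive points adjacent; two rays are equivalent if they have infinitely many points in common. The betweenness extends to $\widehat X=X\cup Ends(X)$: for $x\in X$ and an end $\xi$, $[x,\xi]=[\xi,x]$ consists of $\xi$ and the points of the unique ray from $x$ in the class $\xi$; for distinct ends $\xi,\eta$, $[\xi,\eta]$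 consists of $\xi,\eta$ and the points of the unique bi-infinite line joining them; $[\xi,\xi]=\{\xi\}$. With this structure $\widehat X$ is a median pretree that is compact (and Hausdorff) in its shadow topology, and this is the topology on $\widehat X$. The action is monotone if every translation $x\mapsto gx$ preserves $R$; it then induces an action on $\widehat X$ by homeomorphisms. $G$ may be taken discrete; if $G$ carries another group topology, the induced action on $\widehat X$ is understood to be continuous. For a Banach space $V$, $Is(V)$ is the topological group of all linear isometries of $V$ onto $V$ with the strong operator topology. $V$ is a Rosenthal Banach space if it contains no isomorphic copy of $\ell_1$. A representation of an action $G\curvearrowright K$ on $V$ is a pair $(h,\alpha)$ where $h:G\to Is(V)$ is a strongly continuous co-homomorphism ($h(g_1g_2)=h(g_2)h(g_1)$), and $\alpha:K\to V^*$ is a weak-star continuous bounded map with $\langle v,\alpha(gx)\rangle=\langle h(g)(v),\alpha(x)\rangle$ for all $v\in V$, $g\in G$, $x\in K$. The action is Rosenthal representable if there are a Rosenthal Banach space $V$ and a representation $(h,\alpha)$ on $V$ with $\alpha$ a topological embedding (for the weak-star topology). *)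

theory Defs
  imports
    "HOL-Analysis.Analysis"
    "HOL-Algebra.Group_Action"
    "HOL-Library.Function_Algebras"
begin

section \<open>Pretrees and the shadow topology\<close>

text \<open>
  A ternary relation on \<open>X\<close> is a predicate of which only the values on \<open>X\<close> matter;
  \<open>R a b c\<close> reads ``\<open>b\<close> lies between \<open>a\<close> and \<open>c\<close>''.
\<close>

definition pretree :: "'a set \<Rightarrow> ('a \<Rightarrow> 'a \<Rightarrow> 'a \<Rightarrow> bool) \<Rightarrow> bool" where
  "pretree X R \<longleftrightarrow>
     (\<forall>a\<in>X. \<forall>b\<in>X. \<forall>c\<in>X. R a b c \<longrightarrow> R c b a) \<and>
     (\<forall>a\<in>X. \<forall>b\<in>X. \<forall>c\<in>X. R a b c \<and> R a c b \<longleftrightarrow> b = c) \<and>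
     (\<forall>a\<in>X. \<forall>b\<in>X. \<forall>c\<in>X. \<forall>d\<in>X. R a b c \<longrightarrow> R a b d \<or> R d b c)"

definition interval :: "'a set \<Rightarrow> ('a \<Rightarrow> 'a \<Rightarrow> 'a \<Rightarrow> bool) \<Rightarrow> 'a \<Rightarrow> 'a \<Rightarrow> 'a set" where
  "interval X R u v = {x\<in>X. R u x v}"

definition median_pretree :: "'a set \<Rightarrow> ('a \<Rightarrow> 'a \<Rightarrow> 'a \<Rightarrow> bool) \<Rightarrow> bool" where
  "median_pretree X R \<longleftrightarrow> pretree X R \<and>
     (\<forall>a\<in>X. \<forall>b\<in>X. \<forall>c\<in>X.
        interval X R a b \<inter> interval X R a c \<inter> interval X R b c \<noteq> {})"

definition shadow :: "'a set \<Rightarrow> ('a \<Rightarrow> 'a \<Rightarrow> 'a \<Rightarrow> bool) \<Rightarrow> 'a \<Rightarrow> 'a \<Rightarrow> 'a set" where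
  "shadow X R u v = {x\<in>X. u \<in> interval X R x v}"

text \<open>
  The complements of the shadows form a subbase of open sets. The empty intersection
  \<open>X\<close> is inserted by hand, because \<^const>\<open>topology_generated_by\<close> takes the union of
  the generating family as the space, which would be empty if \<open>X\<close> is a singleton.
\<close>

definition shadow_topology :: "'a set \<Rightarrow> ('a \<Rightarrow> 'a \<Rightarrow> 'a \<Rightarrow> bool) \<Rightarrow> 'a topology" where
  "shadow_topology X R =
     topology_generated_by
       (insert X {X - shadow X R u v | u v. u \<in> X \<and> v \<in> X \<and> u \<noteq> v})"

lemma topspace_shadow_topology [simp]: "topspace (shadow_topology X R) = X"
  by (auto simp: shadow_topology_def)


section \<open>Z-trees and their ends\<close>

definition Z_tree :: "'a set \<Rightarrow> ('a \<Rightarrow> 'a \<Rightarrow> 'a \<Rightarrow> bool) \<Rightarrow> bool" where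
  "Z_tree X R \<longleftrightarrow> median_pretree X R \<and> (\<forall>u\<in>X. \<forall>v\<in>X. finite (interval X R u v))"

definition adjacent :: "'a set \<Rightarrow> ('a \<Rightarrow> 'a \<Rightarrow> 'a \<Rightarrow> bool) \<Rightarrow> 'a \<Rightarrow> 'a \<Rightarrow> bool" where
  "adjacent X R u v \<longleftrightarrow> u \<in> X \<and> v \<in> X \<and> u \<noteq> v \<and> interval X R u v = {u, v}"

definition rays :: "'a set \<Rightarrow> ('a \<Rightarrow> 'a \<Rightarrow> 'a \<Rightarrow> bool) \<Rightarrow> (nat \<Rightarrow> 'a) set" where
  "rays X R = {r. range r \<subseteq> X \<and> inj r \<and> (\<forall>n. adjacent X R (r n) (r (Suc n)))}"

definition ray_equiv ::
  "'a set \<Rightarrow> ('a \<Rightarrow> 'a \<Rightarrow> 'a \<Rightarrow> bool) \<Rightarrow> ((nat \<Rightarrow> 'a) \<times> (nat \<Rightarrow> 'a)) set" where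
  "ray_equiv X R =
     {(r, s). r \<in> rays X R \<and> s \<in> rays X R \<and> infinite (range r \<inter> range s)}"

definition Ends :: "'a set \<Rightarrow> ('a \<Rightarrow> 'a \<Rightarrow> 'a \<Rightarrow> bool) \<Rightarrow> (nat \<Rightarrow> 'a) set set" where
  "Ends X R = rays X R // ray_equiv X R"

definition lines :: "'a set \<Rightarrow> ('a \<Rightarrow> 'a \<Rightarrow> 'a \<Rightarrow> bool) \<Rightarrow> (int \<Rightarrow> 'a) set" where
  "lines X R = {l. range l \<subseteq> X \<and> inj l \<and> (\<forall>n. adjacent X R (l n) (l (n + 1)))}"

type_synonym 'a hat = "'a + (nat \<Rightarrow> 'a) set"

definition hat :: "'a set \<Rightarrow> ('a \<Rightarrow> 'a \<Rightarrow> 'a \<Rightarrow> bool) \<Rightarrow> 'a hat set" where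
  "hat X R = Inl ` X \<union> Inr ` Ends X R"

definition ray_points :: "'a \<Rightarrow> (nat \<Rightarrow> 'a) set \<Rightarrow> 'a set" where
  "ray_points x \<xi> = \<Union> {range r | r. r \<in> \<xi> \<and> r 0 = x}"

definition line_points ::
  "'a set \<Rightarrow> ('a \<Rightarrow> 'a \<Rightarrow> 'a \<Rightarrow> bool) \<Rightarrow> (nat \<Rightarrow> 'a) set \<Rightarrow> (nat \<Rightarrow> 'a) set \<Rightarrow> 'a set" where
  "line_points X R \<xi> \<eta> =
     \<Union> {range l | l. l \<in> lines X R \<and> (\<lambda>n. l (- int n)) \<in> \<xi> \<and> (\<lambda>n. l (int n)) \<in> \<eta>}"

fun hat_interval ::
  "'a set \<Rightarrow> ('a \<Rightarrow> 'a \<Rightarrow> 'a \<Rightarrow> bool) \<Rightarrow> 'a hat \<Rightarrow> 'a hat \<Rightarrow> 'a hat set" where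
  "hat_interval X R (Inl x) (Inl y) = Inl ` interval X R x y"
| "hat_interval X R (Inl x) (Inr \<xi>) = insert (Inr \<xi>) (Inl ` ray_points x \<xi>)"
| "hat_interval X R (Inr \<xi>) (Inl x) = insert (Inr \<xi>) (Inl ` ray_points x \<xi>)"
| "hat_interval X R (Inr \<xi>) (Inr \<eta>) =
     (if \<xi> = \<eta> then {Inr \<xi>} else {Inr \<xi>, Inr \<eta>} \<union> Inl ` line_points X R \<xi> \<eta>)"

definition hat_between ::
  "'a set \<Rightarrow> ('a \<Rightarrow> 'a \<Rightarrow> 'a \<Rightarrow> bool) \<Rightarrow> 'a hat \<Rightarrow> 'a hat \<Rightarrow> 'a hat \<Rightarrow> bool" where
  "hat_between X R u p v \<longleftrightarrow> p \<in> hat_interval X R u v"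

definition hat_topology ::
  "'a set \<Rightarrow> ('a \<Rightarrow> 'a \<Rightarrow> 'a \<Rightarrow> bool) \<Rightarrow> 'a hat topology" where
  "hat_topology X R = shadow_topology (hat X R) (hat_between X R)"


section \<open>Actions\<close>

definition topological_group :: "('g, 'm) monoid_scheme \<Rightarrow> 'g topology \<Rightarrow> bool" where
  "topological_group G T \<longleftrightarrow> group G \<and> topspace T = carrier G \<and>
     continuous_map (prod_topology T T) T (\<lambda>(g, h). g \<otimes>\<^bsub>G\<^esub> h) \<and>
     continuous_map T T (\<lambda>g. inv\<^bsub>G\<^esub> g)"

definition monotone_action ::
  "('g, 'm) monoid_scheme \<Rightarrow> 'a set \<Rightarrow> ('a \<Rightarrow> 'a \<Rightarrow> 'a \<Rightarrow> bool) \<Rightarrow> ('g \<Rightarrow> 'a \<Rightarrow> 'a) \<Rightarrow> bool" where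
  "monotone_action G X R \<phi> \<longleftrightarrow> group_action G X \<phi> \<and>
     (\<forall>g\<in>carrier G. \<forall>a\<in>X. \<forall>b\<in>X. \<forall>c\<in>X. R a b c \<longrightarrow> R (\<phi> g a) (\<phi> g b) (\<phi> g c))"

fun hat_action :: "('g \<Rightarrow> 'a \<Rightarrow> 'a) \<Rightarrow> 'g \<Rightarrow> 'a hat \<Rightarrow> 'a hat" where
  "hat_action \<phi> g (Inl x) = Inl (\<phi> g x)"
| "hat_action \<phi> g (Inr \<xi>) = Inr ((\<lambda>r. \<phi> g \<circ> r) ` \<xi>)"


section \<open>Banach spaces\<close>

text \<open>
  A (real) normed space is a linear subspace \<open>V\<close> of an ambient real vector space together
  with a norm \<open>N\<close> on \<open>V\<close>; the values of \<open>N\<close> outside \<open>V\<close> are irrelevant. Function types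
  serve as ambient vector spaces with the pointwise operations.
\<close>

instantiation "fun" :: (type, real_vector) real_vector
begin

definition scaleR_fun_def: "scaleR c f = (\<lambda>x. c *\<^sub>R f x)"

instance
  by standard (simp_all add: scaleR_fun_def plus_fun_def scaleR_add_right scaleR_add_left)

end

definition linear_map_on :: "'v::real_vector set \<Rightarrow> ('v \<Rightarrow> 'w::real_vector) \<Rightarrow> bool" where
  "linear_map_on V f \<longleftrightarrow>
     (\<forall>x\<in>V. \<forall>y\<in>V. f (x + y) = f x + f y) \<and> (\<forall>c. \<forall>x\<in>V. f (c *\<^sub>R x) = c *\<^sub>R f x)"

definition normed_space :: "'v::real_vector set \<Rightarrow> ('v \<Rightarrow> real) \<Rightarrow> bool" where
  "normed_space V N \<longleftrightarrow> subspace V \<and>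
     (\<forall>x\<in>V. 0 \<le> N x \<and> (N x = 0 \<longleftrightarrow> x = 0)) \<and>
     (\<forall>c. \<forall>x\<in>V. N (c *\<^sub>R x) = \<bar>c\<bar> * N x) \<and>
     (\<forall>x\<in>V. \<forall>y\<in>V. N (x + y) \<le> N x + N y)"

text \<open>The locale \<^locale>\<open>Metric_space\<close> wants a nonnegative symmetric distance outside \<open>V\<close> too.\<close>

definition norm_dist :: "'v::real_vector set \<Rightarrow> ('v \<Rightarrow> real) \<Rightarrow> 'v \<Rightarrow> 'v \<Rightarrow> real" where
  "norm_dist V N x y = (if x \<in> V \<and> y \<in> V then N (x - y) else 0)"

lemma Metric_space_norm_dist:
  assumes "normed_space V N"
  shows "Metric_space V (norm_dist V N)"
proof -
  have V: "subspace V" and pos: "\<And>x. x \<in> V \<Longrightarrow> 0 \<le> N x \<and> (N x = 0 \<longleftrightarrow> x = 0)"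
    and hom: "\<And>c x. x \<in> V \<Longrightarrow> N (c *\<^sub>R x) = \<bar>c\<bar> * N x"
    and tri: "\<And>x y. x \<in> V \<Longrightarrow> y \<in> V \<Longrightarrow> N (x + y) \<le> N x + N y"
    using assms unfolding normed_space_def by auto
  have diff: "x - y \<in> V" if "x \<in> V" "y \<in> V" for x y
    using V that by (rule subspace_diff)
  show ?thesis
  proof
    fix x y
    show "0 \<le> norm_dist V N x y"
      using pos diff by (simp add: norm_dist_def)
    show "norm_dist V N x y = norm_dist V N y x"
      using hom[of "x - y" "-1"] diff by (auto simp: norm_dist_def)
  next
    fix x y assume "x \<in> V" "y \<in> V"
    then show "norm_dist V N x y = 0 \<longleftrightarrow> x = y"
      using pos diff by (simp add: norm_dist_def)
  next
    fix x y z assume "x \<in> V" "y \<in> V" "z \<in> V"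
    then show "norm_dist V N x z \<le> norm_dist V N x y + norm_dist V N y z"
      using tri[of "x - y" "y - z"] diff by (simp add: norm_dist_def)
  qed
qed

definition norm_topology :: "'v::real_vector set \<Rightarrow> ('v \<Rightarrow> real) \<Rightarrow> 'v topology" where
  "norm_topology V N = Metric_space.mtopology V (norm_dist V N)"

definition Banach_space :: "'v::real_vector set \<Rightarrow> ('v \<Rightarrow> real) \<Rightarrow> bool" where
  "Banach_space V N \<longleftrightarrow> normed_space V N \<and> Metric_space.mcomplete V (norm_dist V N)"

definition ell1 :: "(nat \<Rightarrow> real) set" where
  "ell1 = {x. summable (\<lambda>n. \<bar>x n\<bar>)}"

definition ell1_norm :: "(nat \<Rightarrow> real) \<Rightarrow> real" where
  "ell1_norm x = (\<Sum>n. \<bar>x n\<bar>)"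

text \<open>An isomorphic copy of one space in another: the image of a linear map bounded
  from above and from below.\<close>

definition contains_copy_of ::
  "'v::real_vector set \<Rightarrow> ('v \<Rightarrow> real) \<Rightarrow> 'w::real_vector set \<Rightarrow> ('w \<Rightarrow> real) \<Rightarrow> bool" where
  "contains_copy_of V N W M \<longleftrightarrow>
     (\<exists>T c C. T \<in> W \<rightarrow> V \<and> linear_map_on W T \<and> 0 < c \<and>
        (\<forall>w\<in>W. c * M w \<le> N (T w) \<and> N (T w) \<le> C * M w))"

definition Rosenthal_space :: "'v::real_vector set \<Rightarrow> ('v \<Rightarrow> real) \<Rightarrow> bool" where
  "Rosenthal_space V N \<longleftrightarrow> Banach_space V N \<and> \<not> contains_copy_of V N ell1 ell1_norm"

text \<open>
  Maps defined on \<open>V\<close> are represented by \<^const>\<open>extensional\<close> functions, so that pointwise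
  convergence on \<open>V\<close> is convergence in a subspace of a product.
\<close>

definition dual_space :: "'v::real_vector set \<Rightarrow> ('v \<Rightarrow> real) \<Rightarrow> ('v \<Rightarrow> real) set" where
  "dual_space V N =
     {f \<in> extensional V. linear_map_on V f \<and> (\<exists>C. \<forall>v\<in>V. \<bar>f v\<bar> \<le> C * N v)}"

definition weak_star_topology ::
  "'v::real_vector set \<Rightarrow> ('v \<Rightarrow> real) \<Rightarrow> ('v \<Rightarrow> real) topology" where
  "weak_star_topology V N =
     subtopology (product_topology (\<lambda>_. euclideanreal) V) (dual_space V N)"

definition linear_isometries :: "'v::real_vector set \<Rightarrow> ('v \<Rightarrow> real) \<Rightarrow> ('v \<Rightarrow> 'v) set" where
  "linear_isometries V N =
     {T \<in> extensional V. bij_betw T V V \<and> linear_map_on V T \<and> (\<forall>v\<in>V. N (T v) = N v)}"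

definition strong_operator_topology ::
  "'v::real_vector set \<Rightarrow> ('v \<Rightarrow> real) \<Rightarrow> ('v \<Rightarrow> 'v) topology" where
  "strong_operator_topology V N =
     subtopology (product_topology (\<lambda>_. norm_topology V N) V) (linear_isometries V N)"


section \<open>Rosenthal representability\<close>

text \<open>
  \<open>G\<close> with the topology \<open>T\<close> acts on the space \<open>K\<close> by \<open>act\<close>. Boundedness of \<open>\<alpha>\<close> refers to the
  dual norm, and \<open>v\<close> paired with \<open>\<alpha> x\<close> is \<open>\<alpha> x v\<close>.
\<close>

definition representation ::
  "('g, 'm) monoid_scheme \<Rightarrow> 'g topology \<Rightarrow> 'k topology \<Rightarrow> ('g \<Rightarrow> 'k \<Rightarrow> 'k) \<Rightarrow>
   'v::real_vector set \<Rightarrow> ('v \<Rightarrow> real) \<Rightarrow> ('g \<Rightarrow> 'v \<Rightarrow> 'v) \<Rightarrow> ('k \<Rightarrow> 'v \<Rightarrow> real) \<Rightarrow> bool" where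
  "representation G T K act V N h \<alpha> \<longleftrightarrow>
     continuous_map T (strong_operator_topology V N) h \<and>
     (\<forall>g1\<in>carrier G. \<forall>g2\<in>carrier G. h (g1 \<otimes>\<^bsub>G\<^esub> g2) = compose V (h g2) (h g1)) \<and>
     continuous_map K (weak_star_topology V N) \<alpha> \<and>
     (\<exists>C. \<forall>x\<in>topspace K. \<forall>v\<in>V. \<bar>\<alpha> x v\<bar> \<le> C * N v) \<and>
     (\<forall>v\<in>V. \<forall>g\<in>carrier G. \<forall>x\<in>topspace K. \<alpha> (act g x) v = \<alpha> x (h g v))"

text \<open>
  HOL cannot quantify over all types that might carry \<open>V\<close>, but subspaces \<open>V\<close> of the
  space of all functions \<open>K \<Rightarrow> \<real>\<close>, with arbitrary complete norms, suffice. Given a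
  representation on any Rosenthal space \<open>W\<close>, divide \<open>W\<close> by the closed \<open>G\<close>-invariant subspace
  of all \<open>w\<close> annihilated by every \<open>\<alpha> x\<close>. The quotient is again Rosenthal since copies of
  \<open>\<ell>\<^sub>1\<close> lift through quotient maps, \<open>(h, \<alpha>)\<close> descends to it and \<open>\<alpha>\<close> remains an
  embedding, and \<open>w \<mapsto> (\<lambda>x. \<alpha> x w)\<close> maps it injectively and linearly into that space.
\<close>

definition Rosenthal_representable ::
  "('g, 'm) monoid_scheme \<Rightarrow> 'g topology \<Rightarrow> 'k topology \<Rightarrow> ('g \<Rightarrow> 'k \<Rightarrow> 'k) \<Rightarrow> bool" where
  "Rosenthal_representable G T K act \<longleftrightarrow>
     (\<exists>(V :: ('k \<Rightarrow> real) set) N h \<alpha>.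
        Rosenthal_space V N \<and> representation G T K act V N h \<alpha> \<and>
        embedding_map K (weak_star_topology V N) \<alpha>)"

end

theory Submission
  imports Defs
begin

text \<open>
  An edge \<open>(a, b)\<close> of the tree cuts the compactification \<open>K\<close> of \<open>X\<close> by its ends into two clopen
  sides. The sides generate the topology of \<open>K\<close>, separate its points, are permuted by \<open>G\<close>, and
  no two of them cross. Because of the last property, \<open>n\<close> sides cut \<open>K\<close> into at most \<open>n + 1\<close> cells, and
  a fourth moment estimate for random signs shows that any \<open>n\<close> functions \<open>a\<^sub>i\<close> in the absolutely convex
  hull \<open>D\<close> of the indicators of the sides admit signs with \<open>\<Sum>i<n. e\<^sub>i a\<^sub>i\<close> of sup norm \<open>o(n)\<close>.

  The representation space \<open>V\<close> is obtained by interpolating between the gauge of \<open>D\<close> and the sup norm, as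
  in the factorization of Davis, Figiel, Johnson and Pelczynski, and a point of \<open>K\<close>
  is represented by evaluation at it. The
  estimate yields, in the image of any copy of \<open>\<ell>\<^sub>1\<close>, signed averages of small sup norm over arbitrarily late
  blocks of unit vectors. Such averages are almost orthogonal to any given element of \<open>V\<close>, so that sums of
  \<open>m\<close> of them have norm of order \<open>sqrt m\<close> only, although they come from vectors of \<open>\<ell>\<^sub>1\<close>-norm \<open>m\<close>.
\<close>

text \<open>The gauge of \<open>D\<close> alone would not do: for a star with infinitely many leaves
  it turns the indicators of the leaves into the unit vectors of \<open>ell1\<close>. An average of
  small sup norm contradicts nothing by itself either, since its norm \<open>N\<close> may stay
  large; only sums of many such averages do. The fourth is the first even moment that is strong
  enough. On one cell the p-th moment of a signed sum is of order n^(p/2). Summed over n + 1 cells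
  and compared with a threshold proportional to n, it leaves an error of order n^(2 - p/2), which is
  o(n) only for p > 2. All sides enter \<open>D\<close> with the same weights, so \<open>D\<close>
  is invariant under \<open>G\<close> and the action on \<open>V\<close> is isometric. For a
  nondiscrete \<open>T\<close> the delicate point is strong continuity: the preimages of a side must
  be locally constant in the group element, which is more than continuity of the action says. It
  holds because edges are rigid: an edge whose ends are separated by another edge is that
  edge.\<close>

section \<open>Random signs\<close>

text \<open>Expectation under independent fair signs, peeling off the last one, so that moment
  bounds become inductions on \<open>n\<close>. The coordinates from \<open>n\<close> on stay
  0.\<close>

fun sign_mean :: "nat \<Rightarrow> ((nat \<Rightarrow> real) \<Rightarrow> real) \<Rightarrow> real" where
  "sign_mean 0 F = F (\<lambda>_. 0)"
| "sign_mean (Suc n) F =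
     (sign_mean n (\<lambda>e. F (e(n := 1))) + sign_mean n (\<lambda>e. F (e(n := -1)))) / 2"

definition is_sign :: "nat \<Rightarrow> (nat \<Rightarrow> real) \<Rightarrow> bool" where
  "is_sign n e \<longleftrightarrow> (\<forall>i<n. \<bar>e i\<bar> = 1)"

lemma is_sign_upd: "is_sign n e \<Longrightarrow> \<bar>s\<bar> = 1 \<Longrightarrow> is_sign (Suc n) (e(n := s))"
  by (auto simp: is_sign_def less_Suc_eq)

lemma sign_mean_add: "sign_mean n (\<lambda>e. F e + F' e) = sign_mean n F + sign_mean n F'"
  by (induction n arbitrary: F F') (auto simp: field_simps)

lemma sign_mean_scale: "sign_mean n (\<lambda>e. c * F e) = c * sign_mean n F"
  by (induction n arbitrary: F) (auto simp: field_simps)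

lemma sign_mean_const: "sign_mean n (\<lambda>e. c) = c"
  by (induction n) auto

lemma sign_mean_sum: "sign_mean n (\<lambda>e. \<Sum>p\<in>P. F p e) = (\<Sum>p\<in>P. sign_mean n (F p))"
proof (induction P rule: infinite_finite_induct)
  case (insert x P)
  then show ?case using sign_mean_add[of n "F x"] by simp
qed (auto simp: sign_mean_const)

lemma ex_sign_le_mean: "\<exists>e. is_sign n e \<and> F e \<le> sign_mean n F"
proof (induction n arbitrary: F)
  case 0
  show ?case by (auto simp: is_sign_def)
next
  case (Suc n)
  let ?F = "\<lambda>s e. F (e(n := s))"
  obtain e e' where e: "is_sign n e" "?F 1 e \<le> sign_mean n (?F 1)"
    and e': "is_sign n e'" "?F (-1) e' \<le> sign_mean n (?F (-1))"
    using Suc by meson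
  have "F (e(n := 1)) \<le> sign_mean (Suc n) F \<or> F (e'(n := -1)) \<le> sign_mean (Suc n) F"
    using e(2) e'(2) by auto
  then show ?case
    using is_sign_upd[OF e(1), of 1] is_sign_upd[OF e'(1), of "-1"] by auto
qed

lemma sign_mean_square:
  assumes "\<And>i. i < n \<Longrightarrow> \<bar>b i\<bar> \<le> 1"
  shows "sign_mean n (\<lambda>e. (\<Sum>i<n. e i * b i)\<^sup>2) \<le> real n"
  using assms
proof (induction n)
  case (Suc n)
  let ?S = "\<lambda>e. \<Sum>i<n. e i * b i"
  have upd: "(\<Sum>i<Suc n. (e(n := s)) i * b i) = ?S e + s * b n" for e s
    by (auto intro!: sum.cong)
  have "sign_mean (Suc n) (\<lambda>e. (\<Sum>i<Suc n. e i * b i)\<^sup>2) =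
      (sign_mean n (\<lambda>e. (?S e + b n)\<^sup>2) + sign_mean n (\<lambda>e. (?S e - b n)\<^sup>2)) / 2"
    by (simp only: sign_mean.simps upd) simp
  also have "\<dots> = sign_mean n (\<lambda>e. (1 / 2) * ((?S e + b n)\<^sup>2 + (?S e - b n)\<^sup>2))"
    by (simp only: sign_mean_scale sign_mean_add)
  also have "\<dots> = sign_mean n (\<lambda>e. (?S e)\<^sup>2 + (b n)\<^sup>2)"
    by (intro arg_cong[where f = "sign_mean n"] ext) (simp add: power2_eq_square algebra_simps)
  also have "\<dots> = sign_mean n (\<lambda>e. (?S e)\<^sup>2) + (b n)\<^sup>2"
    by (simp add: sign_mean_add sign_mean_const)
  also have "\<dots> \<le> real n + 1"
    using Suc by (intro add_mono) (auto simp: abs_square_le_1)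
  finally show ?case by simp
qed auto

lemma sign_mean_fourth_power:
  assumes "\<And>i. i < n \<Longrightarrow> \<bar>b i\<bar> \<le> 1"
  shows "sign_mean n (\<lambda>e. (\<Sum>i<n. e i * b i) ^ 4) \<le> 3 * (real n)\<^sup>2"
  using assms
proof (induction n)
  case (Suc n)
  let ?S = "\<lambda>e. \<Sum>i<n. e i * b i"
  have upd: "(\<Sum>i<Suc n. (e(n := s)) i * b i) = ?S e + s * b n" for e s
    by (auto intro!: sum.cong)
  have b: "(b n)\<^sup>2 \<le> 1"
    using Suc.prems by (auto simp: abs_square_le_1)
  then have b4: "(b n) ^ 4 \<le> 1"
    using power_le_one[of "(b n)\<^sup>2" 2] by (simp add: power_mult[symmetric])
  have "sign_mean (Suc n) (\<lambda>e. (\<Sum>i<Suc n. e i * b i) ^ 4) =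
      (sign_mean n (\<lambda>e. (?S e + b n) ^ 4) + sign_mean n (\<lambda>e. (?S e - b n) ^ 4)) / 2"
    by (simp only: sign_mean.simps upd) simp
  also have "\<dots> = sign_mean n (\<lambda>e. (1 / 2) * ((?S e + b n) ^ 4 + (?S e - b n) ^ 4))"
    by (simp only: sign_mean_scale sign_mean_add)
  also have "\<dots> = sign_mean n (\<lambda>e. ?S e ^ 4 + ((6 * (b n)\<^sup>2) * (?S e)\<^sup>2 + b n ^ 4))"
    by (intro arg_cong[where f = "sign_mean n"] ext)
      (simp add: power4_eq_xxxx power2_eq_square algebra_simps)
  also have "\<dots> = sign_mean n (\<lambda>e. ?S e ^ 4) +
      (6 * (b n)\<^sup>2 * sign_mean n (\<lambda>e. (?S e)\<^sup>2) + b n ^ 4)"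
    by (simp only: sign_mean_add sign_mean_const sign_mean_scale)
  \<comment> \<open>The factor 3 is the one that survives the induction: 3 n^2 + 6 n + 1 <= 3 (n +
    1)^2.\<close>
  also have "\<dots> \<le> 3 * (real n)\<^sup>2 + (6 * real n + 1)"
  proof (intro add_mono)
    have "6 * (b n)\<^sup>2 * sign_mean n (\<lambda>e. (?S e)\<^sup>2) \<le> 6 * (b n)\<^sup>2 * real n"
      using Suc.prems by (intro mult_left_mono sign_mean_square) auto
    also have "\<dots> \<le> 6 * 1 * real n"
      using b by (intro mult_right_mono) auto
    finally show "6 * (b n)\<^sup>2 * sign_mean n (\<lambda>e. (?S e)\<^sup>2) \<le> 6 * real n" by simp
  qed (use Suc b4 in auto)
  also have "\<dots> \<le> 3 * (real (Suc n))\<^sup>2"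
    by (simp add: power2_eq_square algebra_simps)
  finally show ?case .
qed auto


section \<open>Families of nested sets\<close>

text \<open>A nonempty atom of the algebra generated by the first \<open>n\<close> sets is recorded
  by the indices of the sets containing it.\<close>

definition cells :: "'k set \<Rightarrow> (nat \<Rightarrow> 'k set) \<Rightarrow> nat \<Rightarrow> nat set set" where
  "cells K H n = (\<lambda>x. {i. i < n \<and> x \<in> H i}) ` K"

definition crossing_free :: "'k set \<Rightarrow> 'k set \<Rightarrow> 'k set \<Rightarrow> bool" where
  "crossing_free K A B \<longleftrightarrow>
     K \<inter> A \<inter> B = {} \<or> (K \<inter> A) - B = {} \<or> (K \<inter> B) - A = {} \<or> K - (A \<union> B) = {}"

text \<open>Passing from \<open>n\<close> to \<open>n + 1\<close> sets splits at most one cell: if two cells were split by the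
  new set, that set would cross any of the old sets that tells the two cells apart.\<close>

lemma card_cells_le:
  assumes "\<And>i j. i < n \<Longrightarrow> j < n \<Longrightarrow> crossing_free K (H i) (H j)"
  shows "finite (cells K H n) \<and> card (cells K H n) \<le> n + 1"
  using assms
proof (induction n)
  case 0
  have "cells K H 0 \<subseteq> {{}}" by (auto simp: cells_def)
  then show ?case
    using card_mono[of "{{}}" "cells K H 0"] by (auto intro: finite_subset)
next
  case (Suc n)
  let ?C = "cells K H n"
  have fin: "finite ?C" and card: "card ?C \<le> n + 1"
    using Suc by auto
  define sp where "sp = {p\<in>?C. p \<in> cells K H (Suc n) \<and> insert n p \<in> cells K H (Suc n)}"
  have nn: "n \<notin> p" if "p \<in> ?C" for p
    using that by (auto simp: cells_def)
  have sub: "p - {n} \<in> ?C" if p: "p \<in> cells K H (Suc n)" for p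
  proof -
    obtain x where "x \<in> K" "p = {i. i < Suc n \<and> x \<in> H i}"
      using p by (auto simp: cells_def)
    then have "x \<in> K" "p - {n} = {i. i < n \<and> x \<in> H i}" by auto
    then show ?thesis by (auto simp: cells_def)
  qed
  have "p = p'" if pp': "p \<in> sp" "p' \<in> sp" for p p'
  proof (rule ccontr)
    assume "p \<noteq> p'"
    then obtain i where i: "i \<in> p \<longleftrightarrow> i \<notin> p'" by blast
    have lt: "i < n"
      using i pp' by (auto simp: sp_def cells_def)
    have out: "\<exists>x\<in>K. (\<forall>i<n. x \<in> H i \<longleftrightarrow> i \<in> q) \<and> x \<notin> H n" if "q \<in> sp" for q
    proof -
      have q: "q \<in> cells K H (Suc n)" "n \<notin> q"
        using that nn by (auto simp: sp_def)
      then show ?thesis by (force simp: cells_def)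
    qed
    have ins: "\<exists>x\<in>K. (\<forall>i<n. x \<in> H i \<longleftrightarrow> i \<in> q) \<and> x \<in> H n" if "q \<in> sp" for q
    proof -
      have "insert n q \<in> cells K H (Suc n)"
        using that by (auto simp: sp_def)
      then obtain x where x: "x \<in> K" "insert n q = {i. i < Suc n \<and> x \<in> H i}"
        by (auto simp: cells_def)
      then have "\<forall>i<n. x \<in> H i \<longleftrightarrow> i \<in> q" "x \<in> H n" by (auto simp: set_eq_iff less_Suc_eq)
      then show ?thesis using x by blast
    qed
    obtain x where "x \<in> K" "x \<notin> H n" "x \<in> H i \<longleftrightarrow> i \<in> p"
      using out[OF pp'(1)] lt by blast
    moreover obtain y where "y \<in> K" "y \<in> H n" "y \<in> H i \<longleftrightarrow> i \<in> p"
      using ins[OF pp'(1)] lt by blast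
    moreover obtain x' where "x' \<in> K" "x' \<notin> H n" "x' \<in> H i \<longleftrightarrow> i \<in> p'"
      using out[OF pp'(2)] lt by blast
    moreover obtain y' where "y' \<in> K" "y' \<in> H n" "y' \<in> H i \<longleftrightarrow> i \<in> p'"
      using ins[OF pp'(2)] lt by blast
    moreover have "crossing_free K (H i) (H n)"
      using Suc.prems lt by auto
    ultimately show False
      using i unfolding crossing_free_def by (cases "i \<in> p") (simp_all, blast+)
  qed
  then have sp: "finite sp" "card sp \<le> 1"
    using fin by (auto simp: sp_def card_le_Suc0_iff_eq)
  \<comment> \<open>A new cell goes to its trace on the old sets; of the two halves of a split cell,
    the one inside \<open>H n\<close> goes to the second summand.\<close>
  let ?r = "\<lambda>p. if p - {n} \<in> sp \<and> n \<in> p then Inr (p - {n}) else Inl (p - {n})"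
  have inj: "inj_on ?r (cells K H (Suc n))"
  proof (rule inj_onI)
    fix p q assume pq: "p \<in> cells K H (Suc n)" "q \<in> cells K H (Suc n)" "?r p = ?r q"
    then have eq: "p - {n} = q - {n}" by (auto split: if_splits)
    show "p = q"
    proof (cases "n \<in> p \<longleftrightarrow> n \<in> q")
      case True
      then show ?thesis using eq by blast
    next
      case False
      have "p - {n} \<in> sp"
      proof (cases "n \<in> p")
        case True
        then have "insert n (p - {n}) = p" "p - {n} = q"
          using False eq by auto
        then show ?thesis using pq sub[OF pq(1)] by (auto simp: sp_def)
      next
        case False': False
        then have "insert n (p - {n}) = q" "p - {n} = p"
          using False eq by auto
        then show ?thesis using pq sub[OF pq(1)] by (auto simp: sp_def)
      qed
      moreover from this have "q - {n} \<in> sp" by (simp only: eq)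
      ultimately show ?thesis
        using False pq(3) by (simp split: if_splits)
    qed
  qed
  have ran: "?r ` cells K H (Suc n) \<subseteq> ?C <+> sp"
    using sub by auto
  have fp: "finite (?C <+> sp)"
    using fin sp by auto
  have "card (cells K H (Suc n)) \<le> card (?C <+> sp)"
    by (rule card_inj_on_le[OF inj ran fp])
  also have "\<dots> \<le> Suc n + 1"
    using fin sp card by (simp add: card_Plus)
  finally show ?case
    using inj_on_finite[OF inj ran fp] by simp
qed


lemma scaleR_fun_apply [simp]: "(c *\<^sub>R f) x = c *\<^sub>R f x"
  by (simp add: scaleR_fun_def)

locale nested_family =
  fixes K :: "'k set" and HH :: "'k set set"
  assumes subset_carrier: "A \<in> HH \<Longrightarrow> A \<subseteq> K"
    and crossing: "A \<in> HH \<Longrightarrow> B \<in> HH \<Longrightarrow> crossing_free K A B"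
begin

text \<open>The range of \<open>t\<close> makes the hull symmetric, and 0 keeps it nonempty when
  \<open>HH\<close> is empty, as for the tree with one point.\<close>

definition D :: "('k \<Rightarrow> real) set" where
  "D = convex hull (insert 0 {t *\<^sub>R indicator A | t A. A \<in> HH \<and> \<bar>t\<bar> \<le> 1})"

lemma D_induct [consumes 1, case_names zero indicator convex]:
  assumes "a \<in> D" and "P 0"
    and "\<And>t A. A \<in> HH \<Longrightarrow> \<bar>t\<bar> \<le> 1 \<Longrightarrow> P (t *\<^sub>R indicator A)"
    and "\<And>a b u v. P a \<Longrightarrow> P b \<Longrightarrow> 0 \<le> u \<Longrightarrow> 0 \<le> v \<Longrightarrow> u + v = 1 \<Longrightarrow> P (u *\<^sub>R a + v *\<^sub>R b)"
  shows "P a"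
proof -
  have "D \<subseteq> Collect P"
    unfolding D_def using assms(2-) by (intro hull_minimal) (auto simp: convex_def)
  then show ?thesis using assms(1) by auto
qed

lemma zero_D: "0 \<in> D"
  unfolding D_def by (intro hull_inc) auto

lemma indicator_D: "A \<in> HH \<Longrightarrow> \<bar>t\<bar> \<le> 1 \<Longrightarrow> t *\<^sub>R indicator A \<in> D"
  unfolding D_def by (intro hull_inc) auto

lemma convex_D: "a \<in> D \<Longrightarrow> b \<in> D \<Longrightarrow> 0 \<le> u \<Longrightarrow> 0 \<le> v \<Longrightarrow> u + v = 1 \<Longrightarrow> u *\<^sub>R a + v *\<^sub>R b \<in> D"
  using convex_convex_hull[of "insert 0 {t *\<^sub>R indicator A | t A. A \<in> HH \<and> \<bar>t\<bar> \<le> 1}"]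
  unfolding D_def convex_def by blast

lemma scale_D:
  assumes "a \<in> D" "\<bar>c\<bar> \<le> 1"
  shows "c *\<^sub>R a \<in> D"
  using assms(1)
proof (induction rule: D_induct)
  case zero
  then show ?case using zero_D by (simp add: zero_fun_def)
next
  case (indicator t A)
  have "\<bar>c * t\<bar> \<le> 1"
    using indicator assms(2) by (simp add: abs_mult mult_le_one)
  then show ?case
    using indicator_D[OF indicator(1), of "c * t"] by (simp only: scaleR_scaleR)
next
  case (convex a b u v)
  then have "u *\<^sub>R (c *\<^sub>R a) + v *\<^sub>R (c *\<^sub>R b) \<in> D"
    by (intro convex_D)
  then show ?case
    by (simp only: scaleR_add_right scaleR_scaleR mult.commute)
qed

lemma D_abs_le_1: "a \<in> D \<Longrightarrow> \<bar>a x\<bar> \<le> 1"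
proof (induction rule: D_induct)
  case (indicator t A)
  then show ?case by (auto simp: indicator_def)
next
  case (convex a b u v)
  have "\<bar>u * a x + v * b x\<bar> \<le> u * \<bar>a x\<bar> + v * \<bar>b x\<bar>"
    using convex abs_triangle_ineq[of "u * a x" "v * b x"] by (simp add: abs_mult)
  also have "\<dots> \<le> u * 1 + v * 1"
    using convex by (intro add_mono mult_left_mono) auto
  finally show ?case using convex by simp
qed auto


subsection \<open>Signed sums of elements of the absolutely convex hull\<close>

text \<open>Meant as a bound on the expected sup norm over \<open>K\<close>; the majorant
  \<open>M\<close> replaces the supremum, whose existence then need not be carried along.\<close>

definition dominated :: "nat \<Rightarrow> (nat \<Rightarrow> 'k \<Rightarrow> real) \<Rightarrow> real \<Rightarrow> bool" where
  "dominated n a \<beta> \<longleftrightarrow> (\<exists>M. (\<forall>e. is_sign n e \<longrightarrow> (\<forall>x\<in>K. \<bar>\<Sum>i<n. e i * a i x\<bar> \<le> M e)) \<and>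
     sign_mean n M \<le> \<beta>)"

lemma dominated_convex:
  assumes "dominated n (a(k := b)) \<beta>" "dominated n (a(k := c)) \<beta>" and uv: "0 \<le> u" "0 \<le> v" "u + v = 1"
  shows "dominated n (a(k := u *\<^sub>R b + v *\<^sub>R c)) \<beta>"
proof -
  obtain M where M: "\<And>e x. is_sign n e \<Longrightarrow> x \<in> K \<Longrightarrow> \<bar>\<Sum>i<n. e i * (a(k := b)) i x\<bar> \<le> M e"
    "sign_mean n M \<le> \<beta>"
    using assms(1) unfolding dominated_def by blast
  obtain M' where M': "\<And>e x. is_sign n e \<Longrightarrow> x \<in> K \<Longrightarrow> \<bar>\<Sum>i<n. e i * (a(k := c)) i x\<bar> \<le> M' e"
    "sign_mean n M' \<le> \<beta>"
    using assms(2) unfolding dominated_def by blast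
  have split: "(a(k := u *\<^sub>R b + v *\<^sub>R c)) i x = u * (a(k := b)) i x + v * (a(k := c)) i x" for i x
    using uv by (auto simp: distrib_right[symmetric])
  show ?thesis
    unfolding dominated_def
  proof (intro exI conjI allI impI ballI)
    fix e x assume e: "is_sign n e" and x: "x \<in> K"
    have "(\<Sum>i<n. e i * (a(k := u *\<^sub>R b + v *\<^sub>R c)) i x) =
        u * (\<Sum>i<n. e i * (a(k := b)) i x) + v * (\<Sum>i<n. e i * (a(k := c)) i x)"
      unfolding split by (simp add: sum_distrib_left sum.distrib[symmetric] algebra_simps)
    also have "\<bar>\<dots>\<bar> \<le> u * \<bar>\<Sum>i<n. e i * (a(k := b)) i x\<bar> + v * \<bar>\<Sum>i<n. e i * (a(k := c)) i x\<bar>"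
      using uv by (intro order.trans[OF abs_triangle_ineq]) (simp add: abs_mult)
    also have "\<dots> \<le> u * M e + v * M' e"
      using uv M(1)[OF e x] M'(1)[OF e x] by (intro add_mono mult_left_mono)
    finally show "\<bar>\<Sum>i<n. e i * (a(k := u *\<^sub>R b + v *\<^sub>R c)) i x\<bar> \<le> u * M e + v * M' e" .
  next
    have "u * sign_mean n M + v * sign_mean n M' \<le> u * \<beta> + v * \<beta>"
      using uv M(2) M'(2) by (intro add_mono mult_left_mono)
    also have "\<dots> = \<beta>"
      using uv by (simp add: distrib_right[symmetric])
    finally show "sign_mean n (\<lambda>e. u * M e + v * M' e) \<le> \<beta>"
      by (simp add: sign_mean_add sign_mean_scale)
  qed
qed

text \<open>The mean of a maximum over cells is not directly accessible; by this bound the maximum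
  is at most \<open>t\<close> plus a sum over cells, whose mean is.\<close>

lemma abs_le_fourth_power:
  fixes t y :: real
  assumes "0 < t"
  shows "\<bar>y\<bar> \<le> t + y ^ 4 / t ^ 3"
proof (cases "\<bar>y\<bar> \<le> t")
  case True
  then show ?thesis using assms by (simp add: add_increasing2)
next
  case False
  then have "\<bar>y\<bar> * t ^ 3 \<le> \<bar>y\<bar> * \<bar>y\<bar> ^ 3"
    using assms by (intro mult_left_mono power_mono) auto
  also have "\<dots> = y ^ 4"
    by (simp add: power_Suc[symmetric] del: power_Suc)
  finally show ?thesis
    using assms by (simp add: pos_le_divide_eq add_increasing)
qed

lemma dominated_base:
  assumes a: "\<And>i. i < n \<Longrightarrow> a i = \<sigma> i *\<^sub>R indicator (H i) \<and> H i \<in> insert {} HH \<and> \<bar>\<sigma> i\<bar> \<le> 1"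
    and t: "0 < t"
  shows "dominated n a (t + (real n + 1) * (3 * (real n)\<^sup>2) / t ^ 3)"
proof -
  let ?b = "\<lambda>p i. if i \<in> p then \<sigma> i else 0"
  have "crossing_free K (H i) (H j)" if "i < n" "j < n" for i j
    using a[OF that(1)] a[OF that(2)] crossing by (auto simp: crossing_free_def)
  then have cells: "finite (cells K H n)" "card (cells K H n) \<le> n + 1"
    using card_cells_le by blast+
  define M where "M e = t + (\<Sum>p\<in>cells K H n. (1 / t ^ 3) * (\<Sum>i<n. e i * ?b p i) ^ 4)" for e
  have "\<bar>\<Sum>i<n. e i * a i x\<bar> \<le> M e" if "x \<in> K" for e x
  proof -
    define p where "p = {i. i < n \<and> x \<in> H i}"
    have p: "p \<in> cells K H n"
      using that by (auto simp: p_def cells_def)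
    have "(\<Sum>i<n. e i * a i x) = (\<Sum>i<n. e i * ?b p i)"
      using a by (intro sum.cong) (auto simp: p_def)
    then have "\<bar>\<Sum>i<n. e i * a i x\<bar> \<le> t + (\<Sum>i<n. e i * ?b p i) ^ 4 / t ^ 3"
      by (simp only: abs_le_fourth_power[OF t])
    also have "t + (\<Sum>i<n. e i * ?b p i) ^ 4 / t ^ 3 \<le> M e"
      unfolding M_def using member_le_sum[OF p, of "\<lambda>p. (1 / t ^ 3) * (\<Sum>i<n. e i * ?b p i) ^ 4"] cells t
      by simp
    finally show ?thesis .
  qed
  moreover have "sign_mean n M \<le> t + (real n + 1) * (3 * (real n)\<^sup>2) / t ^ 3"
  proof -
    have "sign_mean n M = t + (\<Sum>p\<in>cells K H n. (1 / t ^ 3) * sign_mean n (\<lambda>e. (\<Sum>i<n. e i * ?b p i) ^ 4))"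
      unfolding M_def by (simp only: sign_mean_add sign_mean_const sign_mean_sum sign_mean_scale)
    also have "\<dots> \<le> t + (\<Sum>p\<in>cells K H n. (1 / t ^ 3) * (3 * (real n)\<^sup>2))"
      using t a by (intro add_mono sum_mono mult_left_mono sign_mean_fourth_power) auto
    also have "\<dots> = t + card (cells K H n) * ((1 / t ^ 3) * (3 * (real n)\<^sup>2))"
      by simp
    also have "\<dots> \<le> t + (real n + 1) * ((1 / t ^ 3) * (3 * (real n)\<^sup>2))"
      using cells t by (intro add_left_mono mult_right_mono) auto
    finally show ?thesis by simp
  qed
  ultimately show ?thesis
    unfolding dominated_def by blast
qed

text \<open>The mean over all signs of the sup norm is convex in each \<open>a i\<close>, so that the \<open>a i\<close> can be replaced
  one at a time by the multiples of indicators that span \<open>D\<close>.\<close>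

lemma dominated_D:
  assumes a: "\<And>i. i < n \<Longrightarrow> a i \<in> D" and t: "0 < t"
  shows "dominated n a (t + (real n + 1) * (3 * (real n)\<^sup>2) / t ^ 3)"
    (is "dominated n a ?\<beta>")
proof -
  \<comment> \<open>Induction on \<open>k\<close>: the first \<open>k\<close> functions are
    arbitrary in \<open>D\<close>, the others are already multiples of indicators.\<close>
  have "dominated n a ?\<beta>"
    if "k \<le> n" "\<And>i. i < k \<Longrightarrow> a i \<in> D"
      "\<And>i. k \<le> i \<Longrightarrow> i < n \<Longrightarrow> \<exists>\<sigma> A. a i = \<sigma> *\<^sub>R indicator A \<and> A \<in> insert {} HH \<and> \<bar>\<sigma>\<bar> \<le> 1" for k a
    using that
  proof (induction k arbitrary: a)
    case 0
    then have "\<forall>i<n. \<exists>\<sigma> A. a i = \<sigma> *\<^sub>R indicator A \<and> A \<in> insert {} HH \<and> \<bar>\<sigma>\<bar> \<le> 1"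
      by blast
    then obtain \<sigma> H where
      "\<And>i. i < n \<Longrightarrow> a i = \<sigma> i *\<^sub>R indicator (H i) \<and> H i \<in> insert {} HH \<and> \<bar>\<sigma> i\<bar> \<le> 1"
      by metis
    then show ?case
      by (rule dominated_base) (use t in auto)
  next
    case (Suc k)
    have base: "dominated n (a(k := \<sigma> *\<^sub>R indicator A)) ?\<beta>" if "A \<in> insert {} HH" "\<bar>\<sigma>\<bar> \<le> 1" for \<sigma> A
    proof (rule Suc.IH)
      fix i assume i: "k \<le> i" "i < n"
      show "\<exists>\<sigma>' A'. (a(k := \<sigma> *\<^sub>R indicator A)) i = \<sigma>' *\<^sub>R indicator A' \<and>
          A' \<in> insert {} HH \<and> \<bar>\<sigma>'\<bar> \<le> 1"
      proof (cases "i = k")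
        case True
        then show ?thesis using that by (intro exI[of _ \<sigma>] exI[of _ A]) simp
      next
        case False
        then have "Suc k \<le> i" using i by simp
        from Suc.prems(3)[OF this i(2)] show ?thesis
          unfolding fun_upd_other[OF False] .
      qed
    qed (use Suc.prems in auto)
    have "a k \<in> D"
      using Suc.prems by auto
    \<comment> \<open>Written as an update, \<open>a k\<close> can vary over \<open>D\<close> while
      the other functions stay fixed.\<close>
    then have "dominated n (a(k := a k)) ?\<beta>"
    proof (induction rule: D_induct)
      case zero
      show ?case using base[of "{}" 0] by (simp only: scaleR_zero_left insertI1 abs_zero zero_le_one)
    next
      case (indicator t A)
      then show ?case using base by blast
    next
      case (convex a b u v)
      then show ?case by (intro dominated_convex)
    qed
    then show ?case by simp
  qed
  from this[of n a] show ?thesis using a by auto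
qed

lemma ex_small_signed_sum:
  fixes \<theta> :: real
  assumes \<theta>: "0 < \<theta>"
  obtains n where "0 < n"
    "\<And>a. (\<And>i. i < n \<Longrightarrow> a i \<in> D) \<Longrightarrow> \<exists>e. is_sign n e \<and> (\<forall>x\<in>K. \<bar>\<Sum>i<n. e i * a i x\<bar> \<le> \<theta> * n)"
proof -
  \<comment> \<open>With t = \<theta> n / 2 the error is at most \<open>t\<close> as soon as 6 n^3
    <= t^4 = \<theta>^4 n^4 / 16, that is, 96 <= \<theta>^4 n.\<close>
  obtain n :: nat where n: "n > 96 / \<theta> ^ 4"
    using reals_Archimedean2 by blast
  have "0 < 96 / \<theta> ^ 4" using \<theta> by simp
  then have n0: "0 < real n" using n by linarith
  define t where "t = \<theta> / 2 * n"
  have t: "0 < t" using \<theta> n0 by (simp add: t_def)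
  have "96 / \<theta> ^ 4 * (\<theta> ^ 4 * real n) \<le> real n * (\<theta> ^ 4 * real n)"
    using n n0 \<theta> by (intro mult_right_mono) auto
  then have *: "96 * real n \<le> \<theta> ^ 4 * (real n)\<^sup>2"
    using \<theta> by (simp add: power2_eq_square mult_ac)
  have "(real n + 1) * (3 * (real n)\<^sup>2) \<le> (2 * real n) * (3 * (real n)\<^sup>2)"
    using n0 by (intro mult_right_mono) auto
  also have "\<dots> = (real n)\<^sup>2 * (96 * real n) / 16"
    by simp
  also have "\<dots> \<le> (real n)\<^sup>2 * (\<theta> ^ 4 * (real n)\<^sup>2) / 16"
    using * by (intro divide_right_mono mult_left_mono) auto
  also have "\<dots> = t * t ^ 3"
    by (simp add: t_def power2_eq_square power3_eq_cube power4_eq_xxxx)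
  finally have "(real n + 1) * (3 * (real n)\<^sup>2) / t ^ 3 \<le> t"
    using t by (simp add: pos_divide_le_eq)
  then have le: "t + (real n + 1) * (3 * (real n)\<^sup>2) / t ^ 3 \<le> \<theta> * n"
    by (simp add: t_def)
  show ?thesis
  proof (rule that)
    fix a assume "\<And>i. i < n \<Longrightarrow> a i \<in> D"
    then have "dominated n a (t + (real n + 1) * (3 * (real n)\<^sup>2) / t ^ 3)"
      by (rule dominated_D[OF _ t])
    then obtain M where M: "\<And>e x. is_sign n e \<Longrightarrow> x \<in> K \<Longrightarrow> \<bar>\<Sum>i<n. e i * a i x\<bar> \<le> M e"
        "sign_mean n M \<le> t + (real n + 1) * (3 * (real n)\<^sup>2) / t ^ 3"
      unfolding dominated_def by blast
    obtain e where "is_sign n e" "M e \<le> sign_mean n M"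
      using ex_sign_le_mean[of n M] by blast
    moreover have "M e \<le> \<theta> * n"
      using calculation(2) M(2) le by linarith
    ultimately show "\<exists>e. is_sign n e \<and> (\<forall>x\<in>K. \<bar>\<Sum>i<n. e i * a i x\<bar> \<le> \<theta> * n)"
      using M(1) order.trans by blast
  qed (use n0 in auto)
qed


subsection \<open>The interpolation space\<close>

definition approx :: "real \<Rightarrow> real \<Rightarrow> ('k \<Rightarrow> real) \<Rightarrow> bool" where
  "approx A B f \<longleftrightarrow> 0 \<le> A \<and> 0 \<le> B \<and> (\<exists>a\<in>D. \<forall>x\<in>K. \<bar>f x - A * a x\<bar> \<le> B)"

text \<open>The K-functional of \<open>f\<close> between the gauge of \<open>D\<close> and the sup norm at the scale \<open>2 ^ j\<close>; the
  infimum is over the empty set, hence meaningless, unless \<open>f\<close> is bounded on \<open>K\<close>.\<close>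

definition q :: "nat \<Rightarrow> ('k \<Rightarrow> real) \<Rightarrow> real" where
  "q j f = Inf {A / 2 ^ j + 2 ^ j * B | A B. approx A B f}"

definition bdd :: "('k \<Rightarrow> real) \<Rightarrow> bool" where
  "bdd f \<longleftrightarrow> (\<exists>B. \<forall>x\<in>K. \<bar>f x\<bar> \<le> B)"

lemma approx_sup: "0 \<le> B \<Longrightarrow> (\<And>x. x \<in> K \<Longrightarrow> \<bar>f x\<bar> \<le> B) \<Longrightarrow> approx 0 B f"
  unfolding approx_def using zero_D by auto

lemma approx_add:
  assumes "approx A B f" "approx A' B' g"
  shows "approx (A + A') (B + B') (f + g)"
proof -
  obtain a where a: "a \<in> D" "\<And>x. x \<in> K \<Longrightarrow> \<bar>f x - A * a x\<bar> \<le> B"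
    using assms(1) by (auto simp: approx_def)
  obtain b where b: "b \<in> D" "\<And>x. x \<in> K \<Longrightarrow> \<bar>g x - A' * b x\<bar> \<le> B'"
    using assms(2) by (auto simp: approx_def)
  have pos: "0 \<le> A" "0 \<le> A'" "0 \<le> B" "0 \<le> B'"
    using assms by (auto simp: approx_def)
  obtain c where c: "c \<in> D" "\<And>x. (A + A') * c x = A * a x + A' * b x"
  proof (cases "A + A' = 0")
    case True
    then have "A = 0" "A' = 0" using pos by auto
    then show ?thesis using that zero_D by auto
  next
    case False
    then have "A / (A + A') + A' / (A + A') = 1"
      by (simp add: add_divide_distrib[symmetric])
    then have "(A / (A + A')) *\<^sub>R a + (A' / (A + A')) *\<^sub>R b \<in> D"
      using pos a b by (intro convex_D) auto
    moreover have "(A + A') * ((A / (A + A')) *\<^sub>R a + (A' / (A + A')) *\<^sub>R b) x = A * a x + A' * b x" for x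
      using False by (simp add: distrib_left)
    ultimately show ?thesis using that by blast
  qed
  have "\<bar>(f + g) x - (A + A') * c x\<bar> \<le> B + B'" if "x \<in> K" for x
    using a(2)[OF that] b(2)[OF that] unfolding c plus_fun_apply by linarith
  then show ?thesis
    unfolding approx_def using pos c(1) by auto
qed

lemma approx_scale:
  assumes "approx A B f"
  shows "approx (\<bar>c\<bar> * A) (\<bar>c\<bar> * B) (c *\<^sub>R f)"
proof -
  obtain a where a: "a \<in> D" "\<And>x. x \<in> K \<Longrightarrow> \<bar>f x - A * a x\<bar> \<le> B" "0 \<le> A" "0 \<le> B"
    using assms by (auto simp: approx_def)
  have "\<bar>(c *\<^sub>R f) x - \<bar>c\<bar> * A * (sgn c *\<^sub>R a) x\<bar> \<le> \<bar>c\<bar> * B" if "x \<in> K" for x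
  proof -
    have "\<bar>c\<bar> * A * (sgn c *\<^sub>R a) x = (\<bar>c\<bar> * sgn c) * (A * a x)"
      by simp
    also have "\<dots> = c * (A * a x)"
      by (simp add: abs_mult_sgn)
    finally have "(c *\<^sub>R f) x - \<bar>c\<bar> * A * (sgn c *\<^sub>R a) x = c * (f x - A * a x)"
      by (simp add: right_diff_distrib)
    then show ?thesis
      using a(2)[OF that] by (simp add: abs_mult mult_left_mono)
  qed
  moreover have "sgn c *\<^sub>R a \<in> D"
    using a(1) by (intro scale_D) (auto simp: sgn_real_def)
  ultimately show ?thesis
    unfolding approx_def using a(3,4) by (intro conjI bexI[of _ "sgn c *\<^sub>R a"] ballI) auto
qed

lemma q_le: "approx A B f \<Longrightarrow> q j f \<le> A / 2 ^ j + 2 ^ j * B"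
  unfolding q_def by (intro cInf_lower) (auto intro!: bdd_belowI[of _ 0] simp: approx_def)

lemma bdd_approx: "bdd f \<Longrightarrow> \<exists>B. approx 0 B f"
  unfolding bdd_def by (metis approx_sup abs_ge_zero order.trans ex_in_conv empty_iff le_cases)

lemma ex_approx_less:
  assumes "bdd f" "q j f < r"
  obtains A B where "approx A B f" "A / 2 ^ j + 2 ^ j * B < r"
proof -
  have "{A / 2 ^ j + 2 ^ j * B | A B. approx A B f} \<noteq> {}"
    using bdd_approx[OF assms(1)] by blast
  from cInf_lessD[OF this] show ?thesis
    using assms(2) that unfolding q_def by blast
qed

lemma q_nonneg: "bdd f \<Longrightarrow> 0 \<le> q j f"
proof (rule ccontr)
  assume "bdd f" "\<not> 0 \<le> q j f"
  then obtain A B where "approx A B f" "A / 2 ^ j + 2 ^ j * B < 0"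
    using ex_approx_less[of f j 0] by auto
  moreover from this have "0 \<le> A / 2 ^ j + 2 ^ j * B"
    by (intro add_nonneg_nonneg) (auto simp: approx_def)
  ultimately show False by simp
qed

lemma bdd_add: "bdd f \<Longrightarrow> bdd g \<Longrightarrow> bdd (f + g)"
  unfolding bdd_def plus_fun_apply by (meson abs_triangle_ineq add_mono order.trans)

lemma bdd_scale: "bdd f \<Longrightarrow> bdd (c *\<^sub>R f)"
  unfolding bdd_def scaleR_fun_apply real_scaleR_def abs_mult by (meson abs_ge_zero mult_left_mono)

lemma q_add:
  assumes "bdd f" "bdd g"
  shows "q j (f + g) \<le> q j f + q j g"
proof (rule field_le_epsilon)
  fix e :: real assume "0 < e"
  then obtain A B A' B' where "approx A B f" "A / 2 ^ j + 2 ^ j * B < q j f + e / 2"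
    "approx A' B' g" "A' / 2 ^ j + 2 ^ j * B' < q j g + e / 2"
    using ex_approx_less[OF assms(1), of j "q j f + e / 2"]
      ex_approx_less[OF assms(2), of j "q j g + e / 2"] by (metis half_gt_zero less_add_same_cancel1)
  moreover from this have "q j (f + g) \<le> (A + A') / 2 ^ j + 2 ^ j * (B + B')"
    by (intro q_le approx_add)
  ultimately show "q j (f + g) \<le> q j f + q j g + e"
    by (simp add: add_divide_distrib distrib_left)
qed

lemma q_scale_le:
  assumes "bdd f"
  shows "q j (c *\<^sub>R f) \<le> \<bar>c\<bar> * q j f"
proof (rule field_le_epsilon)
  fix e :: real assume e: "0 < e"
  then have "q j f < q j f + e / (\<bar>c\<bar> + 1)" by simp
  then obtain A B where AB: "approx A B f" "A / 2 ^ j + 2 ^ j * B < q j f + e / (\<bar>c\<bar> + 1)"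
    using ex_approx_less[OF assms] by blast
  have "q j (c *\<^sub>R f) \<le> (\<bar>c\<bar> * A) / 2 ^ j + 2 ^ j * (\<bar>c\<bar> * B)"
    using AB by (intro q_le approx_scale)
  also have "\<dots> = \<bar>c\<bar> * (A / 2 ^ j + 2 ^ j * B)"
    by (simp add: distrib_left)
  also have "\<dots> \<le> \<bar>c\<bar> * (q j f + e / (\<bar>c\<bar> + 1))"
    using AB by (intro mult_left_mono) auto
  also have "\<dots> \<le> \<bar>c\<bar> * q j f + e"
    using e by (simp add: distrib_left pos_divide_le_eq)
  finally show "q j (c *\<^sub>R f) \<le> \<bar>c\<bar> * q j f + e" .
qed

lemma q_scale:
  assumes "bdd f"
  shows "q j (c *\<^sub>R f) = \<bar>c\<bar> * q j f"
proof (cases "c = 0")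
  case True
  then show ?thesis
    using q_scale_le[OF assms, of j c] q_nonneg[OF bdd_scale[OF assms], of j c] by simp
next
  case False
  have "q j f = q j (inverse c *\<^sub>R (c *\<^sub>R f))"
    using False by simp
  also have "\<dots> \<le> \<bar>inverse c\<bar> * q j (c *\<^sub>R f)"
    using assms by (intro q_scale_le bdd_scale)
  finally have "\<bar>c\<bar> * q j f \<le> q j (c *\<^sub>R f)"
    using False by (simp add: field_simps)
  then show ?thesis
    using q_scale_le[OF assms, of j c] by simp
qed

text \<open>Functions in \<open>D\<close> are bounded by 1, so \<open>approx A B f\<close> gives |f|
  <= A + B, which is at most 2^j times the cost A / 2^j + 2^j B. For j = 0 this bounds point
  evaluations by \<open>N\<close>.\<close>

lemma abs_le_q:
  assumes "bdd f" "x \<in> K"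
  shows "\<bar>f x\<bar> \<le> 2 ^ j * q j f"
proof -
  have "\<bar>f x\<bar> / 2 ^ j \<le> q j f"
  proof (rule ccontr)
    assume "\<not> \<bar>f x\<bar> / 2 ^ j \<le> q j f"
    then obtain A B where AB: "approx A B f" "A / 2 ^ j + 2 ^ j * B < \<bar>f x\<bar> / 2 ^ j"
      using ex_approx_less[OF assms(1)] by (metis not_le)
    then obtain a where a: "a \<in> D" "\<bar>f x - A * a x\<bar> \<le> B" "0 \<le> A" "0 \<le> B"
      using assms(2) by (auto simp: approx_def)
    have "\<bar>A * a x\<bar> \<le> A"
      using D_abs_le_1[OF a(1), of x] a(3) by (simp add: abs_mult mult_left_le)
    then have "\<bar>f x\<bar> \<le> A + B"
      using a(2) by linarith
    also have "\<dots> \<le> A + 2 ^ j * (2 ^ j * B)"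
      using a(4) by (simp add: mult_le_cancel_right1 mult.assoc[symmetric] power_add[symmetric])
    finally have "\<bar>f x\<bar> / 2 ^ j \<le> A / 2 ^ j + 2 ^ j * B"
      by (simp add: pos_divide_le_eq field_simps)
    then show False using AB by simp
  qed
  then show ?thesis by (simp add: pos_divide_le_eq mult.commute)
qed

lemma q_le_sup: "0 \<le> B \<Longrightarrow> (\<And>x. x \<in> K \<Longrightarrow> \<bar>f x\<bar> \<le> B) \<Longrightarrow> q j f \<le> 2 ^ j * B"
  using q_le[OF approx_sup, of B f j] by simp

text \<open>Only the values on \<open>K\<close> enter \<open>q\<close>; demanding 0 off
  \<open>K\<close> makes \<open>N\<close> definite.\<close>

definition V :: "('k \<Rightarrow> real) set" where
  "V = {f. (\<forall>x. x \<notin> K \<longrightarrow> f x = 0) \<and> bdd f \<and> summable (\<lambda>j. (q j f)\<^sup>2)}"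

definition N :: "('k \<Rightarrow> real) \<Rightarrow> real" where
  "N f = sqrt (\<Sum>j. (q j f)\<^sup>2)"

lemma V_bdd: "f \<in> V \<Longrightarrow> bdd f"
  by (simp add: V_def)

lemma N_nonneg: "f \<in> V \<Longrightarrow> 0 \<le> N f"
  by (simp add: N_def V_def suminf_nonneg)

lemma L2_set_le_N:
  assumes "f \<in> V"
  shows "L2_set (\<lambda>j. q j f) {..<n} \<le> N f"
  unfolding L2_set_def N_def using assms
  by (intro real_sqrt_le_mono sum_le_suminf) (auto simp: V_def)

lemma q_le_N:
  assumes "f \<in> V"
  shows "q j f \<le> N f"
proof -
  have "q j f \<le> L2_set (\<lambda>j. q j f) {..<Suc j}"
    by (intro member_le_L2_set) auto
  then show ?thesis using L2_set_le_N[OF assms, of "Suc j"] by simp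
qed

lemma V_abs_le_N: "f \<in> V \<Longrightarrow> x \<in> K \<Longrightarrow> \<bar>f x\<bar> \<le> N f"
  using abs_le_q[OF V_bdd, of f x 0] q_le_N[of f 0] by simp

text \<open>Works with finite partial norms, for which \<open>L2_set\<close> has Minkowski's
  inequality; membership and the norm bound then come together.\<close>

lemma VI:
  assumes "\<And>x. x \<notin> K \<Longrightarrow> f x = 0" "bdd f"
    and c: "\<And>n. L2_set (\<lambda>j. q j f) {..<n} \<le> c"
  shows "f \<in> V" "N f \<le> c"
proof -
  have "0 \<le> c" using c[of 0] by simp
  have le: "(\<Sum>j<n. (q j f)\<^sup>2) \<le> c\<^sup>2" for n
    using c[of n] by (intro sqrt_le_D) (simp add: L2_set_def)
  have sum: "summable (\<lambda>j. (q j f)\<^sup>2)"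
    using le[of "Suc n" for n] by (intro bounded_imp_summable[of _ "c\<^sup>2"])
      (auto simp only: lessThan_Suc_atMost zero_le_power2)
  then show "f \<in> V" using assms by (auto simp: V_def)
  have "(\<Sum>j. (q j f)\<^sup>2) \<le> c\<^sup>2"
    using sum le by (intro suminf_le_const)
  then show "N f \<le> c"
    unfolding N_def using \<open>0 \<le> c\<close> by (intro real_le_lsqrt) auto
qed

lemma V_add:
  assumes "f \<in> V" "g \<in> V"
  shows "f + g \<in> V" "N (f + g) \<le> N f + N g"
proof -
  have "L2_set (\<lambda>j. q j (f + g)) {..<n} \<le> N f + N g" for n
  proof -
    have "L2_set (\<lambda>j. q j (f + g)) {..<n} \<le> L2_set (\<lambda>j. q j f + q j g) {..<n}"
      using assms by (intro L2_set_mono q_add q_nonneg bdd_add) (auto simp: V_bdd)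
    also have "\<dots> \<le> L2_set (\<lambda>j. q j f) {..<n} + L2_set (\<lambda>j. q j g) {..<n}"
      by (rule L2_set_triangle_ineq)
    also have "\<dots> \<le> N f + N g"
      using assms by (intro add_mono L2_set_le_N)
    finally show ?thesis .
  qed
  then show "f + g \<in> V" "N (f + g) \<le> N f + N g"
    using assms VI[of "f + g" "N f + N g"] by (auto simp: V_def bdd_add)
qed

lemma V_scale:
  assumes "f \<in> V"
  shows "c *\<^sub>R f \<in> V" "N (c *\<^sub>R f) = \<bar>c\<bar> * N f"
proof -
  have f: "bdd f" "summable (\<lambda>j. (q j f)\<^sup>2)" using assms by (auto simp: V_def)
  have eq: "(\<lambda>j. (q j (c *\<^sub>R f))\<^sup>2) = (\<lambda>j. c\<^sup>2 * (q j f)\<^sup>2)"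
    using q_scale[OF f(1)] by (simp add: power_mult_distrib)
  show "c *\<^sub>R f \<in> V"
    unfolding V_def mem_Collect_eq eq using assms
    by (auto intro!: bdd_scale summable_mult f simp: V_def)
  show "N (c *\<^sub>R f) = \<bar>c\<bar> * N f"
    unfolding N_def eq suminf_mult[OF f(2)] by (simp add: real_sqrt_mult)
qed

lemma zero_V: "0 \<in> V" and N_zero: "N 0 = 0"
proof -
  have *: "bdd 0" by (auto simp: bdd_def)
  have "q j 0 = 0" for j
    using q_scale[OF *, of j 0] by simp
  then show "0 \<in> V" "N 0 = 0" using * by (auto simp: V_def N_def)
qed

lemma V_diff:
  assumes "f \<in> V" "g \<in> V"
  shows "f - g \<in> V"
  using V_add(1)[OF assms(1) V_scale(1)[OF assms(2), of "-1"]] by simp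

lemma normed_V: "normed_space V N"
  unfolding normed_space_def
proof (intro conjI ballI allI)
  show "subspace V"
    using zero_V V_add V_scale by (auto simp: subspace_def)
  fix f assume f: "f \<in> V"
  show "N f = 0 \<longleftrightarrow> f = 0"
  proof
    assume "N f = 0"
    then have "f x = 0" for x
      using V_abs_le_N[OF f, of x] f by (cases "x \<in> K") (auto simp: V_def)
    then show "f = 0" by auto
  qed (use N_zero in auto)
qed (use N_nonneg V_add V_scale in auto)

text \<open>The norm is lower semicontinuous for uniform convergence, so a Cauchy sequence for \<open>N\<close>
  converges in \<open>N\<close> to its uniform limit.\<close>

lemma complete_V:
  fixes \<sigma> :: "nat \<Rightarrow> 'k \<Rightarrow> real"
  assumes "range \<sigma> \<subseteq> V" and cauchy: "\<And>e. 0 < e \<Longrightarrow> \<exists>M. \<forall>m n. M \<le> m \<longrightarrow> M \<le> n \<longrightarrow> N (\<sigma> m - \<sigma> n) < e"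
  shows "\<exists>f\<in>V. \<forall>e>0. \<exists>M. \<forall>n\<ge>M. N (f - \<sigma> n) \<le> e"
proof -
  have \<sigma>: "\<sigma> n \<in> V" for n using assms(1) by auto
  define f where "f x = (if x \<in> K then lim (\<lambda>n. \<sigma> n x) else 0)" for x
  have lim: "(\<lambda>n. \<sigma> n x) \<longlonglongrightarrow> f x" if x: "x \<in> K" for x
  proof -
    have "Cauchy (\<lambda>n. \<sigma> n x)"
    proof (rule metric_CauchyI)
      fix e :: real assume "0 < e"
      then obtain M where M: "\<forall>m n. M \<le> m \<longrightarrow> M \<le> n \<longrightarrow> N (\<sigma> m - \<sigma> n) < e"
        using cauchy by blast
      have "dist (\<sigma> m x) (\<sigma> n x) < e" if "M \<le> m" "M \<le> n" for m n
        using V_abs_le_N[OF V_diff[OF \<sigma> \<sigma>] x, of m n] M that by (force simp: dist_real_def)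
      then show "\<exists>M. \<forall>m\<ge>M. \<forall>n\<ge>M. dist (\<sigma> m x) (\<sigma> n x) < e" by blast
    qed
    then show ?thesis
      using x by (simp add: f_def Cauchy_convergent convergent_LIMSEQ_iff[symmetric])
  qed
  have unif: "\<exists>M. \<forall>n\<ge>M. \<forall>x\<in>K. \<bar>f x - \<sigma> n x\<bar> \<le> e" if e: "0 < e" for e
  proof -
    obtain M where M: "\<And>m n. M \<le> m \<Longrightarrow> M \<le> n \<Longrightarrow> N (\<sigma> m - \<sigma> n) < e"
      using cauchy[OF e] by blast
    have "\<bar>f x - \<sigma> n x\<bar> \<le> e" if "M \<le> n" "x \<in> K" for n x
    proof (rule tendsto_upperbound)
      show "(\<lambda>m. \<bar>\<sigma> m x - \<sigma> n x\<bar>) \<longlonglongrightarrow> \<bar>f x - \<sigma> n x\<bar>"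
        using lim[OF that(2)] by (intro tendsto_intros)
      show "\<forall>\<^sub>F m in sequentially. \<bar>\<sigma> m x - \<sigma> n x\<bar> \<le> e"
        using eventually_ge_at_top[of M]
      proof eventually_elim
        case (elim m)
        then show ?case
          using V_abs_le_N[OF V_diff[OF \<sigma> \<sigma>] that(2), of m n] M[of m n] that(1) by simp
      qed
    qed auto
    then show ?thesis by blast
  qed
  have bdd: "bdd (f - \<sigma> n)" for n
  proof -
    obtain m where m: "\<forall>x\<in>K. \<bar>f x - \<sigma> m x\<bar> \<le> 1" using unif[of 1] by auto
    have "bdd (f - \<sigma> m)" using m by (auto simp: bdd_def)
    then have "bdd ((f - \<sigma> m) + (\<sigma> m - \<sigma> n))"
      using V_diff[OF \<sigma> \<sigma>] by (intro bdd_add) (auto simp: V_bdd)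
    then show ?thesis by simp
  qed
  have main: "f - \<sigma> n \<in> V \<and> N (f - \<sigma> n) \<le> e"
    if M: "\<And>m. M \<le> m \<Longrightarrow> N (\<sigma> m - \<sigma> n) < e" for M n e
  proof -
    have "L2_set (\<lambda>j. q j (f - \<sigma> n)) {..<k} \<le> e" for k
    proof (rule field_le_epsilon)
      fix d :: real assume d: "0 < d"
      \<comment> \<open>\<open>q j\<close> is at most 2^j times the sup norm, and the factors 2^j
        with j < k add up to less than 2^k.\<close>
      define d' where "d' = d / 2 ^ k"
      have d': "0 < d'" using d by (simp add: d'_def)
      obtain M' where M': "\<forall>n\<ge>M'. \<forall>x\<in>K. \<bar>f x - \<sigma> n x\<bar> \<le> d'" using unif[OF d'] by blast
      define m where "m = max M M'"
      have "L2_set (\<lambda>j. q j (f - \<sigma> n)) {..<k} \<le>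
          L2_set (\<lambda>j. q j (\<sigma> m - \<sigma> n) + q j (f - \<sigma> m)) {..<k}"
      proof (intro L2_set_mono)
        fix j
        show "q j (f - \<sigma> n) \<le> q j (\<sigma> m - \<sigma> n) + q j (f - \<sigma> m)"
          using q_add[OF V_bdd[OF V_diff[OF \<sigma>[of m] \<sigma>[of n]]] bdd[of m], of j] by simp
      qed (use bdd q_nonneg in auto)
      also have "\<dots> \<le> L2_set (\<lambda>j. q j (\<sigma> m - \<sigma> n)) {..<k} + L2_set (\<lambda>j. q j (f - \<sigma> m)) {..<k}"
        by (rule L2_set_triangle_ineq)
      also have "\<dots> \<le> e + (\<Sum>j<k. q j (f - \<sigma> m))"
      proof (intro add_mono)
        show "L2_set (\<lambda>j. q j (\<sigma> m - \<sigma> n)) {..<k} \<le> e"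
          using L2_set_le_N[OF V_diff[OF \<sigma> \<sigma>], of m n k] M[of m] by (simp add: m_def)
      qed (use bdd q_nonneg in \<open>auto intro!: L2_set_le_sum\<close>)
      finally have le: "L2_set (\<lambda>j. q j (f - \<sigma> n)) {..<k} \<le> e + (\<Sum>j<k. q j (f - \<sigma> m))" .
      have "(\<Sum>j<k. q j (f - \<sigma> m)) \<le> (\<Sum>j<k. 2 ^ j * d')"
        using M' d' by (intro sum_mono q_le_sup) (auto simp: m_def)
      also have "\<dots> = (2 ^ k - 1) * d'"
        by (induction k) (auto simp: algebra_simps)
      also have "\<dots> \<le> d"
        using d by (simp add: d'_def field_simps)
      finally show "L2_set (\<lambda>j. q j (f - \<sigma> n)) {..<k} \<le> e + d"
        using le by linarith
    qed
    then show ?thesis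
      using VI[of "f - \<sigma> n" e] bdd[of n] \<sigma>[of n] by (auto simp: V_def f_def)
  qed
  have "f \<in> V"
  proof -
    obtain M where M: "\<And>m n. M \<le> m \<Longrightarrow> M \<le> n \<Longrightarrow> N (\<sigma> m - \<sigma> n) < 1"
      using cauchy[of 1] by auto
    have "f - \<sigma> M \<in> V" using main[of M M 1] M by auto
    from V_add(1)[OF this \<sigma>[of M]] show ?thesis by simp
  qed
  moreover have "\<exists>M. \<forall>n\<ge>M. N (f - \<sigma> n) \<le> e" if "0 < e" for e
  proof -
    obtain M where "\<And>m n. M \<le> m \<Longrightarrow> M \<le> n \<Longrightarrow> N (\<sigma> m - \<sigma> n) < e"
      using cauchy[OF \<open>0 < e\<close>] by blast
    then have "\<forall>n\<ge>M. N (f - \<sigma> n) \<le> e"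
      using main by blast
    then show ?thesis ..
  qed
  ultimately show ?thesis by blast
qed

lemma Banach_V: "Banach_space V N"
proof -
  interpret Metric_space V "norm_dist V N"
    by (rule Metric_space_norm_dist[OF normed_V])
  have "mcomplete"
    unfolding mcomplete_def
  proof (intro allI impI)
    fix \<sigma> assume "MCauchy \<sigma>"
    then have ran: "range \<sigma> \<subseteq> V"
      and c: "\<And>e. 0 < e \<Longrightarrow> \<exists>M. \<forall>m n. M \<le> m \<longrightarrow> M \<le> n \<longrightarrow> norm_dist V N (\<sigma> m) (\<sigma> n) < e"
      by (auto simp: MCauchy_def)
    have \<sigma>: "\<sigma> n \<in> V" for n using ran by auto
    have "\<exists>f\<in>V. \<forall>e>0. \<exists>M. \<forall>n\<ge>M. N (f - \<sigma> n) \<le> e"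
      using c by (intro complete_V[OF ran]) (simp add: norm_dist_def \<sigma>)
    then obtain f where f: "f \<in> V" "\<forall>e>0. \<exists>M. \<forall>n\<ge>M. N (f - \<sigma> n) \<le> e"
      by (rule bexE)
    have "\<exists>M. \<forall>n\<ge>M. \<sigma> n \<in> V \<and> norm_dist V N (\<sigma> n) f < e" if e: "0 < e" for e
    proof -
      obtain M where M: "\<And>n. M \<le> n \<Longrightarrow> N (f - \<sigma> n) \<le> e / 2"
        using f(2) half_gt_zero[OF e] by blast
      have "norm_dist V N (\<sigma> n) f < e" if "M \<le> n" for n
        unfolding commute[of "\<sigma> n" f] using M[OF that] e by (simp only: norm_dist_def f(1) \<sigma> if_True conj_absorb)
      then show ?thesis using \<sigma> by blast
    qed
    then have "limitin mtopology \<sigma> f sequentially"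
      using f(1) by (auto simp: limitin_metric eventually_sequentially)
    then show "\<exists>x. limitin mtopology \<sigma> x sequentially" by blast
  qed
  then show ?thesis
    using normed_V by (simp add: Banach_space_def)
qed

end


subsection \<open>The interpolation space contains no copy of \<open>\<ell>\<^sub>1\<close>\<close>

definition unit_vec :: "nat \<Rightarrow> nat \<Rightarrow> real" where
  "unit_vec i k = (if k = i then 1 else 0)"

lemma sum_unit_vec:
  "(\<Sum>i<n. a i *\<^sub>R unit_vec (p + i)) k = (if p \<le> k \<and> k < p + n then a (k - p) else 0)"
  by (induction n) (auto simp: unit_vec_def)

lemma finite_support_ell1:
  assumes "\<And>i. p \<le> i \<Longrightarrow> w i = 0"
  shows "w \<in> ell1" "ell1_norm w = (\<Sum>i<p. \<bar>w i\<bar>)"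
proof -
  show "w \<in> ell1"
    unfolding ell1_def mem_Collect_eq using assms
    by (intro summable_finite[of "{..<p}"]) (auto simp: not_less)
  show "ell1_norm w = (\<Sum>i<p. \<bar>w i\<bar>)"
    unfolding ell1_norm_def using assms
    by (intro suminf_finite) (auto simp: not_less)
qed

lemma linear_map_on_sum_unit_vec:
  assumes "linear_map_on ell1 T"
  shows "T (\<Sum>i<n. a i *\<^sub>R unit_vec (p + i)) = (\<Sum>i<n. a i *\<^sub>R T (unit_vec (p + i)))"
proof (induction n)
  case 0
  have "(0 :: nat \<Rightarrow> real) \<in> ell1"
    by (rule finite_support_ell1[of 0]) auto
  then have "T (0 *\<^sub>R 0) = 0 *\<^sub>R T 0"
    using assms unfolding linear_map_on_def by blast
  then show ?case by (simp only: scaleR_zero_left lessThan_0 sum.empty)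
next
  case (Suc n)
  have u: "unit_vec (p + n) \<in> ell1"
    by (rule finite_support_ell1[of "Suc (p + n)"]) (auto simp: unit_vec_def)
  have au: "a n *\<^sub>R unit_vec (p + n) \<in> ell1"
    by (rule finite_support_ell1[of "Suc (p + n)"]) (auto simp: unit_vec_def)
  have s: "(\<Sum>i<n. a i *\<^sub>R unit_vec (p + i)) \<in> ell1"
    by (rule finite_support_ell1[of "p + n"]) (auto simp: sum_unit_vec)
  have "T ((\<Sum>i<n. a i *\<^sub>R unit_vec (p + i)) + a n *\<^sub>R unit_vec (p + n)) =
      T (\<Sum>i<n. a i *\<^sub>R unit_vec (p + i)) + T (a n *\<^sub>R unit_vec (p + n))"
    using assms s au unfolding linear_map_on_def by blast
  moreover have "T (a n *\<^sub>R unit_vec (p + n)) = a n *\<^sub>R T (unit_vec (p + n))"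
    using assms u unfolding linear_map_on_def by blast
  ultimately show ?case
    by (simp only: Suc sum.lessThan_Suc)
qed

context nested_family
begin

text \<open>A bound on \<open>N\<close> bounds \<open>q j\<close> at every scale. At a late scale
  the error of the decomposition is at most \<eta> / 2, so all \<open>f i\<close> are uniformly
  close to one and the same multiple of \<open>D\<close>, and the signs found for \<open>D\<close>
  apply.\<close>

lemma ex_signs_small_sup:
  fixes \<eta> :: real
  assumes f: "\<And>i. f i \<in> V" "\<And>i. N (f i) \<le> C" and \<eta>: "0 < \<eta>"
  shows "\<exists>n e. 0 < n \<and> is_sign n e \<and> (\<forall>x\<in>K. \<bar>\<Sum>i<n. e i * f i x\<bar> \<le> \<eta> * n)"
proof -
  \<comment> \<open>Strictly above \<open>C\<close>, so that the infimum defining \<open>q j\<close>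
    has a competitor of cost below it.\<close>
  define C' where "C' = \<bar>C\<bar> + 1"
  have C': "0 < C'" "C < C'" by (auto simp: C'_def)
  obtain j where j: "2 * C' / \<eta> < 2 ^ j"
    using real_arch_pow[of 2] by auto
  then have j': "C' / 2 ^ j \<le> \<eta> / 2"
    using \<eta> by (simp add: field_simps)
  define A0 where "A0 = 2 ^ j * C'"
  have A0: "0 < A0" using C' by (simp add: A0_def)
  have "\<exists>b\<in>D. \<forall>x\<in>K. \<bar>f i x - A0 * b x\<bar> \<le> \<eta> / 2" for i
  proof -
    have "q j (f i) < C'"
      using q_le_N[OF f(1), of j i] f(2)[of i] C' by linarith
    then obtain A B where AB: "approx A B (f i)" "A / 2 ^ j + 2 ^ j * B < C'"
      using ex_approx_less V_bdd[OF f(1)] by blast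
    then obtain a where a: "a \<in> D" "\<And>x. x \<in> K \<Longrightarrow> \<bar>f i x - A * a x\<bar> \<le> B" "0 \<le> A" "0 \<le> B"
      by (auto simp: approx_def)
    have "0 \<le> A / 2 ^ j" "0 \<le> 2 ^ j * B"
      using a(3,4) by simp_all
    then have lt: "A / 2 ^ j < C'" "2 ^ j * B < C'"
      using AB(2) by linarith+
    have "B < C' / 2 ^ j"
      using lt(2) by (simp add: pos_less_divide_eq mult.commute)
    then have le: "A \<le> A0" "B \<le> \<eta> / 2"
      using j' lt(1) by (simp add: A0_def pos_divide_less_eq mult.commute, linarith)
    have "(A / A0) *\<^sub>R a \<in> D"
      using a le A0 by (intro scale_D) auto
    moreover have "\<bar>f i x - A0 * ((A / A0) *\<^sub>R a) x\<bar> \<le> \<eta> / 2" if "x \<in> K" for x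
    proof -
      have "A0 * ((A / A0) *\<^sub>R a) x = A * a x"
        using A0 by simp
      then show ?thesis
        using a(2)[OF that] le(2) by linarith
    qed
    ultimately show ?thesis by blast
  qed
  then obtain b where b: "\<And>i. b i \<in> D" "\<And>i x. x \<in> K \<Longrightarrow> \<bar>f i x - A0 * b i x\<bar> \<le> \<eta> / 2"
    by metis
  \<comment> \<open>Dividing by \<open>A0\<close> compensates the multiple of \<open>D\<close>; one
    half of \<eta> pays for the approximation errors, the other for the signed sum in
    \<open>D\<close>.\<close>
  have "0 < \<eta> / 2 / A0" using \<eta> A0 by simp
  from ex_small_signed_sum[OF this] obtain n where n: "0 < n"
    "\<And>a. (\<And>i. i < n \<Longrightarrow> a i \<in> D) \<Longrightarrow>
      \<exists>e. is_sign n e \<and> (\<forall>x\<in>K. \<bar>\<Sum>i<n. e i * a i x\<bar> \<le> \<eta> / 2 / A0 * n)"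
    by blast
  then obtain e where e: "is_sign n e" "\<And>x. x \<in> K \<Longrightarrow> \<bar>\<Sum>i<n. e i * b i x\<bar> \<le> \<eta> / 2 / A0 * n"
    using b(1) by blast
  have "\<bar>\<Sum>i<n. e i * f i x\<bar> \<le> \<eta> * n" if x: "x \<in> K" for x
  proof -
    have "(\<Sum>i<n. e i * f i x) = (\<Sum>i<n. e i * (f i x - A0 * b i x)) + A0 * (\<Sum>i<n. e i * b i x)"
      by (simp add: sum_distrib_left sum.distrib[symmetric] algebra_simps)
    moreover have "\<bar>\<Sum>i<n. e i * (f i x - A0 * b i x)\<bar> \<le> (\<Sum>i<n. \<eta> / 2)"
      using e(1) b(2)[OF x]
      by (intro order.trans[OF sum_abs] sum_mono) (auto simp: is_sign_def abs_mult)
    moreover have "\<bar>A0 * (\<Sum>i<n. e i * b i x)\<bar> \<le> A0 * (\<eta> / 2 / A0 * n)"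
      using e(2)[OF x] A0 by (simp only: abs_mult abs_of_pos) (intro mult_left_mono, auto)
    moreover have "A0 * (\<eta> / 2 / A0 * n) = \<eta> / 2 * n"
      using A0 by simp
    moreover have "(\<Sum>i<n. \<eta> / 2) = \<eta> / 2 * n"
      by simp
    ultimately show ?thesis by linarith
  qed
  then show ?thesis using n(1) e(1) by blast
qed

text \<open>An element of small sup norm lives on scales beyond those that matter for a given \<open>y\<close>, so
  that the two are almost orthogonal.\<close>

lemma almost_orthogonal:
  assumes y: "y \<in> V" and C: "0 \<le> C"
  obtains \<eta> where "0 < \<eta>"
    "\<And>z. z \<in> V \<Longrightarrow> N z \<le> C \<Longrightarrow> (\<And>x. x \<in> K \<Longrightarrow> \<bar>z x\<bar> \<le> \<eta>) \<Longrightarrow> (N (y + z))\<^sup>2 \<le> (N y)\<^sup>2 + C\<^sup>2 + 1"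
proof -
  \<comment> \<open>The weight in 2 a b <= a^2 / \<kappa> + \<kappa> b^2, applied to the tails. The
    excess 1 is paid in thirds: the head, the tail of \<open>y\<close>, and the tail of
    \<open>z\<close>, for which \<kappa> C^2 <= 1/3.\<close>
  define \<kappa> where "\<kappa> = 1 / (3 * (C\<^sup>2 + 1))"
  have C1: "0 < C\<^sup>2 + 1" by (simp add: add_nonneg_pos)
  then have \<kappa>: "0 < \<kappa>" by (simp add: \<kappa>_def)
  have \<kappa>C: "\<kappa> * C\<^sup>2 \<le> 1 / 3"
    using C1 by (simp add: \<kappa>_def field_simps)
  have ys: "summable (\<lambda>j. (q j y)\<^sup>2)" using y by (simp add: V_def)
  have Nsq: "(N f)\<^sup>2 = (\<Sum>j. (q j f)\<^sup>2)" if "f \<in> V" for f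
    using that by (simp add: N_def V_def suminf_nonneg)
  have "0 < \<kappa> / 3" using \<kappa> by simp
  \<comment> \<open>The tail of \<open>y\<close> will be multiplied by 1 / \<kappa>, so \<kappa> / 3
    leaves 1/3.\<close>
  from suminf_exist_split[OF this ys] obtain J
    where "\<forall>n\<ge>J. norm (\<Sum>i. (q (i + n) y)\<^sup>2) < \<kappa> / 3" by blast
  then have "norm (\<Sum>i. (q (i + J) y)\<^sup>2) < \<kappa> / 3" by blast
  then have tail: "(\<Sum>i. (q (i + J) y)\<^sup>2) \<le> \<kappa> / 3"
    by (simp only: real_norm_def)
  \<comment> \<open>For j < J, \<open>q j z\<close> is at most 2^J \<eta>, so the cross terms in the
    head add up to at most 1/3. The added ones keep the denominator positive.\<close>
  define \<eta> where "\<eta> = 1 / (6 * ((J + 1) * ((N y + 1) * 2 ^ J)))"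
  have Ny: "0 \<le> N y" using y by (rule N_nonneg)
  then have pos: "0 < (J + 1) * ((N y + 1) * 2 ^ J)"
    by (intro mult_pos_pos) auto
  then have \<eta>: "0 < \<eta>" by (simp add: \<eta>_def)
  show ?thesis
  proof (rule that[OF \<eta>])
    fix z assume z: "z \<in> V" "N z \<le> C" and small: "\<And>x. x \<in> K \<Longrightarrow> \<bar>z x\<bar> \<le> \<eta>"
    have zs: "summable (\<lambda>j. (q j z)\<^sup>2)" using z by (simp add: V_def)
    have yz: "y + z \<in> V" using V_add y z by blast
    then have yzs: "summable (\<lambda>j. (q j (y + z))\<^sup>2)" by (simp add: V_def)
    have nn: "0 \<le> q j y" "0 \<le> q j z" "0 \<le> q j (y + z)" for j
      using y z yz by (auto intro: q_nonneg V_bdd)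
    have sq: "(q j (y + z))\<^sup>2 \<le> (q j y + q j z)\<^sup>2" for j
      using y z by (intro power_mono q_add nn) (auto intro: V_bdd)
    have head: "(\<Sum>j<J. (q j (y + z))\<^sup>2) \<le> (\<Sum>j<J. (q j y)\<^sup>2) + (\<Sum>j<J. (q j z)\<^sup>2) + 1 / 3"
    proof -
      have "(q j (y + z))\<^sup>2 \<le> (q j y)\<^sup>2 + (q j z)\<^sup>2 + 2 * ((N y + 1) * (2 ^ J * \<eta>))" if "j < J" for j
      proof -
        have "q j z \<le> 2 ^ j * \<eta>"
          using \<eta> small by (intro q_le_sup) auto
        also have "\<dots> \<le> 2 ^ J * \<eta>"
          using \<eta> that by (intro mult_right_mono power_increasing) auto
        finally have "q j y * q j z \<le> (N y + 1) * (2 ^ J * \<eta>)"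
          using q_le_N[OF y, of j] nn Ny by (intro mult_mono) auto
        then show ?thesis
          using sq[of j] by (simp add: power2_sum)
      qed
      then have "(\<Sum>j<J. (q j (y + z))\<^sup>2) \<le>
          (\<Sum>j<J. (q j y)\<^sup>2 + (q j z)\<^sup>2 + 2 * ((N y + 1) * (2 ^ J * \<eta>)))"
        by (intro sum_mono) auto
      also have "\<dots> = (\<Sum>j<J. (q j y)\<^sup>2) + (\<Sum>j<J. (q j z)\<^sup>2) + real J * (2 * ((N y + 1) * (2 ^ J * \<eta>)))"
        by (simp add: sum.distrib)
      finally have le: "(\<Sum>j<J. (q j (y + z))\<^sup>2) \<le>
          (\<Sum>j<J. (q j y)\<^sup>2) + (\<Sum>j<J. (q j z)\<^sup>2) + real J * (2 * ((N y + 1) * (2 ^ J * \<eta>)))" .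
      have "real J * (2 * ((N y + 1) * (2 ^ J * \<eta>))) \<le> real (J + 1) * (2 * ((N y + 1) * (2 ^ J * \<eta>)))"
        using \<eta> Ny by (intro mult_right_mono) auto
      also have "\<dots> = 2 * (((J + 1) * ((N y + 1) * 2 ^ J)) * \<eta>)"
        by (simp only: mult_ac)
      also have "\<dots> = 1 / 3"
        using pos unfolding \<eta>_def by (subst times_divide_eq_right) (simp add: field_simps)
      finally show ?thesis using le by linarith
    qed
    note ysJ = summable_ignore_initial_segment[OF ys, of J]
      and zsJ = summable_ignore_initial_segment[OF zs, of J]
    have "(\<Sum>i. (q (i + J) (y + z))\<^sup>2) \<le>
        (\<Sum>i. (1 + 1 / \<kappa>) * (q (i + J) y)\<^sup>2 + (1 + \<kappa>) * (q (i + J) z)\<^sup>2)"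
    proof (intro suminf_le)
      fix i
      let ?a = "q (i + J) y" and ?b = "q (i + J) z"
      have "0 \<le> (?a - \<kappa> * ?b)\<^sup>2 / \<kappa>"
        using \<kappa> by simp
      also have "\<dots> = 1 / \<kappa> * ?a\<^sup>2 + \<kappa> * ?b\<^sup>2 - 2 * ?a * ?b"
        using \<kappa> by (simp add: power2_eq_square field_simps)
      finally have "2 * ?a * ?b \<le> 1 / \<kappa> * ?a\<^sup>2 + \<kappa> * ?b\<^sup>2" by simp
      then have "(?a + ?b)\<^sup>2 \<le> (1 + 1 / \<kappa>) * ?a\<^sup>2 + (1 + \<kappa>) * ?b\<^sup>2"
        by (simp add: power2_sum distrib_right)
      then show "(q (i + J) (y + z))\<^sup>2 \<le> (1 + 1 / \<kappa>) * ?a\<^sup>2 + (1 + \<kappa>) * ?b\<^sup>2"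
        using sq[of "i + J"] by simp
    qed (use ys zs yzs in \<open>auto intro!: summable_add summable_mult summable_ignore_initial_segment
        simp del: distrib_right_numeral\<close>)
    also have "\<dots> = (1 + 1 / \<kappa>) * (\<Sum>i. (q (i + J) y)\<^sup>2) + (1 + \<kappa>) * (\<Sum>i. (q (i + J) z)\<^sup>2)"
      by (simp only: suminf_add[OF summable_mult[OF ysJ] summable_mult[OF zsJ], symmetric]
          suminf_mult[OF ysJ] suminf_mult[OF zsJ])
    also have "\<dots> \<le> (\<Sum>i. (q (i + J) y)\<^sup>2) + 1 / 3 + ((\<Sum>i. (q (i + J) z)\<^sup>2) + 1 / 3)"
    proof (intro add_mono)
      have "1 / \<kappa> * (\<Sum>i. (q (i + J) y)\<^sup>2) \<le> 1 / \<kappa> * (\<kappa> / 3)"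
        using tail \<kappa> by (intro mult_left_mono) auto
      then show "(1 + 1 / \<kappa>) * (\<Sum>i. (q (i + J) y)\<^sup>2) \<le> (\<Sum>i. (q (i + J) y)\<^sup>2) + 1 / 3"
        using \<kappa> by (simp add: distrib_right)
      have "(\<Sum>i. (q (i + J) z)\<^sup>2) \<le> (N z)\<^sup>2"
        unfolding Nsq[OF z(1)] suminf_split_initial_segment[OF zs, of J]
        by (simp add: sum_nonneg)
      also have "\<dots> \<le> C\<^sup>2"
        using z N_nonneg by (intro power_mono) auto
      finally have "\<kappa> * (\<Sum>i. (q (i + J) z)\<^sup>2) \<le> \<kappa> * C\<^sup>2"
        using \<kappa> by (intro mult_left_mono) auto
      then show "(1 + \<kappa>) * (\<Sum>i. (q (i + J) z)\<^sup>2) \<le> (\<Sum>i. (q (i + J) z)\<^sup>2) + 1 / 3"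
        using \<kappa>C by (simp add: distrib_right)
    qed
    finally have tails: "(\<Sum>i. (q (i + J) (y + z))\<^sup>2) \<le>
        (\<Sum>i. (q (i + J) y)\<^sup>2) + 1 / 3 + ((\<Sum>i. (q (i + J) z)\<^sup>2) + 1 / 3)" .
    have "(N (y + z))\<^sup>2 \<le> (N y)\<^sup>2 + (N z)\<^sup>2 + 1"
      unfolding Nsq[OF y] Nsq[OF z(1)] Nsq[OF yz] suminf_split_initial_segment[OF ys, of J]
        suminf_split_initial_segment[OF zs, of J] suminf_split_initial_segment[OF yzs, of J]
      using head tails by linarith
    also have "(N z)\<^sup>2 \<le> C\<^sup>2"
      using z N_nonneg by (intro power_mono) auto
    finally show "(N (y + z))\<^sup>2 \<le> (N y)\<^sup>2 + C\<^sup>2 + 1" by simp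
  qed
qed

lemma not_contains_ell1: "\<not> contains_copy_of V N ell1 ell1_norm"
proof
  assume "contains_copy_of V N ell1 ell1_norm"
  then obtain T c C where T: "T \<in> ell1 \<rightarrow> V" "linear_map_on ell1 T" and c: "0 < c"
    and low: "\<And>w. w \<in> ell1 \<Longrightarrow> c * ell1_norm w \<le> N (T w)"
    and up: "\<And>w. w \<in> ell1 \<Longrightarrow> N (T w) \<le> C * ell1_norm w"
    unfolding contains_copy_of_def by blast
  have unit: "unit_vec i \<in> ell1" "ell1_norm (unit_vec i) = 1" for i
    using finite_support_ell1[of "Suc i" "unit_vec i"] by (auto simp: unit_vec_def)
  have TV: "T w \<in> V" if "w \<in> ell1" for w
    using T(1) that by auto
  have NT: "N (T (unit_vec i)) \<le> C" for i
    using up[OF unit(1), of i] unit(2) by simp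
  have C: "0 \<le> C"
    using NT[of 0] N_nonneg[OF TV[OF unit(1)], of 0] by linarith
  \<comment> \<open>The support of \<open>w\<close> ends before \<open>p\<close>, so the next block
    of unit vectors can start there: \<open>ell1\<close> norms add up exactly, while squared norms
    in \<open>V\<close> grow by at most C^2 + 1 per block.\<close>
  have step: "\<exists>p w. (\<forall>i\<ge>p. w i = 0) \<and> (\<Sum>i<p. \<bar>w i\<bar>) = real m \<and> (N (T w))\<^sup>2 \<le> real m * (C\<^sup>2 + 1)" for m
  proof (induction m)
    case 0
    have "T (\<Sum>i<0. 0 *\<^sub>R unit_vec (0 + i)) = 0"
      unfolding linear_map_on_sum_unit_vec[OF T(2)] by simp
    then have "T 0 = 0" by (simp only: lessThan_0 sum.empty)
    then have "(N (T 0))\<^sup>2 = 0" using N_zero by simp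
    then have "(N (T 0))\<^sup>2 \<le> real 0 * (C\<^sup>2 + 1)"
      by (simp only: of_nat_0 mult_zero_left order_refl)
    moreover have "(\<forall>i\<ge>0. (0 :: nat \<Rightarrow> real) i = 0) \<and> (\<Sum>i<0. \<bar>(0 :: nat \<Rightarrow> real) i\<bar>) = real 0"
      by simp
    ultimately show ?case by blast
  next
    case (Suc m)
    then obtain p w where w: "\<And>i. p \<le> i \<Longrightarrow> w i = 0" "(\<Sum>i<p. \<bar>w i\<bar>) = real m"
      "(N (T w))\<^sup>2 \<le> real m * (C\<^sup>2 + 1)" by blast
    have wl: "w \<in> ell1" using finite_support_ell1(1) w(1) by blast
    obtain \<eta> where \<eta>: "0 < \<eta>" and orth:
      "\<And>z. z \<in> V \<Longrightarrow> N z \<le> C \<Longrightarrow> (\<And>x. x \<in> K \<Longrightarrow> \<bar>z x\<bar> \<le> \<eta>) \<Longrightarrow>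
        (N (T w + z))\<^sup>2 \<le> (N (T w))\<^sup>2 + C\<^sup>2 + 1"
      by (rule almost_orthogonal[OF TV[OF wl] C]) blast
    obtain n e where n: "0 < n" and e: "is_sign n e"
      and small: "\<And>x. x \<in> K \<Longrightarrow> \<bar>\<Sum>i<n. e i * T (unit_vec (p + i)) x\<bar> \<le> \<eta> * n"
      using ex_signs_small_sup[OF TV[OF unit(1)] NT \<eta>, of "\<lambda>i. p + i"] by blast
    \<comment> \<open>The coefficients have modulus 1 / n, so \<open>u\<close> has
      \<open>ell1\<close> norm 1, and the bound \<eta> n on the signed sum becomes \<eta>.\<close>
    define u where "u = (\<Sum>i<n. (e i / n) *\<^sub>R unit_vec (p + i))"
    have u: "u k = (if p \<le> k \<and> k < p + n then e (k - p) / n else 0)" for k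
      unfolding u_def by (rule sum_unit_vec)
    have u0: "u i = 0" if "p + n \<le> i" for i using that by (simp add: u)
    have ul: "u \<in> ell1" using finite_support_ell1(1) u0 by blast
    have split: "(\<Sum>i<p + n. g i) = (\<Sum>i<p. g i) + (\<Sum>i<n. g (p + i))" for g :: "nat \<Rightarrow> real"
      by (induction n) auto
    have un: "(\<Sum>i<n. \<bar>u (p + i)\<bar>) = 1"
    proof -
      have "(\<Sum>i<n. \<bar>u (p + i)\<bar>) = (\<Sum>i<n. 1 / real n)"
        using e by (intro sum.cong) (auto simp: u is_sign_def)
      then show ?thesis using n by simp
    qed
    moreover have "(\<Sum>i<p. \<bar>u i\<bar>) = 0"
      by (simp add: u)
    ultimately have "ell1_norm u = 1"
      using finite_support_ell1(2)[of "p + n" u] u0 by (simp add: split)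
    then have NTu: "N (T u) \<le> C" using up[OF ul] by simp
    have Tu: "T u x = (\<Sum>i<n. e i * T (unit_vec (p + i)) x) / n" for x
    proof -
      have "(\<Sum>i<n. (e i / r) *\<^sub>R h i) x = (\<Sum>i<n. e i * h i x) / r" for h :: "nat \<Rightarrow> 'k \<Rightarrow> real" and r n
        by (induction n) (auto simp: add_divide_distrib)
      then show ?thesis
        unfolding u_def linear_map_on_sum_unit_vec[OF T(2)] .
    qed
    have "\<bar>T u x\<bar> \<le> \<eta>" if "x \<in> K" for x
      using small[OF that] n by (simp add: Tu pos_divide_le_eq)
    then have "(N (T w + T u))\<^sup>2 \<le> (N (T w))\<^sup>2 + C\<^sup>2 + 1"
      by (intro orth TV ul NTu)
    moreover have "T (w + u) = T w + T u"
      using T(2) wl ul by (simp add: linear_map_on_def)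
    ultimately have "(N (T (w + u)))\<^sup>2 \<le> real (Suc m) * (C\<^sup>2 + 1)"
      using w(3) by (simp add: algebra_simps)
    moreover have "(\<Sum>i<p + n. \<bar>(w + u) i\<bar>) = real (Suc m)"
    proof -
      have "(\<Sum>i<p. \<bar>(w + u) i\<bar>) = (\<Sum>i<p. \<bar>w i\<bar>)"
        by (intro sum.cong) (auto simp: u)
      moreover have "(\<Sum>i<n. \<bar>(w + u) (p + i)\<bar>) = (\<Sum>i<n. \<bar>u (p + i)\<bar>)"
        using w(1) by simp
      ultimately show ?thesis
        using w(2) un by (simp add: split)
    qed
    moreover have "\<forall>i\<ge>p + n. (w + u) i = 0"
      using w(1) u0 by simp
    ultimately show ?case by blast
  qed
  \<comment> \<open>Beyond this bound c m exceeds sqrt (m (C^2 + 1)).\<close>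
  obtain m :: nat where m: "m > (C\<^sup>2 + 1) / c\<^sup>2"
    using reals_Archimedean2 by blast
  have "0 < (C\<^sup>2 + 1) / c\<^sup>2"
    using c by (intro divide_pos_pos) (auto simp: add_nonneg_pos)
  then have m0: "0 < real m" using m by linarith
  obtain p w where w: "\<And>i. p \<le> i \<Longrightarrow> w i = 0" "(\<Sum>i<p. \<bar>w i\<bar>) = real m"
    "(N (T w))\<^sup>2 \<le> real m * (C\<^sup>2 + 1)"
    using step[of m] by blast
  have "w \<in> ell1" "ell1_norm w = real m"
    using finite_support_ell1[of p w] w by auto
  then have "(c * real m)\<^sup>2 \<le> (N (T w))\<^sup>2"
    using low[of w] c by (intro power_mono) auto
  also have "\<dots> \<le> real m * (C\<^sup>2 + 1)" by (rule w(3))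
  also have "\<dots> < real m * (real m * c\<^sup>2)"
    using m m0 c by (intro mult_strict_left_mono) (auto simp: pos_divide_less_eq)
  finally show False by (simp add: power2_eq_square mult_ac)
qed

lemma Rosenthal_V: "Rosenthal_space V N"
  unfolding Rosenthal_space_def using Banach_V not_contains_ell1 by blast

end


section \<open>Representing an action on a family of nested sets\<close>

text \<open>\<open>locally_constant\<close> is what strong continuity of the representation forces:
  \<open>N\<close> dominates the sup norm, and two translates of an indicator at sup distance below
  1 coincide.\<close>

locale nested_action = nested_family K HH
  for K :: "'k set" and HH :: "'k set set" +
  fixes G :: "('g, 'm) monoid_scheme" and T :: "'g topology" and act :: "'g \<Rightarrow> 'k \<Rightarrow> 'k"
  assumes complement: "A \<in> HH \<Longrightarrow> K - A \<in> HH"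
    and separated: "x \<in> K \<Longrightarrow> y \<in> K \<Longrightarrow> x \<noteq> y \<Longrightarrow> \<exists>A\<in>HH. x \<in> A \<and> y \<notin> A"
    and group_G: "group G" and topspace_T: "topspace T = carrier G"
    and act_closed: "g \<in> carrier G \<Longrightarrow> x \<in> K \<Longrightarrow> act g x \<in> K"
    and act_mult: "g1 \<in> carrier G \<Longrightarrow> g2 \<in> carrier G \<Longrightarrow> x \<in> K \<Longrightarrow>
      act (g1 \<otimes>\<^bsub>G\<^esub> g2) x = act g1 (act g2 x)"
    and act_one: "x \<in> K \<Longrightarrow> act \<one>\<^bsub>G\<^esub> x = x"
    and preimage: "g \<in> carrier G \<Longrightarrow> A \<in> HH \<Longrightarrow> {x\<in>K. act g x \<in> A} \<in> HH"
    and locally_constant: "A \<in> HH \<Longrightarrow> g0 \<in> carrier G \<Longrightarrow>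
      \<exists>U. openin T U \<and> g0 \<in> U \<and> (\<forall>g\<in>U. \<forall>x\<in>K. act g x \<in> A \<longleftrightarrow> act g0 x \<in> A)"
begin

definition \<tau> :: "'k topology" where
  "\<tau> = topology_generated_by (insert K HH)"

text \<open>Composition with the action reverses products, as a co-homomorphism must; the value 0
  off \<open>K\<close> keeps translates in \<open>V\<close>.\<close>

definition pull :: "'g \<Rightarrow> ('k \<Rightarrow> real) \<Rightarrow> 'k \<Rightarrow> real" where
  "pull g f x = (if x \<in> K then f (act g x) else 0)"

lemma topspace_\<tau> [simp]: "topspace \<tau> = K"
  using subset_carrier by (auto simp: \<tau>_def)

lemma openin_HH: "A \<in> HH \<Longrightarrow> openin \<tau> A"
  unfolding \<tau>_def by (intro topology_generated_by_Basis) auto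

lemma pull_lincomb: "pull g (u *\<^sub>R a + v *\<^sub>R b) = u *\<^sub>R pull g a + v *\<^sub>R pull g b"
  by (rule ext) (simp add: pull_def)

lemma pull_add: "pull g (a + b) = pull g a + pull g b"
  using pull_lincomb[of g 1 a 1 b] by (simp only: scaleR_one)

lemma pull_scale: "pull g (c *\<^sub>R a) = c *\<^sub>R pull g a"
  by (rule ext) (simp add: pull_def)

text \<open>Preimages of sides are sides. The invariance of \<open>D\<close> passes to
  \<open>approx\<close>, \<open>q\<close> and \<open>N\<close>, which makes the action on
  \<open>V\<close> isometric.\<close>

lemma pull_D:
  assumes "g \<in> carrier G" "a \<in> D"
  shows "pull g a \<in> D"
  using assms(2)
proof (induction rule: D_induct)
  case zero
  have "pull g 0 = 0" by (rule ext) (simp add: pull_def)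
  then show ?case using zero_D by (simp only:)
next
  case (indicator t A)
  have "pull g (t *\<^sub>R indicator A) = t *\<^sub>R indicator {x\<in>K. act g x \<in> A}"
    by (rule ext) (simp add: pull_def indicator_def)
  then show ?case
    using indicator_D[OF preimage[OF assms(1) indicator(1)] indicator(2)] by (simp only:)
next
  case (convex a b u v)
  then show ?case unfolding pull_lincomb by (intro convex_D)
qed

lemma pull_mult:
  "g1 \<in> carrier G \<Longrightarrow> g2 \<in> carrier G \<Longrightarrow> pull (g1 \<otimes>\<^bsub>G\<^esub> g2) f = pull g2 (pull g1 f)"
  by (rule ext) (simp add: pull_def act_mult act_closed)

lemma pull_inv:
  assumes "g \<in> carrier G" "\<And>x. x \<notin> K \<Longrightarrow> f x = 0"
  shows "pull g (pull (inv\<^bsub>G\<^esub> g) f) = f" "pull (inv\<^bsub>G\<^esub> g) (pull g f) = f"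
proof -
  interpret group G by (rule group_G)
  have "pull \<one>\<^bsub>G\<^esub> f = f"
    using assms(2) by (intro ext) (simp add: pull_def act_one)
  then show "pull g (pull (inv\<^bsub>G\<^esub> g) f) = f" "pull (inv\<^bsub>G\<^esub> g) (pull g f) = f"
    using assms(1) by (simp_all flip: pull_mult)
qed

lemma approx_pull:
  assumes "g \<in> carrier G" "approx A B f"
  shows "approx A B (pull g f)"
proof -
  obtain a where a: "a \<in> D" "\<And>x. x \<in> K \<Longrightarrow> \<bar>f x - A * a x\<bar> \<le> B" and AB: "0 \<le> A" "0 \<le> B"
    using assms(2) by (auto simp: approx_def)
  have "\<bar>pull g f x - A * pull g a x\<bar> \<le> B" if "x \<in> K" for x
    using a(2)[OF act_closed[OF assms(1) that]] that by (simp add: pull_def)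
  then show ?thesis
    unfolding approx_def using AB pull_D[OF assms(1) a(1)] by blast
qed

lemma pull_V:
  assumes g: "g \<in> carrier G" and f: "f \<in> V"
  shows "q j (pull g f) = q j f" "pull g f \<in> V" "N (pull g f) = N f"
proof -
  interpret group G by (rule group_G)
  have "approx A B (pull g f) \<longleftrightarrow> approx A B f" for A B
    using approx_pull[of "inv\<^bsub>G\<^esub> g" A B "pull g f"] approx_pull[OF g, of A B f] pull_inv(2)[OF g, of f] g f
    by (auto simp: V_def)
  then have q: "q j (pull g f) = q j f" for j
    unfolding q_def by simp
  show "q j (pull g f) = q j f" by (rule q)
  have "bdd (pull g f)"
    using V_bdd[OF f] act_closed[OF g] by (auto simp: bdd_def pull_def)
  then show "pull g f \<in> V"
    using f by (auto simp: V_def q) (auto simp: pull_def)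
  show "N (pull g f) = N f"
    by (simp add: N_def q)
qed

definition h :: "'g \<Rightarrow> ('k \<Rightarrow> real) \<Rightarrow> 'k \<Rightarrow> real" where
  "h g = restrict (pull g) V"

definition \<alpha> :: "'k \<Rightarrow> ('k \<Rightarrow> real) \<Rightarrow> real" where
  "\<alpha> x = restrict (\<lambda>f. f x) V"

lemma h_isometry:
  assumes g: "g \<in> carrier G"
  shows "h g \<in> linear_isometries V N"
proof -
  interpret group G by (rule group_G)
  have out: "f x = 0" if "f \<in> V" "x \<notin> K" for f x
    using that by (simp add: V_def)
  have "bij_betw (pull g) V V"
    using g out by (intro bij_betw_byWitness[where f' = "pull (inv\<^bsub>G\<^esub> g)"]) (auto simp: pull_V pull_inv)
  then have "bij_betw (h g) V V"
    by (simp add: h_def bij_betw_restrict_eq)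
  moreover have "linear_map_on V (h g)"
    unfolding linear_map_on_def h_def
    by (intro conjI ballI allI) (simp_all only: restrict_apply' V_add(1) V_scale(1) pull_add pull_scale)
  ultimately show ?thesis
    unfolding linear_isometries_def h_def using g by (auto simp: pull_V)
qed

text \<open>At scale \<open>j\<close> some decomposition costs less than N f + 1, so its error is
  below (N f + 1) / 2^j. Both continuity proofs use this to replace \<open>f\<close> by a multiple
  of an element of \<open>D\<close>.\<close>

lemma uniform_approx:
  assumes f: "f \<in> V" and \<eta>: "0 < \<eta>"
  shows "\<exists>A. \<exists>a\<in>D. \<forall>x\<in>K. \<bar>f x - A * a x\<bar> \<le> \<eta>"
proof -
  have N1: "0 < N f + 1" using N_nonneg[OF f] by simp
  obtain j where "(N f + 1) / \<eta> < 2 ^ j"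
    using real_arch_pow[of 2] by auto
  then have j: "(N f + 1) / 2 ^ j \<le> \<eta>"
    using \<eta> by (simp add: field_simps)
  have "q j f < N f + 1"
    using q_le_N[OF f, of j] by simp
  then obtain A B where AB: "approx A B f" "A / 2 ^ j + 2 ^ j * B < N f + 1"
    using ex_approx_less V_bdd[OF f] by blast
  then obtain a where a: "a \<in> D" "\<And>x. x \<in> K \<Longrightarrow> \<bar>f x - A * a x\<bar> \<le> B" "0 \<le> A" "0 \<le> B"
    by (auto simp: approx_def)
  have "0 \<le> A / 2 ^ j" using a(3) by simp
  then have "2 ^ j * B < N f + 1" using AB(2) by linarith
  then have "B < (N f + 1) / 2 ^ j"
    by (simp add: pos_less_divide_eq mult.commute)
  then have "B \<le> \<eta>" using j by linarith
  then show ?thesis using a(1,2) order.trans by blast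
qed

lemma D_locally_constant:
  assumes "a \<in> D" "x \<in> K"
  shows "\<exists>U. openin \<tau> U \<and> x \<in> U \<and> (\<forall>y\<in>U. a y = a x)"
  using assms(1)
proof (induction rule: D_induct)
  case zero
  show ?case using assms(2) by (intro exI[of _ K]) (auto intro: openin_topspace[of \<tau>, simplified])
next
  case (indicator t A)
  show ?case
  proof (cases "x \<in> A")
    case True
    then show ?thesis using openin_HH[OF indicator(1)] by (intro exI[of _ A]) (simp add: indicator_def)
  next
    case False
    then show ?thesis using openin_HH[OF complement[OF indicator(1)]] assms(2)
      by (intro exI[of _ "K - A"]) (simp add: indicator_def)
  qed
next
  case (convex a b u v)
  obtain U where U: "openin \<tau> U" "x \<in> U" "\<forall>y\<in>U. a y = a x"
    using convex by blast
  obtain U' where U': "openin \<tau> U'" "x \<in> U'" "\<forall>y\<in>U'. b y = b x"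
    using convex by blast
  have "(u *\<^sub>R a + v *\<^sub>R b) y = (u *\<^sub>R a + v *\<^sub>R b) x" if "y \<in> U \<inter> U'" for y
    using that U(3)[rule_format, of y] U'(3)[rule_format, of y] by simp
  then show ?case
    using openin_Int[OF U(1) U'(1)] U(2) U'(2) by blast
qed

text \<open>One neighbourhood serves all of \<open>K\<close>, since an element of \<open>D\<close>
  involves finitely many sides; neighbourhoods depending on the point would give only pointwise
  convergence of translates.\<close>

lemma D_pull_locally_constant:
  assumes "a \<in> D" "g0 \<in> carrier G"
  shows "\<exists>U. openin T U \<and> g0 \<in> U \<and> (\<forall>g\<in>U. \<forall>x\<in>K. a (act g x) = a (act g0 x))"
  using assms(1)
proof (induction rule: D_induct)
  case zero
  show ?case
  proof (intro exI[of _ "carrier G"] conjI ballI)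
    show "openin T (carrier G)" using openin_topspace[of T] by (simp only: topspace_T)
  qed (use assms(2) in simp_all)
next
  case (indicator t A)
  obtain U where U: "openin T U" "g0 \<in> U" "\<forall>g\<in>U. \<forall>x\<in>K. act g x \<in> A \<longleftrightarrow> act g0 x \<in> A"
    using locally_constant[OF indicator(1) assms(2)] by blast
  have "(t *\<^sub>R indicator A) (act g x) = (t *\<^sub>R indicator A) (act g0 x)" if "g \<in> U" "x \<in> K" for g x
    using U(3)[rule_format, OF that] by (simp add: indicator_def)
  then show ?case using U(1,2) by blast
next
  case (convex a b u v)
  obtain U where U: "openin T U" "g0 \<in> U" "\<forall>g\<in>U. \<forall>x\<in>K. a (act g x) = a (act g0 x)"
    using convex by blast
  obtain U' where U': "openin T U'" "g0 \<in> U'" "\<forall>g\<in>U'. \<forall>x\<in>K. b (act g x) = b (act g0 x)"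
    using convex by blast
  have "(u *\<^sub>R a + v *\<^sub>R b) (act g x) = (u *\<^sub>R a + v *\<^sub>R b) (act g0 x)"
    if "g \<in> U \<inter> U'" "x \<in> K" for g x
    using that U(3)[rule_format, of g x] U'(3)[rule_format, of g x] by simp
  then show ?case
    using openin_Int[OF U(1) U'(1)] U(2) U'(2) by blast
qed

lemma continuous_V:
  assumes f: "f \<in> V"
  shows "continuous_map \<tau> euclideanreal f"
proof -
  have "continuous_map \<tau> Met_TC.mtopology f"
    unfolding Met_TC.continuous_map_to_metric
  proof (intro ballI allI impI)
    fix x and e :: real assume x: "x \<in> topspace \<tau>" and e: "0 < e"
    obtain A a where a: "a \<in> D" "\<And>x. x \<in> K \<Longrightarrow> \<bar>f x - A * a x\<bar> \<le> e / 3"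
      using uniform_approx[OF f, of "e / 3"] e by auto
    obtain U where U: "openin \<tau> U" "x \<in> U" "\<And>y. y \<in> U \<Longrightarrow> a y = a x"
      using D_locally_constant[OF a(1), of x] x by auto
    have "f y \<in> Met_TC.mball (f x) e" if y: "y \<in> U" for y
    proof -
      have "y \<in> K" "x \<in> K" using openin_subset[OF U(1)] y x by auto
      then have "\<bar>f x - A * a x\<bar> \<le> e / 3" "\<bar>f y - A * a x\<bar> \<le> e / 3"
        using a(2)[of x] a(2)[of y] U(3)[OF y] by simp_all
      then have "\<bar>f x - f y\<bar> < e" using e by linarith
      then show ?thesis by (simp add: dist_real_def)
    qed
    then show "\<exists>U. openin \<tau> U \<and> x \<in> U \<and> (\<forall>y\<in>U. f y \<in> Met_TC.mball (f x) e)"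
      using U by blast
  qed
  then show ?thesis by simp
qed

text \<open>The translates \<open>pull g f\<close> have the same tails as \<open>f\<close>, so that norm convergence of translates
  reduces to uniform convergence.\<close>

lemma N_less_of_dominated_tails:
  assumes f: "f \<in> V" and e: "0 < e"
  obtains \<eta> where "0 < \<eta>"
    "\<And>z. z \<in> V \<Longrightarrow> (\<And>j. q j z \<le> 2 * q j f) \<Longrightarrow> (\<And>x. x \<in> K \<Longrightarrow> \<bar>z x\<bar> \<le> \<eta>) \<Longrightarrow> N z < e"
proof -
  have fs: "summable (\<lambda>j. (q j f)\<^sup>2)" using f by (simp add: V_def)
  \<comment> \<open>The tail of \<open>z\<close>, in squares, is at most 4 times that of
    \<open>f\<close>, hence at most e^2 / 4; the choice of \<eta> gives the head another e^2 /
    4.\<close>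
  have "0 < e\<^sup>2 / 16" using e by simp
  from suminf_exist_split[OF this fs] obtain J
    where "\<forall>n\<ge>J. norm (\<Sum>i. (q (i + n) f)\<^sup>2) < e\<^sup>2 / 16" by blast
  then have "norm (\<Sum>i. (q (i + J) f)\<^sup>2) < e\<^sup>2 / 16" by blast
  then have tail: "(\<Sum>i. (q (i + J) f)\<^sup>2) \<le> e\<^sup>2 / 16"
    by (simp only: real_norm_def)
  define \<eta> where "\<eta> = e / (2 * ((real J + 1) * 2 ^ J))"
  have pos: "0 < (real J + 1) * 2 ^ J" by simp
  then have \<eta>: "0 < \<eta>" using e by (simp add: \<eta>_def)
  show ?thesis
  proof (rule that[OF \<eta>])
    fix z assume z: "z \<in> V" and dom: "\<And>j. q j z \<le> 2 * q j f" and small: "\<And>x. x \<in> K \<Longrightarrow> \<bar>z x\<bar> \<le> \<eta>"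
    have zs: "summable (\<lambda>j. (q j z)\<^sup>2)" using z by (simp add: V_def)
    note fsJ = summable_ignore_initial_segment[OF fs, of J]
      and zsJ = summable_ignore_initial_segment[OF zs, of J]
    have nn: "0 \<le> q j z" for j using z by (intro q_nonneg V_bdd)
    have "(\<Sum>i. (q (i + J) z)\<^sup>2) \<le> (\<Sum>i. 4 * (q (i + J) f)\<^sup>2)"
    proof (intro suminf_le zsJ summable_mult fsJ)
      fix i
      have "(q (i + J) z)\<^sup>2 \<le> (2 * q (i + J) f)\<^sup>2"
        using dom nn by (intro power_mono)
      then show "(q (i + J) z)\<^sup>2 \<le> 4 * (q (i + J) f)\<^sup>2" by (simp add: power_mult_distrib)
    qed
    also have "\<dots> \<le> e\<^sup>2 / 4"
      unfolding suminf_mult[OF fsJ] using tail by linarith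
    finally have 1: "(\<Sum>i. (q (i + J) z)\<^sup>2) \<le> e\<^sup>2 / 4" .
    have "(\<Sum>j<J. (q j z)\<^sup>2) \<le> (\<Sum>j<J. q j z)\<^sup>2"
    proof -
      have "L2_set (\<lambda>j. q j z) {..<J} \<le> (\<Sum>j<J. q j z)"
        using nn by (intro L2_set_le_sum)
      then show ?thesis
        unfolding L2_set_def using nn by (intro sqrt_le_D)
    qed
    also have "\<dots> \<le> (e / 2)\<^sup>2"
    proof (intro power_mono sum_nonneg nn)
      have "(\<Sum>j<J. q j z) \<le> (\<Sum>j<J. 2 ^ J * \<eta>)"
      proof (intro sum_mono)
        fix j assume "j \<in> {..<J}"
        have "q j z \<le> 2 ^ j * \<eta>"
          using \<eta> small by (intro q_le_sup) auto
        also have "\<dots> \<le> 2 ^ J * \<eta>"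
          using \<eta> \<open>j \<in> {..<J}\<close> by (intro mult_right_mono power_increasing) auto
        finally show "q j z \<le> 2 ^ J * \<eta>" .
      qed
      also have "\<dots> = real J * (2 ^ J * \<eta>)" by simp
      also have "\<dots> \<le> (real J + 1) * (2 ^ J * \<eta>)"
        using \<eta> by (intro mult_right_mono) auto
      also have "\<dots> = ((real J + 1) * 2 ^ J) * \<eta>"
        by (simp only: mult.assoc)
      also have "\<dots> = e / 2"
        using pos unfolding \<eta>_def by (subst times_divide_eq_right) (simp add: field_simps)
      finally show "(\<Sum>j<J. q j z) \<le> e / 2" .
    qed
    finally have 2: "(\<Sum>j<J. (q j z)\<^sup>2) \<le> e\<^sup>2 / 4"
      by (simp add: power_divide)
    have "(\<Sum>j. (q j z)\<^sup>2) \<le> e\<^sup>2 / 2"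
      unfolding suminf_split_initial_segment[OF zs, of J] using 1 2 by linarith
    also have "\<dots> < e\<^sup>2" using e by simp
    finally show "N z < e"
      unfolding N_def using e by (intro real_sqrt_less_mono[THEN order.strict_trans2]) auto
  qed
qed

lemma continuous_h: "continuous_map T (strong_operator_topology V N) h"
proof -
  interpret M: Metric_space V "norm_dist V N"
    by (rule Metric_space_norm_dist[OF normed_V])
  have "continuous_map T M.mtopology (\<lambda>g. h g f)" if f: "f \<in> V" for f
    unfolding M.continuous_map_to_metric topspace_T
  proof (intro ballI allI impI)
    fix g0 and e :: real assume g0: "g0 \<in> carrier G" and e: "0 < e"
    obtain \<eta> where \<eta>: "0 < \<eta>" and less:
      "\<And>z. z \<in> V \<Longrightarrow> (\<And>j. q j z \<le> 2 * q j f) \<Longrightarrow> (\<And>x. x \<in> K \<Longrightarrow> \<bar>z x\<bar> \<le> \<eta>) \<Longrightarrow> N z < e"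
      by (rule N_less_of_dominated_tails[OF f e]) blast
    have "0 < \<eta> / 2" using \<eta> by simp
    from uniform_approx[OF f this] obtain A a
      where a: "a \<in> D" "\<And>x. x \<in> K \<Longrightarrow> \<bar>f x - A * a x\<bar> \<le> \<eta> / 2" by blast
    obtain U where U: "openin T U" "g0 \<in> U" "\<And>g x. g \<in> U \<Longrightarrow> x \<in> K \<Longrightarrow> a (act g x) = a (act g0 x)"
      using D_pull_locally_constant[OF a(1) g0] by blast
    have "h g f \<in> M.mball (h g0 f) e" if gU: "g \<in> U" for g
    proof -
      have g: "g \<in> carrier G"
        using openin_subset[OF U(1)] gU topspace_T by auto
      let ?z = "pull g0 f - pull g f"
      have z: "?z \<in> V"
        using pull_V(2) f g g0 by (intro V_diff)
      have "q j ?z \<le> 2 * q j f" for j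
      proof -
        have eq: "?z = pull g0 f + (-1) *\<^sub>R pull g f"
          by (simp only: scaleR_minus_left scaleR_one diff_conv_add_uminus)
        have b: "bdd (pull g0 f)" "bdd (pull g f)"
          using pull_V(2) f g g0 by (auto intro: V_bdd)
        have "q j ?z \<le> q j (pull g0 f) + q j ((-1) *\<^sub>R pull g f)"
          unfolding eq using b by (intro q_add bdd_scale)
        also have "\<dots> = 2 * q j f"
          unfolding q_scale[OF b(2)] pull_V(1)[OF g f] pull_V(1)[OF g0 f] by simp
        finally show ?thesis .
      qed
      moreover have "\<bar>?z x\<bar> \<le> \<eta>" if x: "x \<in> K" for x
      proof -
        have "\<bar>f (act g x) - A * a (act g0 x)\<bar> \<le> \<eta> / 2" "\<bar>f (act g0 x) - A * a (act g0 x)\<bar> \<le> \<eta> / 2"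
          using a(2)[OF act_closed[OF g x]] a(2)[OF act_closed[OF g0 x]] U(3)[OF gU x] by simp_all
        then have "\<bar>f (act g0 x) - f (act g x)\<bar> \<le> \<eta>" by linarith
        then show ?thesis using x by (simp add: pull_def)
      qed
      ultimately have "N ?z < e"
        by (rule less[OF z])
      then show ?thesis
        using f pull_V(2)[OF g f] pull_V(2)[OF g0 f] unfolding M.in_mball h_def
        by (simp only: restrict_apply' norm_dist_def if_True conj_absorb simp_thms)
    qed
    then show "\<exists>U. openin T U \<and> g0 \<in> U \<and> (\<forall>g\<in>U. h g f \<in> M.mball (h g0 f) e)"
      using U by blast
  qed
  then show ?thesis
    unfolding strong_operator_topology_def norm_topology_def continuous_map_in_subtopology
      continuous_map_componentwise
  proof (intro conjI ballI)
    show "h ` topspace T \<subseteq> extensional V"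
      unfolding h_def by blast
    show "h \<in> topspace T \<rightarrow> linear_isometries V N"
      unfolding topspace_T using h_isometry by blast
  qed
qed

text \<open>An indicator lies in \<open>D\<close> itself, so it has a decomposition without error,
  of cost 2^-j at scale \<open>j\<close>; a geometric series then bounds \<open>N\<close>.\<close>

lemma indicator_V:
  assumes A: "A \<in> HH"
  shows "indicator A \<in> V"
proof (rule VI)
  show "indicator A x = (0::real)" if "x \<notin> K" for x
    using that subset_carrier[OF A] by (auto simp: indicator_def)
  show b: "bdd (indicator A)"
    by (auto simp: bdd_def indicator_def intro: exI[of _ 1])
  have "1 *\<^sub>R indicator A \<in> D" using A by (intro indicator_D) auto
  then have "approx 1 0 (indicator A)"
    unfolding approx_def scaleR_one by (intro conjI bexI[of _ "indicator A"]) auto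
  from q_le[OF this] have q: "q j (indicator A) \<le> (1 / 2) ^ j" for j
    by (simp add: power_one_over)
  show "L2_set (\<lambda>j. q j (indicator A)) {..<n} \<le> 2" for n
  proof -
    have "L2_set (\<lambda>j. q j (indicator A)) {..<n} \<le> (\<Sum>j<n. q j (indicator A))"
      using q_nonneg[OF b] by (intro L2_set_le_sum)
    also have "\<dots> \<le> (\<Sum>j<n. (1 / 2) ^ j)"
      using q by (intro sum_mono)
    also have "\<dots> \<le> 2"
      by (simp add: sum_gp_strict)
    finally show ?thesis .
  qed
qed

lemma \<alpha>_dual:
  assumes x: "x \<in> K"
  shows "\<alpha> x \<in> dual_space V N"
proof -
  have "linear_map_on V (\<alpha> x)"
    unfolding linear_map_on_def \<alpha>_def
    by (intro conjI ballI allI) (simp_all only: restrict_apply' V_add(1) V_scale(1) plus_fun_apply scaleR_fun_apply)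
  moreover have "\<bar>\<alpha> x f\<bar> \<le> 1 * N f" if "f \<in> V" for f
    using V_abs_le_N[OF that x] that by (simp add: \<alpha>_def)
  moreover have "\<alpha> x \<in> extensional V" by (simp add: \<alpha>_def)
  ultimately show ?thesis
    unfolding dual_space_def by blast
qed

lemma continuous_\<alpha>: "continuous_map \<tau> (weak_star_topology V N) \<alpha>"
proof -
  have "continuous_map \<tau> euclideanreal (\<lambda>x. \<alpha> x f)" if "f \<in> V" for f
    using continuous_V[OF that] that by (simp add: \<alpha>_def)
  then show ?thesis
    unfolding weak_star_topology_def continuous_map_in_subtopology continuous_map_componentwise
  proof (intro conjI ballI)
    show "\<alpha> ` topspace \<tau> \<subseteq> extensional V"
      unfolding \<alpha>_def by blast
    show "\<alpha> \<in> topspace \<tau> \<rightarrow> dual_space V N"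
      unfolding topspace_\<tau> using \<alpha>_dual by blast
  qed
qed

text \<open>The sides generate \<tau>, and a side \<open>A\<close> is recovered from the functionals
  \<open>F\<close> by the weak-star open condition F (indicator A) > 1/2; hence the inverse is
  continuous.\<close>

lemma embedding_\<alpha>: "embedding_map \<tau> (weak_star_topology V N) \<alpha>"
proof -
  let ?Y = "subtopology (weak_star_topology V N) (\<alpha> ` K)"
  have inj: "inj_on \<alpha> K"
  proof (rule inj_onI, rule ccontr)
    fix x y assume xy: "x \<in> K" "y \<in> K" "\<alpha> x = \<alpha> y" "x \<noteq> y"
    then obtain A where A: "A \<in> HH" "x \<in> A" "y \<notin> A"
      using separated by blast
    have "\<alpha> x (indicator A) = \<alpha> y (indicator A)" using xy by simp
    then show False using A indicator_V[OF A(1)] by (simp add: \<alpha>_def)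
  qed
  have top: "topspace ?Y = \<alpha> ` K"
    using continuous_map_image_subset_topspace[OF continuous_\<alpha>] by auto
  have "continuous_map ?Y \<tau> (inv_into K \<alpha>)"
    unfolding \<tau>_def
  proof (rule continuous_on_generated_topo)
    show "inv_into K \<alpha> ` topspace ?Y \<subseteq> \<Union> (insert K HH)"
      unfolding top using inj by auto
  next
    fix A assume "A \<in> insert K HH"
    then consider "A = K" | "A \<in> HH" by blast
    then show "openin ?Y (inv_into K \<alpha> -` A \<inter> topspace ?Y)"
    proof cases
      case 1
      then have "inv_into K \<alpha> -` A \<inter> topspace ?Y = topspace ?Y"
        unfolding top using inj by auto
      then show ?thesis by (simp only: openin_topspace)
    next
      case 2
      have "continuous_map (weak_star_topology V N) euclideanreal (\<lambda>F. F (indicator A))"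
        unfolding weak_star_topology_def
        by (intro continuous_map_from_subtopology continuous_map_product_projection indicator_V 2)
      then have c: "continuous_map ?Y euclideanreal (\<lambda>F. F (indicator A))"
        by (rule continuous_map_from_subtopology)
      have "openin ?Y {F \<in> topspace ?Y. F (indicator A) \<in> {1/2<..}}"
        by (rule openin_continuous_map_preimage[OF c]) simp
      moreover have "inv_into K \<alpha> -` A \<inter> topspace ?Y = {F \<in> topspace ?Y. F (indicator A) \<in> {1/2<..}}"
      proof -
        have "inv_into K \<alpha> (\<alpha> x) \<in> A \<longleftrightarrow> \<alpha> x (indicator A) \<in> {1/2<..}" if "x \<in> K" for x
          using inv_into_f_f[OF inj that] indicator_V[OF 2] by (simp add: \<alpha>_def indicator_def)
        then show ?thesis unfolding top by blast
      qed
      ultimately show ?thesis by simp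
    qed
  qed
  then have "homeomorphic_maps \<tau> ?Y \<alpha> (inv_into K \<alpha>)"
    unfolding homeomorphic_maps_def top
    using continuous_\<alpha> inj by (auto simp: continuous_map_in_subtopology f_inv_into_f)
  then show ?thesis
    unfolding embedding_map_def using homeomorphic_maps_map by auto
qed

theorem Rosenthal_representable: "Rosenthal_representable G T \<tau> act"
proof -
  interpret group G by (rule group_G)
  have "representation G T \<tau> act V N h \<alpha>"
    unfolding representation_def
  proof (intro conjI ballI)
    show "continuous_map T (strong_operator_topology V N) h" by (rule continuous_h)
    show "continuous_map \<tau> (weak_star_topology V N) \<alpha>" by (rule continuous_\<alpha>)
    fix g1 g2 assume "g1 \<in> carrier G" "g2 \<in> carrier G"
    then show "h (g1 \<otimes>\<^bsub>G\<^esub> g2) = compose V (h g2) (h g1)"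
      by (intro ext) (simp add: h_def compose_def pull_mult pull_V)
  next
    have "\<bar>\<alpha> x v\<bar> \<le> 1 * N v" if "x \<in> K" "v \<in> V" for x v
      using V_abs_le_N[OF that(2,1)] that by (simp add: \<alpha>_def)
    then show "\<exists>C. \<forall>x\<in>topspace \<tau>. \<forall>v\<in>V. \<bar>\<alpha> x v\<bar> \<le> C * N v"
      unfolding topspace_\<tau> by blast
  next
    fix v g x assume "v \<in> V" "g \<in> carrier G" "x \<in> topspace \<tau>"
    then show "\<alpha> (act g x) v = \<alpha> x (h g v)"
      by (simp add: \<alpha>_def h_def pull_V pull_def)
  qed
  then show ?thesis
    unfolding Rosenthal_representable_def using Rosenthal_V embedding_\<alpha> by blast
qed

end


section \<open>Sides of edges in a Z-tree\<close>

locale Z_tree_space =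
  fixes X :: "'a set" and R :: "'a \<Rightarrow> 'a \<Rightarrow> 'a \<Rightarrow> bool"
  assumes Z_tree: "Z_tree X R"
begin

abbreviation adj :: "'a \<Rightarrow> 'a \<Rightarrow> bool" where
  "adj \<equiv> adjacent X R"

section \<open>Betweenness and intervals\<close>

lemma R_sym: "a \<in> X \<Longrightarrow> b \<in> X \<Longrightarrow> c \<in> X \<Longrightarrow> R a b c \<Longrightarrow> R c b a"
  using Z_tree unfolding Z_tree_def median_pretree_def pretree_def by blast

lemma R_right: "a \<in> X \<Longrightarrow> b \<in> X \<Longrightarrow> R a b b"
  using Z_tree unfolding Z_tree_def median_pretree_def pretree_def by blast

lemma R_left: "a \<in> X \<Longrightarrow> b \<in> X \<Longrightarrow> R a a b"
  using R_right R_sym by blast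

lemma R_antisym: "a \<in> X \<Longrightarrow> b \<in> X \<Longrightarrow> c \<in> X \<Longrightarrow> R a b c \<Longrightarrow> R a c b \<Longrightarrow> b = c"
  using Z_tree unfolding Z_tree_def median_pretree_def pretree_def by blast

lemma R_split: "a \<in> X \<Longrightarrow> b \<in> X \<Longrightarrow> c \<in> X \<Longrightarrow> d \<in> X \<Longrightarrow> R a b c \<Longrightarrow> R a b d \<or> R d b c"
  using Z_tree unfolding Z_tree_def median_pretree_def pretree_def by blast

lemma finite_interval: "a \<in> X \<Longrightarrow> b \<in> X \<Longrightarrow> finite (interval X R a b)"
  using Z_tree unfolding Z_tree_def by blast

lemma ex_median:
  assumes "a \<in> X" "b \<in> X" "c \<in> X"
  shows "\<exists>m\<in>X. R a m b \<and> R a m c \<and> R b m c"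
proof -
  have "interval X R a b \<inter> interval X R a c \<inter> interval X R b c \<noteq> {}"
    using Z_tree assms unfolding Z_tree_def median_pretree_def by blast
  then show ?thesis unfolding interval_def by blast
qed

text \<open>Axiom (B3) leaves only the case that \<open>y\<close> lies between \<open>z\<close> and
  \<open>w\<close>, and a second use of it then identifies \<open>y\<close> with
  \<open>w\<close>.\<close>

lemma R_trans_left:
  assumes "u \<in> X" "w \<in> X" "z \<in> X" "y \<in> X" "R u w z" "R u y w"
  shows "R u y z"
proof -
  consider "R u y z" | "R z y w"
    using R_split[of u y w z] assms by blast
  then show ?thesis
  proof cases
    case 2
    consider "R u w y" | "R y w z"
      using R_split[of u w z y] assms by blast
    then show ?thesis
    proof cases
      case 1
      then have "w = y" using R_antisym[of u w y] assms by blast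
      then show ?thesis using assms by blast
    next
      case y: 2
      then have "R z w y" using R_sym assms by blast
      then have "w = y" using R_antisym[of z w y] 2 assms by blast
      then show ?thesis using assms by blast
    qed
  qed
qed

lemma R_trans_right:
  assumes "u \<in> X" "w \<in> X" "z \<in> X" "y \<in> X" "R u w z" "R w y z"
  shows "R u y z"
  using R_trans_left[of z w u y] R_sym assms by meson

lemma R_inner:
  assumes "x \<in> X" "y \<in> X" "u \<in> X" "z \<in> X" "R x y u" "R x u z"
  shows "R y u z"
proof -
  consider "R x u y" | "R y u z"
    using R_split[of x u z y] assms by blast
  then show ?thesis
  proof cases
    case 1
    then have "u = y" using R_antisym[of x u y] assms by blast
    then show ?thesis using R_left assms by blast
  qed
qed

section \<open>Edges and their two sides\<close>

lemma adjD: "adj a b \<Longrightarrow> a \<in> X" "adj a b \<Longrightarrow> b \<in> X" "adj a b \<Longrightarrow> a \<noteq> b"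
  by (auto simp: adjacent_def)

lemma adj_between: "adj a b \<Longrightarrow> x \<in> X \<Longrightarrow> R a x b \<Longrightarrow> x = a \<or> x = b"
  by (auto simp: adjacent_def interval_def)

lemma adj_sym: "adj a b \<Longrightarrow> adj b a"
proof -
  assume ab: "adj a b"
  have "interval X R b a = interval X R a b"
    unfolding interval_def using R_sym adjD[OF ab] by blast
  then show ?thesis using ab by (auto simp: adjacent_def)
qed

text \<open>\<open>R x a b\<close> reads: \<open>x\<close> is on the side of \<open>a\<close>. The
  median of \<open>x\<close>, \<open>a\<close>, \<open>b\<close> lies in [a, b] = {a, b}, and which
  of the two it is decides the side.\<close>

lemma side_iff:
  assumes ab: "adj a b" and x: "x \<in> X"
  shows "R x a b \<longleftrightarrow> \<not> R x b a"
proof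
  assume "R x a b"
  then show "\<not> R x b a"
    using R_antisym[of x a b] adjD[OF ab] x by blast
next
  assume n: "\<not> R x b a"
  obtain m where m: "m \<in> X" "R x m a" "R x m b" "R a m b"
    using ex_median[of x a b] adjD[OF ab] x by blast
  then have "m = a \<or> m = b" using adj_between[OF ab] by blast
  then show "R x a b" using m n by blast
qed

text \<open>Axiom (B3) puts both \<open>a\<close> and \<open>b\<close> between \<open>x\<close> and
  \<open>y\<close>, where an edge has only its ends. So the two sides of an edge are joined by no
  other edge.\<close>

lemma crossing_edge:
  assumes xy: "adj x y" and ab: "adj a b" and "R x a b" "R y b a"
  shows "x = a \<and> y = b"
proof -
  note X = adjD[OF xy] adjD[OF ab]
  have "\<not> R y a b" using side_iff[OF ab, of y] assms X by blast
  then have "R x a y" using R_split[of x a b y] assms X by blast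
  moreover have "a \<noteq> y" using \<open>\<not> R y a b\<close> R_left X by blast
  ultimately have x: "a = x" using adj_between[OF xy] X by blast
  have "\<not> R x b a" using side_iff[OF ab, of x] assms X by blast
  then have "R y b x" using R_split[of y b a x] assms X by blast
  moreover have "b \<noteq> x" using \<open>\<not> R x b a\<close> R_left X by blast
  ultimately have "b = y" using adj_between[OF adj_sym[OF xy]] X by blast
  then show ?thesis using x by blast
qed

text \<open>The edges face each other with \<open>b\<close> and \<open>d\<close> outward. A point on
  both outward sides would have \<open>d\<close> between it and \<open>b\<close>, and
  \<open>b\<close> between it and \<open>d\<close>, forcing b = d.\<close>

lemma disjoint_sides:
  assumes ab: "adj a b" and cd: "adj c d"
    and "R a c d" "R b c d" "R c a b" "R d a b"
    and x: "x \<in> X" "R x b a" "R x d c"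
  shows False
proof -
  note X = adjD[OF ab] adjD[OF cd]
  have n: "\<not> R b d c" "\<not> R d b a"
    using assms side_iff[OF ab] side_iff[OF cd] X by blast+
  have 1: "R x d b" using R_split[of x d c b] n assms X by blast
  have 2: "R x b d" using R_split[of x b a d] n assms X by blast
  have bd: "b = d" using R_antisym[of x b d] 1 2 x X by blast
  have "R b d c" unfolding bd using R_left X by blast
  then show False using n by blast
qed

text \<open>By \<open>crossing_edge\<close> the ends of each edge lie on one side of the other,
  unless the edges coincide, which empties two corners. Up to orientation the edges then face each
  other as in \<open>disjoint_sides\<close>, and one of the four corners is empty.\<close>

lemma sides_nested:
  assumes ab: "adj a b" and cd: "adj c d"
    and x: "x1 \<in> X" "x2 \<in> X" "x3 \<in> X" "x4 \<in> X"
    and 1: "R x1 a b" "R x1 c d" and 2: "R x2 a b" "R x2 d c"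
    and 3: "R x3 b a" "R x3 c d" and 4: "R x4 b a" "R x4 d c"
  shows False
proof -
  note X = adjD[OF ab] adjD[OF cd]
  note ba = adj_sym[OF ab] and dc = adj_sym[OF cd]
  have sab: "R z a b \<longleftrightarrow> \<not> R z b a" if "z \<in> X" for z by (rule side_iff[OF ab that])
  have scd: "R z c d \<longleftrightarrow> \<not> R z d c" if "z \<in> X" for z by (rule side_iff[OF cd that])
  have c1: "\<not> (R c a b \<and> R d b a)"
  proof
    assume "R c a b \<and> R d b a"
    then have "c = a \<and> d = b" using crossing_edge[OF cd ab] by blast
    then show False using 2 sab[OF x(2)] by blast
  qed
  have c2: "\<not> (R c b a \<and> R d a b)"
  proof
    assume "R c b a \<and> R d a b"
    then have "c = b \<and> d = a" using crossing_edge[OF cd ba] by blast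
    then show False using 1 sab[OF x(1)] by blast
  qed
  have c3: "\<not> (R a c d \<and> R b d c)"
  proof
    assume "R a c d \<and> R b d c"
    then have "a = c \<and> b = d" using crossing_edge[OF ab cd] by blast
    then show False using 2 sab[OF x(2)] by blast
  qed
  have c4: "\<not> (R a d c \<and> R b c d)"
  proof
    assume "R a d c \<and> R b c d"
    then have "a = d \<and> b = c" using crossing_edge[OF ab dc] by blast
    then show False using 1 sab[OF x(1)] by blast
  qed
  consider "R c a b" "R d a b" | "R c b a" "R d b a"
    using c1 c2 sab[OF X(4)] sab[OF X(5)] by blast
  then show False
  proof cases
    case cd': 1
    consider "R a c d" "R b c d" | "R a d c" "R b d c"
      using c3 c4 scd[OF X(1)] scd[OF X(2)] by blast
    then show False
      using disjoint_sides[OF ab cd _ _ cd' x(4) 4] disjoint_sides[OF ab dc _ _ cd'(2,1) x(3) 3]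
      by cases blast+
  next
    case cd': 2
    consider "R a c d" "R b c d" | "R a d c" "R b d c"
      using c3 c4 scd[OF X(1)] scd[OF X(2)] by blast
    then show False
      using disjoint_sides[OF ba cd _ _ cd' x(2) 2] disjoint_sides[OF ba dc _ _ cd'(2,1) x(1) 1]
      by cases blast+
  qed
qed

text \<open>Nothing lies strictly between adjacent points, so (B3) puts \<open>a\<close> between
  \<open>z\<close> and \<open>b\<close> as well as \<open>b\<close> between \<open>z\<close> and
  \<open>a\<close>.\<close>

lemma nbr_unique:
  assumes "adj u a" "adj u b" and z: "z \<in> X" "R z a u" "R z b u"
  shows "a = b"
proof -
  note X = adjD[OF assms(1)] adjD[OF assms(2)]
  have "\<not> R b a u \<or> a = b"
    using adj_between[OF adj_sym[OF assms(2)], of a] X by blast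
  moreover have "\<not> R a b u \<or> a = b"
    using adj_between[OF adj_sym[OF assms(1)], of b] X by blast
  ultimately show ?thesis
    using R_split[of z a u b] R_split[of z b u a] R_antisym[of z a b] assms X by blast
qed

text \<open>Finiteness of intervals provides a first step from \<open>u\<close> to \<open>x\<close>:
  a point of [u, x] other than \<open>u\<close> with the smallest interval from \<open>u\<close>.
  The last conclusion turns a shadow seen from a point into a side of an edge.\<close>

lemma ex_nbr:
  assumes X: "u \<in> X" "x \<in> X" and ne: "u \<noteq> x"
  obtains w where "adj u w" "R x w u" "\<And>z. z \<in> X \<Longrightarrow> R z u x \<longleftrightarrow> R z u w"
proof -
  let ?I = "interval X R u x - {u}"
  have "x \<in> ?I" using R_right X ne by (auto simp: interval_def)
  then obtain w where w: "w \<in> ?I" and min: "\<And>y. y \<in> ?I \<Longrightarrow> card (interval X R u w) \<le> card (interval X R u y)"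
    using ex_has_least_nat[of "\<lambda>y. y \<in> ?I" x "\<lambda>y. card (interval X R u y)"] by blast
  have wX: "w \<in> X" "R u w x" "w \<noteq> u" using w by (auto simp: interval_def)
  have "y = u \<or> y = w" if y: "y \<in> X" "R u y w" for y
  proof (rule ccontr)
    assume n: "\<not> (y = u \<or> y = w)"
    have "R u y x" using R_trans_left[of u w x y] X wX y by blast
    then have "y \<in> ?I" using n y by (auto simp: interval_def)
    then have le: "card (interval X R u w) \<le> card (interval X R u y)" by (rule min)
    have "interval X R u y \<subseteq> interval X R u w"
      unfolding interval_def using R_trans_left[of u y w] X wX y by blast
    moreover have "w \<notin> interval X R u y"
      unfolding interval_def using R_antisym[of u w y] X wX y n by blast
    moreover have "w \<in> interval X R u w"
      unfolding interval_def using R_right X wX by blast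
    ultimately have "interval X R u y \<subset> interval X R u w" by blast
    then have "card (interval X R u y) < card (interval X R u w)"
      using finite_interval X wX by (intro psubset_card_mono)
    then show False using le by simp
  qed
  then have "interval X R u w = {u, w}"
    using R_left R_right X wX by (auto simp: interval_def)
  then have uw: "adj u w" using X wX by (auto simp: adjacent_def)
  have "R z u x \<longleftrightarrow> R z u w" if z: "z \<in> X" for z
  proof -
    have n: "\<not> R w u x" "\<not> R x u w"
      using R_antisym[of x u w] R_sym X wX by blast+
    have "R w u x \<or> R z u w" if "R z u x"
      using R_split[of z u x w] that R_sym X wX z by blast
    moreover have "R z u x \<or> R x u w" if "R z u w"
      using R_split[of z u w x] that X wX z by blast
    ultimately show ?thesis using n by blast
  qed
  moreover have "R x w u" using R_sym X wX by blast
  ultimately show ?thesis using that uw by blast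
qed


section \<open>Rays and ends\<close>

text \<open>For an edge this extends the sides to ends: an end is treated through the eventual
  position of one of its rays.\<close>

abbreviation toward :: "(nat \<Rightarrow> 'a) \<Rightarrow> 'a \<Rightarrow> 'a \<Rightarrow> bool" where
  "toward r a b \<equiv> \<forall>\<^sub>F n in sequentially. R (r n) a b"

lemma rayD:
  assumes "r \<in> rays X R"
  shows "r n \<in> X" "adj (r n) (r (Suc n))" "r i = r j \<longleftrightarrow> i = j"
  using assms by (auto simp: rays_def inj_def)

lemma ray_avoids:
  assumes "r \<in> rays X R"
  shows "\<forall>\<^sub>F n in sequentially. r n \<noteq> u"
proof (cases "\<exists>m. r m = u")
  case True
  then obtain m where "r m = u" by blast
  then have "\<forall>n\<ge>Suc m. r n \<noteq> u" using rayD(3)[OF assms] by fastforce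
  then show ?thesis unfolding eventually_sequentially by blast
qed auto

text \<open>To return across an edge the ray would have to traverse that same edge backwards,
  against injectivity.\<close>

lemma ray_past_edge:
  assumes r: "r \<in> rays X R" and "Suc n \<le> m"
  shows "R (r m) (r (Suc n)) (r n)"
  using assms(2)
proof (induction m rule: dec_induct)
  case base
  show ?case using R_left rayD(1)[OF r] by blast
next
  case (step m)
  show ?case
  proof (rule ccontr)
    assume n: "\<not> R (r (Suc m)) (r (Suc n)) (r n)"
    have "R (r (Suc m)) (r n) (r (Suc n))"
      using n side_iff[OF rayD(2)[OF r, of n] rayD(1)[OF r, of "Suc m"]] by blast
    then have "r m = r (Suc n) \<and> r (Suc m) = r n"
      using step.IH crossing_edge[OF rayD(2)[OF r] adj_sym[OF rayD(2)[OF r]]] by blast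
    then show False using rayD(3)[OF r] step by auto
  qed
qed

lemma ray_before_edge:
  assumes r: "r \<in> rays X R" and "m \<le> n"
  shows "R (r m) (r n) (r (Suc n))"
  using assms(2)
proof (induction m rule: inc_induct)
  case base
  show ?case using R_left rayD(1)[OF r] by blast
next
  case (step m)
  show ?case
  proof (rule ccontr)
    assume n: "\<not> R (r m) (r n) (r (Suc n))"
    have "R (r m) (r (Suc n)) (r n)"
      using n side_iff[OF rayD(2)[OF r, of n] rayD(1)[OF r, of m]] by blast
    then have "r m = r (Suc n) \<and> r (Suc m) = r n"
      using step.IH crossing_edge[OF rayD(2)[OF r] adj_sym[OF rayD(2)[OF r]]] by blast
    then show False using rayD(3)[OF r] step by auto
  qed
qed

lemma across_edge:
  assumes ab: "adj a b" and z: "z \<in> X" "x \<in> X" "R x a b" "R z b a"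
  shows "R x a z"
  using R_split[of x a b z] side_iff[OF ab z(1)] adjD[OF ab] z by blast

lemma ray_geodesic:
  assumes r: "r \<in> rays X R" and "i \<le> k"
  shows "\<forall>\<^sub>F n in sequentially. R (r i) (r k) (r n)"
proof -
  have "R (r i) (r k) (r n)" if "Suc k \<le> n" for n
    using across_edge[OF rayD(2)[OF r, of k]] rayD(1)[OF r] ray_before_edge[OF r assms(2)]
      ray_past_edge[OF r that] by blast
  then show ?thesis unfolding eventually_sequentially by blast
qed

text \<open>Once the ray avoids \<open>u\<close> it cannot change branches at \<open>u\<close>,
  since the only way out of the branch of \<open>w\<close> is the edge to \<open>u\<close>.\<close>

lemma ray_ex_nbr:
  assumes r: "r \<in> rays X R" and u: "u \<in> X"
  obtains w where "adj u w" "toward r w u"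
proof -
  obtain M where M: "\<And>n. M \<le> n \<Longrightarrow> r n \<noteq> u"
    using ray_avoids[OF r, of u] unfolding eventually_sequentially by blast
  obtain w where w: "adj u w" "R (r M) w u"
    using ex_nbr[OF u rayD(1)[OF r, of M]] M[of M] by auto
  have "R (r n) w u" if "M \<le> n" for n
    using that
  proof (induction n rule: dec_induct)
    case (step n)
    show ?case
    proof (rule ccontr)
      assume "\<not> R (r (Suc n)) w u"
      then have "R (r (Suc n)) u w"
        using side_iff[OF w(1) rayD(1)[OF r]] by blast
      then have "r (Suc n) = u"
        using crossing_edge[OF rayD(2)[OF r] adj_sym[OF w(1)]] step by blast
      then show False using M[of "Suc n"] step by simp
    qed
  qed (rule w)
  then have "toward r w u" unfolding eventually_sequentially by blast
  then show ?thesis using that w by blast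
qed

text \<open>The branch at \<open>a\<close> into which the ray disappears is either that of
  \<open>b\<close> or one lying on the side of \<open>a\<close>.\<close>

lemma toward_iff:
  assumes r: "r \<in> rays X R" and ab: "adj a b"
  shows "toward r a b \<longleftrightarrow> \<not> toward r b a"
proof
  assume 1: "toward r a b"
  show "\<not> toward r b a"
  proof
    assume "toward r b a"
    with 1 have "\<forall>\<^sub>F n in sequentially. False"
      by eventually_elim (use side_iff[OF ab] rayD(1)[OF r] in blast)
    then show False by simp
  qed
next
  assume n: "\<not> toward r b a"
  obtain w where w: "adj a w" "toward r w a"
    using ray_ex_nbr[OF r adjD(1)[OF ab]] .
  have "w \<noteq> b" using n w by blast
  from w(2) show "toward r a b"
  proof eventually_elim
    case (elim n)
    then show ?case
      using nbr_unique[OF ab w(1) rayD(1)[OF r], of n] \<open>w \<noteq> b\<close> side_iff[OF ab rayD(1)[OF r], of n] by blast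
  qed
qed

lemma ray_equiv_toward:
  assumes rs: "(r, s) \<in> ray_equiv X R" and ab: "adj a b" and r: "toward r a b"
  shows "toward s a b"
proof (rule ccontr)
  assume n: "\<not> toward s a b"
  have rays: "r \<in> rays X R" "s \<in> rays X R" and inf: "infinite (range r \<inter> range s)"
    using rs by (auto simp: ray_equiv_def)
  have "toward s b a" using toward_iff[OF rays(2) ab] n by blast
  then obtain M' where M': "\<And>n. M' \<le> n \<Longrightarrow> R (s n) b a"
    unfolding eventually_sequentially by blast
  obtain M where M: "\<And>n. M \<le> n \<Longrightarrow> R (r n) a b"
    using r unfolding eventually_sequentially by blast
  have "infinite (range r \<inter> range s - (r ` {..<M} \<union> s ` {..<M'}))"
    using inf by (intro Diff_infinite_finite) auto
  then have "range r \<inter> range s - (r ` {..<M} \<union> s ` {..<M'}) \<noteq> {}"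
    by (rule infinite_imp_nonempty)
  then obtain p where p: "p \<in> range r" "p \<in> range s" "p \<notin> r ` {..<M}" "p \<notin> s ` {..<M'}"
    by blast
  obtain i where i: "p = r i" using p(1) by blast
  obtain j where j: "p = s j" using p(2) by blast
  have "M \<le> i" using p(3) unfolding i by (meson imageI lessThan_iff not_le)
  then have "R p a b" unfolding i by (rule M)
  have "M' \<le> j" using p(4) unfolding j by (meson imageI lessThan_iff not_le)
  then have "R p b a" unfolding j by (rule M')
  then show False using side_iff[OF ab rayD(1)[OF rays(1), of i]] \<open>R p a b\<close> unfolding i by blast
qed

text \<open>A ray \<open>s\<close> all of whose edges point towards the end of \<open>r\<close> runs through every point between
  \<open>s 0\<close> and that end: otherwise \<open>s\<close> would be confined to a finite interval.\<close>

lemma ray_exhausts: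
  assumes r: "r \<in> rays X R" and s: "s \<in> rays X R"
    and step: "\<And>n. toward r (s (Suc n)) (s n)"
    and u: "u \<in> X" "\<forall>\<^sub>F n in sequentially. R (s 0) u (r n)"
  shows "u \<in> range s"
proof (rule ccontr)
  assume n: "u \<notin> range s"
  have "R (s 0) (s i) u" for i
  proof (induction i)
    case 0
    show ?case using R_left rayD(1)[OF s] u by blast
  next
    case (Suc i)
    have "s i \<noteq> u" using n by blast
    then obtain w where w: "adj (s i) w" "R u w (s i)"
      using ex_nbr[OF rayD(1)[OF s] u(1)] by blast
    note wX = adjD(2)[OF w(1)]
    have "R (s i) w u" using R_sym w wX u rayD(1)[OF s] by blast
    have "\<forall>\<^sub>F n in sequentially. R (r n) w (s i)"
      using u(2)
    proof eventually_elim
      case (elim n)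
      have "R (s i) u (r n)"
        using R_inner[of "s 0" "s i" u "r n"] Suc elim u rayD(1)[OF s] rayD(1)[OF r] by blast
      then have "R (s i) w (r n)"
        using R_trans_left[of "s i" u "r n" w] \<open>R (s i) w u\<close> wX u rayD(1)[OF s] rayD(1)[OF r] by blast
      then show ?case using R_sym wX rayD(1)[OF s] rayD(1)[OF r] by blast
    qed
    with step[of i] have "\<forall>\<^sub>F n in sequentially. w = s (Suc i)"
      by eventually_elim (use nbr_unique[OF w(1) rayD(2)[OF s]] rayD(1)[OF r] in blast)
    then have "w = s (Suc i)" by simp
    then show ?case
      using R_trans_right[of "s 0" "s i" u w] Suc \<open>R (s i) w u\<close> wX u rayD(1)[OF s] by blast
  qed
  then have "range s \<subseteq> interval X R (s 0) u"
    using rayD(1)[OF s] by (auto simp: interval_def)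
  then have "finite (range s)"
    using finite_interval[OF rayD(1)[OF s] u(1)] finite_subset by blast
  moreover have "inj s" using s by (simp add: rays_def)
  ultimately show False using finite_imageD by blast
qed

text \<open>The ray meets the finite interval [x, r 0] only finitely often, while an edge of the ray
  traversed towards \<open>x\<close> would end in it.\<close>

lemma ray_joined:
  assumes r: "r \<in> rays X R" and x: "x \<in> X"
  shows "\<forall>\<^sub>F k in sequentially. \<forall>\<^sub>F n in sequentially. R x (r k) (r n)"
proof -
  have "finite (r -` interval X R x (r 0))"
    using r finite_interval[OF x rayD(1)[OF r]] by (intro finite_vimageI) (auto simp: rays_def)
  then have "\<exists>M. \<forall>k\<in>r -` interval X R x (r 0). k < M"
    by (simp only: finite_nat_set_iff_bounded)
  then obtain M where M: "\<And>k. k \<in> r -` interval X R x (r 0) \<Longrightarrow> k < M"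
    by blast
  have "\<forall>\<^sub>F n in sequentially. R x (r k) (r n)" if k: "M \<le> k" for k
  proof -
    note e = rayD(2)[OF r, of k]
    have "R x (r k) (r (Suc k))"
    proof (rule ccontr)
      assume "\<not> R x (r k) (r (Suc k))"
      then have "R x (r (Suc k)) (r k)" using side_iff[OF e x] by blast
      then have "R x (r (Suc k)) (r 0)"
        using across_edge[OF adj_sym[OF e] rayD(1)[OF r] x] ray_before_edge[OF r, of 0 k] by blast
      then have "Suc k \<in> r -` interval X R x (r 0)"
        using rayD(1)[OF r] by (simp add: interval_def)
      then have "Suc k < M" by (rule M)
      then show False using k by simp
    qed
    then have "R x (r k) (r n)" if "Suc k \<le> n" for n
      using across_edge[OF e rayD(1)[OF r] x] ray_past_edge[OF r that] by blast
    then show ?thesis unfolding eventually_sequentially by blast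
  qed
  then show ?thesis unfolding eventually_sequentially[of "\<lambda>k. \<forall>\<^sub>F n in sequentially. R x (r k) (r n)"] by blast
qed

text \<open>With \<open>w\<close> the first step from \<open>u\<close> to \<open>x\<close>,
  betweenness of \<open>u\<close> becomes a statement about the sides of the edge (u, w), so it
  depends only on the sides that contain the ray eventually.\<close>

lemma between_transfer:
  assumes r: "r \<in> rays X R" and s: "s \<in> rays X R" and X: "x \<in> X" "u \<in> X"
    and tr: "\<And>a b. adj a b \<Longrightarrow> toward r a b \<Longrightarrow> toward s a b"
    and B: "\<forall>\<^sub>F n in sequentially. R x u (r n)"
  shows "\<forall>\<^sub>F n in sequentially. R x u (s n)"
proof (cases "u = x")
  case True
  then show ?thesis using R_left X rayD(1)[OF s] by simp
next
  case False
  obtain w where w: "adj u w" "\<And>z. z \<in> X \<Longrightarrow> R z u x \<longleftrightarrow> R z u w"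
    using ex_nbr[OF X(2,1) False] by blast
  have *: "R x u z \<longleftrightarrow> R z u w" if "z \<in> X" for z
    using w(2)[OF that] R_sym X that by blast
  have "toward r u w"
    using B by eventually_elim (use * rayD(1)[OF r] in blast)
  then have "toward s u w" by (rule tr[OF w(1)])
  then show ?thesis
    by eventually_elim (use * rayD(1)[OF s] in blast)
qed

text \<open>Late points of \<open>s\<close> lie between \<open>r 0\<close> and the end of
  \<open>s\<close>, hence between \<open>r 0\<close> and the end of \<open>r\<close>, and
  \<open>r\<close> runs through all points of that kind.\<close>

lemma same_sides_ray_equiv:
  assumes r: "r \<in> rays X R" and s: "s \<in> rays X R"
    and tr: "\<And>a b. adj a b \<Longrightarrow> toward s a b \<Longrightarrow> toward r a b"
  shows "(r, s) \<in> ray_equiv X R"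
proof -
  obtain M where M: "\<And>k. M \<le> k \<Longrightarrow> \<forall>\<^sub>F n in sequentially. R (r 0) (s k) (s n)"
    using ray_joined[OF s rayD(1)[OF r, of 0]]
    unfolding eventually_sequentially[of "\<lambda>k. \<forall>\<^sub>F n in sequentially. R (r 0) (s k) (s n)"] by blast
  have "s k \<in> range r" if k: "M \<le> k" for k
  proof (rule ray_exhausts[OF r r _ rayD(1)[OF s]])
    show "toward r (r (Suc n)) (r n)" for n
      using ray_past_edge[OF r] unfolding eventually_sequentially by blast
    show "\<forall>\<^sub>F n in sequentially. R (r 0) (s k) (r n)"
      by (rule between_transfer[OF s r rayD(1)[OF r] rayD(1)[OF s] tr M[OF k]])
  qed
  then have "s ` {M..} \<subseteq> range r \<inter> range s" by blast
  moreover have "infinite (s ` {M..})"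
  proof
    assume "finite (s ` {M..})"
    moreover have "inj_on s {M..}" using s by (auto simp: rays_def intro: inj_on_subset)
    ultimately have "finite {M..}" by (rule finite_imageD)
    then show False using infinite_Ici by blast
  qed
  ultimately have "infinite (range r \<inter> range s)" using infinite_super by blast
  then show ?thesis using r s by (simp add: ray_equiv_def)
qed

lemma ray_equiv_sym: "(r, s) \<in> ray_equiv X R \<Longrightarrow> (s, r) \<in> ray_equiv X R"
  by (auto simp: ray_equiv_def Int_commute)

text \<open>Transitivity is the issue: infinite intersections do not compose, but agreement on all
  sides does.\<close>

lemma equiv_ray_equiv: "equiv (rays X R) (ray_equiv X R)"
proof (rule equivI)
  show "ray_equiv X R \<subseteq> rays X R \<times> rays X R" by (auto simp: ray_equiv_def)
  show "refl_on (rays X R) (ray_equiv X R)"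
    by (auto simp: refl_on_def ray_equiv_def rays_def dest: range_inj_infinite)
  show "sym (ray_equiv X R)" using ray_equiv_sym by (auto simp: sym_def)
  show "trans (ray_equiv X R)"
  proof (rule transI)
    fix r s t assume rs: "(r, s) \<in> ray_equiv X R" and st: "(s, t) \<in> ray_equiv X R"
    have rays: "r \<in> rays X R" "t \<in> rays X R" using rs st by (auto simp: ray_equiv_def)
    show "(r, t) \<in> ray_equiv X R"
    proof (rule same_sides_ray_equiv[OF rays])
      fix a b assume ab: "adj a b" "toward t a b"
      have "toward s a b" by (rule ray_equiv_toward[OF ray_equiv_sym[OF st] ab])
      then show "toward r a b" by (rule ray_equiv_toward[OF ray_equiv_sym[OF rs] ab(1)])
    qed
  qed
qed

lemma EndsD:
  assumes "\<xi> \<in> Ends X R"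
  shows "\<xi> \<noteq> {}" "\<xi> \<subseteq> rays X R" "r \<in> \<xi> \<Longrightarrow> (r, s) \<in> ray_equiv X R \<longleftrightarrow> s \<in> \<xi>"
proof -
  have \<xi>: "\<xi> \<in> rays X R // ray_equiv X R" using assms by (simp only: Ends_def)
  show "\<xi> \<noteq> {}" by (rule in_quotient_imp_non_empty[OF equiv_ray_equiv \<xi>])
  show "\<xi> \<subseteq> rays X R" by (rule in_quotient_imp_subset[OF equiv_ray_equiv \<xi>])
  show "(r, s) \<in> ray_equiv X R \<longleftrightarrow> s \<in> \<xi>" if "r \<in> \<xi>"
    using in_quotient_imp_in_rel[OF equiv_ray_equiv \<xi>, of r s]
      in_quotient_imp_closed[OF equiv_ray_equiv \<xi> that, of s] that by blast
qed

lemma Ends_toward: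
  assumes "\<xi> \<in> Ends X R" "r \<in> \<xi>" "s \<in> \<xi>" "adj a b"
  shows "toward r a b \<longleftrightarrow> toward s a b"
proof -
  have "(r, s) \<in> ray_equiv X R" "(s, r) \<in> ray_equiv X R"
    using EndsD(3)[OF assms(1)] assms by blast+
  then show ?thesis using ray_equiv_toward assms(4) by blast
qed

lemma Ends_separated:
  assumes \<xi>: "\<xi> \<in> Ends X R" and \<eta>: "\<eta> \<in> Ends X R" and ne: "\<xi> \<noteq> \<eta>" and r: "r \<in> \<xi>" and s: "s \<in> \<eta>"
  shows "\<exists>a b. adj a b \<and> toward r a b \<and> toward s b a"
proof (rule ccontr)
  assume n: "\<not> ?thesis"
  have rays: "r \<in> rays X R" "s \<in> rays X R"
    using EndsD(2)[OF \<xi>] EndsD(2)[OF \<eta>] r s by blast+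
  have "(s, r) \<in> ray_equiv X R"
  proof (rule same_sides_ray_equiv[OF rays(2,1)])
    fix a b assume "adj a b" "toward r a b"
    then show "toward s a b"
      using n toward_iff[OF rays(2), of a b] by blast
  qed
  then have "r \<in> \<eta>" using EndsD(3)[OF \<eta> s] by blast
  then have "\<xi> = \<eta>"
    using EndsD(3)[OF \<eta>, of r] EndsD(3)[OF \<xi> r] by blast
  then show False using ne by blast
qed

text \<open>Stepping repeatedly to the neighbour towards the end gives \<open>s\<close>. If it ever
  returned, some \<open>s i\<close> and \<open>s (Suc i)\<close> would each lie between the other
  and the end.\<close>

lemma ex_ray_from:
  assumes \<xi>: "\<xi> \<in> Ends X R" and x: "x \<in> X"
  obtains s where "s \<in> \<xi>" "s 0 = x"
proof -
  obtain r where r\<xi>: "r \<in> \<xi>" using EndsD(1)[OF \<xi>] by blast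
  then have r: "r \<in> rays X R" using EndsD(2)[OF \<xi>] by blast
  have "\<exists>w. u \<in> X \<longrightarrow> adj u w \<and> toward r w u" for u
    using ray_ex_nbr[OF r] by metis
  then obtain nxt where nxt: "\<And>u. u \<in> X \<Longrightarrow> adj u (nxt u)" "\<And>u. u \<in> X \<Longrightarrow> toward r (nxt u) u"
    by metis
  define s where "s n = (nxt ^^ n) x" for n
  have s0: "s 0 = x" by (simp add: s_def)
  have sS: "s (Suc n) = nxt (s n)" for n by (simp add: s_def)
  have sX: "s n \<in> X" for n
    by (induction n) (use x s0 sS adjD(2) nxt(1) in auto)
  have step: "toward r (s (Suc n)) (s n)" and adj: "adj (s n) (s (Suc n))" for n
    using nxt sX sS by auto
  have B: "\<forall>\<^sub>F n in sequentially. R (s i) (s j) (r n)" if "i \<le> j" for i j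
    using that
  proof (induction j rule: dec_induct)
    case base
    then show ?case using R_left sX rayD(1)[OF r] by simp
  next
    case (step j)
    from step.IH \<open>toward r (s (Suc j)) (s j)\<close> show ?case
    proof eventually_elim
      case (elim n)
      then show ?case
        using R_trans_right[of "s i" "s j" "r n" "s (Suc j)"] R_sym sX rayD(1)[OF r] by blast
    qed
  qed
  have ne: "s i \<noteq> s k" if "i < k" for i k
  proof
    assume eq: "s i = s k"
    have "\<forall>\<^sub>F n in sequentially. R (s (Suc i)) (s i) (r n)"
      using B[of "Suc i" k] that eq by simp
    with step[of i] have "\<forall>\<^sub>F n in sequentially. s i = s (Suc i)"
    proof eventually_elim
      case (elim n)
      then have "R (r n) (s i) (s (Suc i))" using R_sym sX rayD(1)[OF r] by blast
      then show ?case using R_antisym elim sX rayD(1)[OF r] by blast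
    qed
    then show False using adjD(3)[OF adj[of i]] by simp
  qed
  have s: "s \<in> rays X R"
    using sX adj ne by (auto simp: rays_def inj_def) (metis linorder_neqE_nat)
  have "(s, r) \<in> ray_equiv X R"
  proof -
    obtain M where M: "\<And>k. M \<le> k \<Longrightarrow> \<forall>\<^sub>F n in sequentially. R x (r k) (r n)"
      using ray_joined[OF r x]
      unfolding eventually_sequentially[of "\<lambda>k. \<forall>\<^sub>F n in sequentially. R x (r k) (r n)"] by blast
    have "r ` {M..} \<subseteq> range r \<inter> range s"
      using ray_exhausts[OF r s step rayD(1)[OF r]] M s0 by auto
    moreover have "infinite (r ` {M..})"
    proof
      assume "finite (r ` {M..})"
      moreover have "inj_on r {M..}" using r by (auto simp: rays_def intro: inj_on_subset)
      ultimately have "finite {M..}" by (rule finite_imageD)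
      then show False using infinite_Ici by blast
    qed
    ultimately have "infinite (range r \<inter> range s)" using infinite_super by blast
    then show ?thesis using r s by (simp add: ray_equiv_def Int_commute)
  qed
  then have "s \<in> \<xi>" using EndsD(3)[OF \<xi> r\<xi>] ray_equiv_sym by blast
  then show ?thesis using that s0 by blast
qed

text \<open>Makes the interval from a point to an end accessible through an arbitrary ray of the
  end, wherever that ray starts.\<close>

lemma ray_points_iff:
  assumes \<xi>: "\<xi> \<in> Ends X R" and r: "r \<in> \<xi>" and X: "x \<in> X" "u \<in> X"
  shows "u \<in> ray_points x \<xi> \<longleftrightarrow> (\<forall>\<^sub>F n in sequentially. R x u (r n))"
proof
  assume "u \<in> ray_points x \<xi>"
  then obtain s k where s: "s \<in> \<xi>" "s 0 = x" "u = s k"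
    by (auto simp: ray_points_def)
  have rays: "r \<in> rays X R" "s \<in> rays X R" using EndsD(2)[OF \<xi>] r s by blast+
  have "\<forall>\<^sub>F n in sequentially. R x u (s n)"
    using ray_geodesic[OF rays(2), of 0 k] s by simp
  then show "\<forall>\<^sub>F n in sequentially. R x u (r n)"
    using Ends_toward[OF \<xi> r s(1)] by (intro between_transfer[OF rays(2,1) X]) blast+
next
  assume B: "\<forall>\<^sub>F n in sequentially. R x u (r n)"
  obtain s where s: "s \<in> \<xi>" "s 0 = x" by (rule ex_ray_from[OF \<xi> X(1)])
  have rays: "r \<in> rays X R" "s \<in> rays X R" using EndsD(2)[OF \<xi>] r s by blast+
  have "\<forall>\<^sub>F n in sequentially. R (s 0) u (s n)"
    unfolding s(2) using Ends_toward[OF \<xi> r s(1)] by (intro between_transfer[OF rays X _ B]) blast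
  then have "u \<in> range s"
    using ray_past_edge[OF rays(2)] X(2)
    by (intro ray_exhausts[OF rays(2) rays(2)]) (auto simp: eventually_sequentially)
  then show "u \<in> ray_points x \<xi>" using s by (auto simp: ray_points_def)
qed

end


context Z_tree_space
begin

section \<open>Bi-infinite lines\<close>

lemma line_shift_rays:
  assumes l: "l \<in> lines X R"
  shows "(\<lambda>n. l (k + int n)) \<in> rays X R" "(\<lambda>n. l (k - int n)) \<in> rays X R"
proof -
  have lX: "l i \<in> X" and inj: "l i = l j \<longleftrightarrow> i = j" and adj: "adj (l i) (l (i + 1))" for i j
    using l by (auto simp: lines_def inj_def)
  show "(\<lambda>n. l (k + int n)) \<in> rays X R"
    using lX inj adj[of "k + int n" for n] by (auto simp: rays_def inj_def add_ac)
  have "adj (l (k - int n)) (l (k - int (Suc n)))" for n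
    using adj_sym[OF adj[of "k - int (Suc n)"]] by simp
  then show "(\<lambda>n. l (k - int n)) \<in> rays X R"
    using lX inj by (auto simp: rays_def inj_def)
qed

text \<open>Here \<open>w\<close> is the neighbour of \<open>u\<close> towards \<eta>. A line leaves
  \<open>u\<close> by two different neighbours, so its half going to \<xi> stays on the side of
  \<open>u\<close>. Conversely, the rays from \<open>u\<close> to the two ends leave by different
  neighbours, hence never meet again and join to a line.\<close>

lemma line_points_iff:
  assumes \<xi>: "\<xi> \<in> Ends X R" and \<eta>: "\<eta> \<in> Ends X R" and r: "r \<in> \<xi>" and s: "s \<in> \<eta>"
    and uw: "adj u w" and sw: "toward s w u"
  shows "u \<in> line_points X R \<xi> \<eta> \<longleftrightarrow> toward r u w"
proof
  assume "u \<in> line_points X R \<xi> \<eta>"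
  then obtain l k where l: "l \<in> lines X R" and u: "u = l k"
    and l\<xi>: "(\<lambda>n. l (- int n)) \<in> \<xi>" and l\<eta>: "(\<lambda>n. l (int n)) \<in> \<eta>"
    by (auto simp: line_points_def)
  have inj: "inj l" using l by (simp add: lines_def)
  have inf: "infinite (l ` A)" if "infinite A" for A
    using inj that by (meson finite_imageD inj_on_subset subset_UNIV)
  let ?t = "\<lambda>n. l (k + int n)" and ?t' = "\<lambda>n. l (k - int n)"
  note t = line_shift_rays(1)[OF l, of k] and t' = line_shift_rays(2)[OF l, of k]
  \<comment> \<open>The half-lines starting at 0 and at \<open>k\<close> share all points from the
    larger of the two indices on, so they define the same end.\<close>
  have "l ` {max 0 k..} \<subseteq> range (\<lambda>n. l (int n)) \<inter> range ?t"
  proof (rule image_subsetI)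
    fix i assume "i \<in> {max 0 k..}"
    then have "i = int (nat i)" "i = k + int (nat (i - k))" by auto
    then show "l i \<in> range (\<lambda>n. l (int n)) \<inter> range ?t" by (metis IntI rangeI)
  qed
  from infinite_super[OF this inf[OF infinite_Ici]] have "((\<lambda>n. l (int n)), ?t) \<in> ray_equiv X R"
    using line_shift_rays(1)[OF l, of 0] t by (simp add: ray_equiv_def)
  then have t\<eta>: "?t \<in> \<eta>" using EndsD(3)[OF \<eta> l\<eta>] by blast
  have "l ` {..min 0 k} \<subseteq> range (\<lambda>n. l (- int n)) \<inter> range ?t'"
  proof (rule image_subsetI)
    fix i assume "i \<in> {..min 0 k}"
    then have "i = - int (nat (- i))" "i = k - int (nat (k - i))" by auto
    then show "l i \<in> range (\<lambda>n. l (- int n)) \<inter> range ?t'" by (metis IntI rangeI)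
  qed
  from infinite_super[OF this inf[OF infinite_Iic]] have "((\<lambda>n. l (- int n)), ?t') \<in> ray_equiv X R"
    using line_shift_rays(2)[OF l, of 0] t' by (simp add: ray_equiv_def)
  then have t'\<xi>: "?t' \<in> \<xi>" using EndsD(3)[OF \<xi> l\<xi>] by blast
  have "toward ?t (?t (Suc 0)) (?t 0)" "toward ?t' (?t' (Suc 0)) (?t' 0)"
    using ray_past_edge[OF t, of 0] ray_past_edge[OF t', of 0]
    by (auto simp: eventually_sequentially simp del: One_nat_def)
  then have past: "toward ?t (l (k + 1)) u" "toward ?t' (l (k - 1)) u"
    by (simp_all add: u)
  have adj: "adj u (l (k + 1))" "adj u (l (k - 1))"
    using rayD(2)[OF t, of 0] rayD(2)[OF t', of 0] by (simp_all add: u)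
  have "toward ?t w u" using Ends_toward[OF \<eta> s t\<eta> adj_sym[OF uw]] sw by blast
  with past(1) have "\<forall>\<^sub>F n in sequentially. l (k + 1) = w"
    by eventually_elim (rule nbr_unique[OF adj(1) uw rayD(1)[OF t]])
  then have w: "w = l (k + 1)" by simp
  then have "l (k - 1) \<noteq> w" using inj by (simp add: inj_eq)
  from past(2) have "toward ?t' u w"
  proof eventually_elim
    case (elim n)
    show ?case
      using nbr_unique[OF adj(2) uw rayD(1)[OF t', of n] elim] \<open>l (k - 1) \<noteq> w\<close>
        side_iff[OF uw rayD(1)[OF t', of n]] by blast
  qed
  then show "toward r u w" using Ends_toward[OF \<xi> r t'\<xi> uw] by blast
next
  assume ru: "toward r u w"
  note uX = adjD(1)[OF uw]
  obtain s' where s': "s' \<in> \<eta>" "s' 0 = u" by (rule ex_ray_from[OF \<eta> uX])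
  obtain r' where r': "r' \<in> \<xi>" "r' 0 = u" by (rule ex_ray_from[OF \<xi> uX])
  have rays: "s' \<in> rays X R" "r' \<in> rays X R"
    using EndsD(2)[OF \<xi>] EndsD(2)[OF \<eta>] r' s' by blast+
  have ds: "s' i = s' j \<longleftrightarrow> i = j" and dr: "r' i = r' j \<longleftrightarrow> i = j" for i j
    using rayD(3)[OF rays(1)] rayD(3)[OF rays(2)] by blast+
  have adj: "adj u (s' 1)" "adj u (r' 1)"
    using rayD(2)[OF rays(1), of 0] rayD(2)[OF rays(2), of 0] s' r' by simp_all
  have past_s: "R (s' n) (s' 1) u" and past_r: "R (r' n) (r' 1) u" if "1 \<le> n" for n
    using ray_past_edge[OF rays(1), of 0 n] ray_past_edge[OF rays(2), of 0 n] s' r' that by simp_all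
  have "toward s' w u" using Ends_toward[OF \<eta> s s'(1) adj_sym[OF uw]] sw by blast
  moreover have "toward s' (s' 1) u" using past_s unfolding eventually_sequentially by blast
  ultimately have "\<forall>\<^sub>F n in sequentially. s' 1 = w"
    by eventually_elim (rule nbr_unique[OF adj(1) uw rayD(1)[OF rays(1)]])
  then have w: "s' 1 = w" by simp
  have "r' 1 \<noteq> w"
  proof
    assume "r' 1 = w"
    then have "toward r' w u" using past_r unfolding eventually_sequentially by blast
    moreover have "toward r' u w" using Ends_toward[OF \<xi> r r'(1) uw] ru by blast
    ultimately show False using toward_iff[OF rays(2) uw] by blast
  qed
  \<comment> \<open>Index 0 is exempt for \<open>r'\<close> because both rays start at
    \<open>u\<close>; the line below takes \<open>u\<close> from \<open>s'\<close>.\<close>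
  then have ne: "s' i \<noteq> r' j" if "1 \<le> j" for i j
  proof (cases "i = 0")
    case True
    then show ?thesis using dr[of 0 j] that s' r' by auto
  next
    case False
    then show ?thesis
      using nbr_unique[OF adj rayD(1)[OF rays(1), of i] past_s] past_r[OF that] \<open>r' 1 \<noteq> w\<close> w by auto
  qed
  define l where "l i = (if 0 \<le> i then s' (nat i) else r' (nat (- i)))" for i
  have "l i \<noteq> l j" if "i < j" for i j
  proof -
    consider "0 \<le> i" | "j < 0" | "i < 0" "0 \<le> j" using that by linarith
    then show ?thesis
    proof cases
      case 3
      then have "1 \<le> nat (- i)" by simp
      from ne[OF this, of "nat j", symmetric] 3 show ?thesis by (simp add: l_def)
    qed (use that in \<open>auto simp: l_def ds dr\<close>)
  qed
  then have "inj l" by (auto simp: inj_def) (metis linorder_neqE)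
  moreover have "adj (l i) (l (i + 1))" for i
  proof -
    consider "0 \<le> i" | "i = -1" | "i < -1" by linarith
    then show ?thesis
    proof cases
      case 1
      then have "nat (i + 1) = Suc (nat i)" by simp
      then show ?thesis using rayD(2)[OF rays(1), of "nat i"] 1 by (simp add: l_def)
    next
      case 2
      then show ?thesis using adj_sym[OF adj(2)] s'(2) by (simp add: l_def)
    next
      case 3
      then have "nat (- i) = Suc (nat (- (i + 1)))" by simp
      then show ?thesis using adj_sym[OF rayD(2)[OF rays(2), of "nat (- (i + 1))"]] 3 by (simp add: l_def)
    qed
  qed
  moreover have "range l \<subseteq> X"
    using rayD(1)[OF rays(1)] rayD(1)[OF rays(2)] by (auto simp: l_def)
  ultimately have "l \<in> lines X R" by (simp add: lines_def)
  moreover have "(\<lambda>n. l (- int n)) = r'"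
    using s' r' by (auto simp: l_def)
  moreover have "(\<lambda>n. l (int n)) = s'"
    by (auto simp: l_def)
  moreover have "u \<in> range l" using s' by (intro range_eqI[of _ _ 0]) (simp add: l_def)
  ultimately show "u \<in> line_points X R \<xi> \<eta>"
    using r'(1) s'(1) unfolding line_points_def by blast
qed


section \<open>The shadow topology in terms of sides\<close>

text \<open>For an edge all rays of \<xi> agree by \<open>Ends_toward\<close>, so any single ray
  decides on which side the end lies.\<close>

definition hat_side :: "'a \<Rightarrow> 'a \<Rightarrow> 'a hat set" where
  "hat_side a b = Inl ` {x \<in> X. R x a b} \<union> Inr ` {\<xi> \<in> Ends X R. \<forall>r\<in>\<xi>. toward r a b}"

lemma hat_cases:
  assumes "p \<in> hat X R"
  obtains x where "p = Inl x" "x \<in> X" | \<xi> r where "p = Inr \<xi>" "\<xi> \<in> Ends X R" "r \<in> \<xi>" "r \<in> rays X R"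
proof -
  consider x where "p = Inl x" "x \<in> X" | \<xi> where "p = Inr \<xi>" "\<xi> \<in> Ends X R"
    using assms by (auto simp: hat_def)
  then show ?thesis
  proof cases
    case (2 \<xi>)
    obtain r where "r \<in> \<xi>" using EndsD(1)[OF 2(2)] by blast
    moreover from this have "r \<in> rays X R" using EndsD(2)[OF 2(2)] by blast
    ultimately show ?thesis using that(2) 2 by blast
  qed (use that in blast)
qed

lemma Inl_hat_side: "x \<in> X \<Longrightarrow> Inl x \<in> hat_side a b \<longleftrightarrow> R x a b"
  by (auto simp: hat_side_def)

lemma Inr_hat_side:
  "\<xi> \<in> Ends X R \<Longrightarrow> r \<in> \<xi> \<Longrightarrow> adj a b \<Longrightarrow> Inr \<xi> \<in> hat_side a b \<longleftrightarrow> toward r a b"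
  using Ends_toward unfolding hat_side_def by blast

lemma hat_side_subset: "hat_side a b \<subseteq> hat X R"
  by (auto simp: hat_side_def hat_def)

lemma hat_side_complement:
  assumes ab: "adj a b"
  shows "hat X R - hat_side a b = hat_side b a"
proof -
  have "p \<in> hat_side a b \<longleftrightarrow> p \<notin> hat_side b a" if "p \<in> hat X R" for p
    using that
  proof (cases rule: hat_cases)
    case (1 x)
    then show ?thesis using side_iff[OF ab] Inl_hat_side by blast
  next
    case (2 \<xi> r)
    then show ?thesis
      using toward_iff[OF 2(4) ab] Inr_hat_side[OF 2(2,3)] ab adj_sym[OF ab] by blast
  qed
  then show ?thesis using hat_side_subset by blast
qed

text \<open>Allows corners to be tested on \<open>X\<close>: an end in a corner brings late points
  of its rays with it.\<close>

lemma common_point: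
  assumes p: "p \<in> hat_side a b" "p \<in> hat_side c d" and "adj a b" "adj c d"
  shows "\<exists>x\<in>X. R x a b \<and> R x c d"
proof -
  have "p \<in> hat X R" using p hat_side_subset by blast
  then show ?thesis
  proof (cases rule: hat_cases)
    case (1 x)
    then show ?thesis using p Inl_hat_side by blast
  next
    case (2 \<xi> r)
    have "toward r a b" "toward r c d"
      using p Inr_hat_side[OF 2(2,3)] assms(3,4) 2(1) by blast+
    then have "\<forall>\<^sub>F n in sequentially. R (r n) a b \<and> R (r n) c d"
      by (rule eventually_conj)
    then obtain n where "R (r n) a b \<and> R (r n) c d"
      unfolding eventually_sequentially by blast
    then show ?thesis using rayD(1)[OF 2(4)] by blast
  qed
qed

lemma hat_sides_crossing_free:
  assumes ab: "adj a b" and cd: "adj c d"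
  shows "crossing_free (hat X R) (hat_side a b) (hat_side c d)"
proof (rule ccontr)
  note c = hat_side_complement[OF ab] hat_side_complement[OF cd]
  note ba = adj_sym[OF ab] and dc = adj_sym[OF cd]
  assume "\<not> ?thesis"
  then obtain p1 p2 p3 p4 where
    "p1 \<in> hat_side a b" "p1 \<in> hat_side c d" "p2 \<in> hat_side a b" "p2 \<in> hat X R - hat_side c d"
    "p3 \<in> hat X R - hat_side a b" "p3 \<in> hat_side c d"
    "p4 \<in> hat X R - hat_side a b" "p4 \<in> hat X R - hat_side c d"
    unfolding crossing_free_def by blast
  note p = this[unfolded c]
  obtain x1 where 1: "x1 \<in> X" "R x1 a b" "R x1 c d" using common_point[OF p(1,2) ab cd] by blast
  obtain x2 where 2: "x2 \<in> X" "R x2 a b" "R x2 d c" using common_point[OF p(3,4) ab dc] by blast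
  obtain x3 where 3: "x3 \<in> X" "R x3 b a" "R x3 c d" using common_point[OF p(5,6) ba cd] by blast
  obtain x4 where 4: "x4 \<in> X" "R x4 b a" "R x4 d c" using common_point[OF p(7,8) ba dc] by blast
  show False
    by (rule sides_nested[OF ab cd 1(1) 2(1) 3(1) 4(1) 1(2,3) 2(2,3) 3(2,3) 4(2,3)])
qed

lemma hat_separated:
  assumes p: "p \<in> hat X R" and q: "q \<in> hat X R" and ne: "p \<noteq> q"
  obtains a b where "adj a b" "p \<in> hat_side a b" "q \<notin> hat_side a b"
proof -
  \<comment> \<open>A vertex is cut off from any other point by the first edge in that
    direction.\<close>
  have pt: "\<exists>a b. adj a b \<and> Inl x \<in> hat_side a b \<and> y \<in> hat_side b a"
    if x: "x \<in> X" and y: "y \<in> hat X R" "Inl x \<noteq> y" for x y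
    using y(1)
  proof (cases rule: hat_cases)
    case (1 z)
    then obtain w where "adj x w" "R z w x"
      using ex_nbr[OF x 1(2)] y by blast
    then show ?thesis using Inl_hat_side x 1 R_left adjD by blast
  next
    case (2 \<xi> r)
    obtain w where "adj x w" "toward r w x" by (rule ray_ex_nbr[OF 2(4) x])
    then show ?thesis using Inl_hat_side Inr_hat_side[OF 2(2,3)] adj_sym x 2(1) R_left adjD by blast
  qed
  have "\<exists>a b. adj a b \<and> p \<in> hat_side a b \<and> q \<in> hat_side b a"
    using p
  proof (cases rule: hat_cases)
    case (1 x)
    then show ?thesis using pt q ne by blast
  next
    case p': (2 \<xi> r)
    show ?thesis using q
    proof (cases rule: hat_cases)
      case (1 y)
      then show ?thesis using pt[of y p] p ne adj_sym by blast
    next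
      case (2 \<eta> s)
      have "\<xi> \<noteq> \<eta>" using ne p' 2 by blast
      then obtain a b where "adj a b" "toward r a b" "toward s b a"
        using Ends_separated[OF p'(2) 2(2) _ p'(3) 2(3)] by blast
      then show ?thesis
        using Inr_hat_side[OF p'(2,3)] Inr_hat_side[OF 2(2,3)] adj_sym p'(1) 2(1) by blast
    qed
  qed
  then obtain a b where ab: "adj a b" "p \<in> hat_side a b" "q \<in> hat_side b a" by blast
  then have "q \<notin> hat_side a b" using hat_side_complement[OF adj_sym[OF ab(1)]] by blast
  then show ?thesis using that ab by blast
qed

text \<open>With \<open>w\<close> the first step from \<open>u\<close> towards \<open>q\<close>,
  membership of \<open>u\<close> in each kind of interval ending at \<open>q\<close> becomes a
  condition on the side of one edge. That \<open>q\<close> is on the side of \<open>w\<close> pins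
  down \<open>w\<close>.\<close>

lemma shadow_point:
  assumes u: "u \<in> X" and q: "q \<in> hat X R" and ne: "Inl u \<noteq> q"
  obtains w where "adj u w" "q \<in> hat_side w u"
    "shadow (hat X R) (hat_between X R) (Inl u) q = hat_side u w"
proof -
  have sh: "shadow (hat X R) (hat_between X R) (Inl u) q = {p \<in> hat X R. Inl u \<in> hat_interval X R p q}"
    using u by (auto simp: shadow_def interval_def hat_between_def hat_def)
  show ?thesis using q
  proof (cases rule: hat_cases)
    case (1 x)
    then have "u \<noteq> x" using ne by blast
    then obtain w where w: "adj u w" "R x w u" "\<And>z. z \<in> X \<Longrightarrow> R z u x \<longleftrightarrow> R z u w"
      using ex_nbr[OF u 1(2)] by blast
    have "Inl u \<in> hat_interval X R p q \<longleftrightarrow> p \<in> hat_side u w" if "p \<in> hat X R" for p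
      using that
    proof (cases rule: hat_cases)
      case p: (1 y)
      have "Inl u \<in> hat_interval X R p q \<longleftrightarrow> R y u x"
        unfolding p(1) 1(1) using u by (auto simp: interval_def)
      then show ?thesis using w(3)[OF p(2)] Inl_hat_side p by blast
    next
      case p: (2 \<xi> r)
      have "Inl u \<in> hat_interval X R p q \<longleftrightarrow> u \<in> ray_points x \<xi>"
        unfolding p(1) 1(1) by auto
      also have "\<dots> \<longleftrightarrow> (\<forall>\<^sub>F n in sequentially. R x u (r n))"
        by (rule ray_points_iff[OF p(2,3) 1(2) u])
      also have "\<dots> \<longleftrightarrow> toward r u w"
      proof -
        have "R x u (r n) \<longleftrightarrow> R (r n) u w" for n
          using w(3)[OF rayD(1)[OF p(4)]] R_sym u 1(2) rayD(1)[OF p(4)] by blast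
        then show ?thesis by simp
      qed
      finally show ?thesis using Inr_hat_side[OF p(2,3) w(1)] p(1) by blast
    qed
    then have "shadow (hat X R) (hat_between X R) (Inl u) q = hat_side u w"
      unfolding sh using hat_side_subset by blast
    moreover have "q \<in> hat_side w u" using w 1 Inl_hat_side by blast
    ultimately show ?thesis using that w(1) by blast
  next
    case (2 \<eta> s)
    obtain w where w: "adj u w" "toward s w u" by (rule ray_ex_nbr[OF 2(4) u])
    have q_side: "q \<in> hat_side w u" using w Inr_hat_side[OF 2(2,3) adj_sym[OF w(1)]] 2(1) by blast
    have "Inl u \<in> hat_interval X R p q \<longleftrightarrow> p \<in> hat_side u w" if "p \<in> hat X R" for p
      using that
    proof (cases rule: hat_cases)
      case p: (1 x)
      have "Inl u \<in> hat_interval X R p q \<longleftrightarrow> u \<in> ray_points x \<eta>"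
        unfolding p(1) 2(1) by auto
      also have "\<dots> \<longleftrightarrow> (\<forall>\<^sub>F n in sequentially. R x u (s n))"
        by (rule ray_points_iff[OF 2(2,3) p(2) u])
      also have "\<dots> \<longleftrightarrow> R x u w"
      proof
        assume "\<forall>\<^sub>F n in sequentially. R x u (s n)"
        with w(2) have "\<forall>\<^sub>F n in sequentially. R x u w"
        proof eventually_elim
          case (elim n)
          have "\<not> R w u (s n)"
          proof
            assume "R w u (s n)"
            then have "R (s n) u w" using R_sym u adjD(2)[OF w(1)] rayD(1)[OF 2(4)] by blast
            then show False using side_iff[OF w(1) rayD(1)[OF 2(4)]] elim by blast
          qed
          then show ?case
            using R_split[of x u "s n" w] elim p(2) u adjD(2)[OF w(1)] rayD(1)[OF 2(4)] by blast
        qed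
        then show "R x u w" by simp
      next
        assume "R x u w"
        from w(2) show "\<forall>\<^sub>F n in sequentially. R x u (s n)"
          by eventually_elim (rule across_edge[OF w(1) rayD(1)[OF 2(4)] p(2) \<open>R x u w\<close>])
      qed
      finally show ?thesis using Inl_hat_side p by blast
    next
      case p: (2 \<xi> r)
      show ?thesis
      proof (cases "\<xi> = \<eta>")
        case True
        then have "p = q" using p(1) 2(1) by blast
        moreover have "Inl u \<notin> hat_interval X R p q"
          unfolding p(1) 2(1) using True by simp
        ultimately show ?thesis
          using q_side hat_side_complement[OF w(1)] by blast
      next
        case False
        have "Inl u \<in> hat_interval X R p q \<longleftrightarrow> u \<in> line_points X R \<xi> \<eta>"
          unfolding p(1) 2(1) using False by auto
        also have "\<dots> \<longleftrightarrow> toward r u w"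
          by (rule line_points_iff[OF p(2) 2(2) p(3) 2(3) w])
        finally show ?thesis using Inr_hat_side[OF p(2,3) w(1)] p(1) by blast
      qed
    qed
    then have "shadow (hat X R) (hat_between X R) (Inl u) q = hat_side u w"
      unfolding sh using hat_side_subset by blast
    then show ?thesis using that w(1) q_side by blast
  qed
qed

lemma shadow_edge:
  assumes ab: "adj a b"
  shows "shadow (hat X R) (hat_between X R) (Inl a) (Inl b) = hat_side a b"
proof -
  have X: "a \<in> X" "b \<in> X" "a \<noteq> b" using adjD[OF ab] by blast+
  have "(Inl b :: 'a hat) \<in> hat X R" "Inl a \<noteq> (Inl b :: 'a hat)"
    using X by (auto simp: hat_def)
  then obtain w where w: "adj a w" "Inl b \<in> hat_side w a"
    "shadow (hat X R) (hat_between X R) (Inl a) (Inl b) = hat_side a w"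
    using shadow_point[OF X(1)] by blast
  have "R b w a" using w(2) Inl_hat_side X by blast
  moreover have "R b b a" using R_left X by blast
  ultimately have "w = b" using nbr_unique[OF w(1) ab X(2)] by blast
  then show ?thesis using w(3) by simp
qed

lemma shadow_end:
  assumes \<xi>: "\<xi> \<in> Ends X R" and q: "q \<in> hat X R" and ne: "Inr \<xi> \<noteq> q"
  shows "shadow (hat X R) (hat_between X R) (Inr \<xi>) q = {Inr \<xi>}"
proof -
  have "Inr \<xi> \<in> hat_interval X R p q \<longleftrightarrow> p = Inr \<xi>" for p
    using ne by (cases p; cases q) (auto split: if_splits)
  then show ?thesis
    using \<xi> by (auto simp: shadow_def interval_def hat_between_def hat_def)
qed

definition sides :: "'a hat set set" where
  "sides = {hat_side a b | a b. adj a b}"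

text \<open>Complements of shadows of vertices are sides, and every side arises so. The complement
  of the shadow of an end omits just that end and is, by separation, the union of the sides missing
  it.\<close>

lemma hat_topology_eq:
  "hat_topology X R = topology_generated_by (insert (hat X R) sides)" (is "_ = ?T")
proof -
  define S where
    "S = insert (hat X R) {hat X R - shadow (hat X R) (hat_between X R) u v | u v. u \<in> hat X R \<and> v \<in> hat X R \<and> u \<noteq> v}"
  have top: "hat_topology X R = topology_generated_by S"
    by (simp add: hat_topology_def shadow_topology_def S_def)
  have coarsest: "openin T' U" if "\<And>A. A \<in> B \<Longrightarrow> openin T' A" "openin (topology_generated_by B) U"
    for T' :: "'a hat topology" and B U
    using generate_topology_on_coarsest[OF istopology_openin that(1)] that(2)
    by (simp add: openin_topology_generated_by_iff)
  have side_open: "openin ?T (hat_side a b)" if "adj a b" for a b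
    using that by (intro topology_generated_by_Basis) (auto simp: sides_def)
  have "openin ?T A" if A: "A \<in> S" for A
  proof -
    consider "A = hat X R" | u v where "u \<in> hat X R" "v \<in> hat X R" "u \<noteq> v"
        "A = hat X R - shadow (hat X R) (hat_between X R) u v"
      using A by (auto simp: S_def)
    then show ?thesis
    proof cases
      case 1
      then show ?thesis by (intro topology_generated_by_Basis) auto
    next
      case (2 u v)
      show ?thesis using 2(1)
      proof (cases rule: hat_cases)
        case (1 x)
        then obtain w where "adj x w" "shadow (hat X R) (hat_between X R) u v = hat_side x w"
          using shadow_point[OF 1(2) 2(2)] 2(3) by blast
        then show ?thesis
          using side_open[OF adj_sym] hat_side_complement 2(4) by simp
      next
        case u: (2 \<xi> r)
        have "A = hat X R - {u}"
          using shadow_end[OF u(2) 2(2)] 2(3,4) u(1) by simp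
        also have "\<dots> = \<Union> {B \<in> sides. u \<notin> B}"
        proof
          show "hat X R - {u} \<subseteq> \<Union> {B \<in> sides. u \<notin> B}"
          proof
            fix p assume "p \<in> hat X R - {u}"
            then obtain a b where "adj a b" "p \<in> hat_side a b" "u \<notin> hat_side a b"
              using hat_separated[of p u] 2(1) by blast
            then show "p \<in> \<Union> {B \<in> sides. u \<notin> B}" by (auto simp: sides_def)
          qed
          show "\<Union> {B \<in> sides. u \<notin> B} \<subseteq> hat X R - {u}"
            using hat_side_subset by (auto simp: sides_def)
        qed
        also have "openin ?T \<dots>"
          using side_open by (intro openin_Union) (auto simp: sides_def)
        finally show ?thesis .
      qed
    qed
  qed
  moreover have "openin (topology_generated_by S) A" if A: "A \<in> insert (hat X R) sides" for A
  proof -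
    consider "A = hat X R" | a b where "adj a b" "A = hat_side a b"
      using A by (auto simp: sides_def)
    then have "A \<in> S"
    proof cases
      case (2 a b)
      have "A = hat X R - shadow (hat X R) (hat_between X R) (Inl b) (Inl a)"
        using 2 shadow_edge[OF adj_sym[OF 2(1)]] hat_side_complement[OF adj_sym[OF 2(1)]] by simp
      moreover have "(Inl a :: 'a hat) \<in> hat X R" "(Inl b :: 'a hat) \<in> hat X R" "Inl b \<noteq> (Inl a :: 'a hat)"
        using adjD[OF 2(1)] by (auto simp: hat_def)
      ultimately show ?thesis unfolding S_def by blast
    qed (simp add: S_def)
    then show ?thesis by (rule topology_generated_by_Basis)
  qed
  ultimately show ?thesis
    unfolding top topology_eq using coarsest[of S ?T] coarsest[of "insert (hat X R) sides" "topology_generated_by S"]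
    by blast
qed

end


section \<open>Monotone actions\<close>

locale monotone_action_space = Z_tree_space X R
  for X :: "'a set" and R :: "'a \<Rightarrow> 'a \<Rightarrow> 'a \<Rightarrow> bool" +
  fixes G :: "('g, 'm) monoid_scheme" and \<phi> :: "'g \<Rightarrow> 'a \<Rightarrow> 'a"
  assumes monotone: "monotone_action G X R \<phi>"
begin

lemma action: "group_action G X \<phi>"
  using monotone by (simp add: monotone_action_def)

lemma group_G: "group G"
  using action by (simp add: group_action_def group_hom_def)

lemma \<phi>_closed: "g \<in> carrier G \<Longrightarrow> x \<in> X \<Longrightarrow> \<phi> g x \<in> X"
  using group_action.element_image[OF action] by blast

lemma \<phi>_mult:
  "g1 \<in> carrier G \<Longrightarrow> g2 \<in> carrier G \<Longrightarrow> x \<in> X \<Longrightarrow> \<phi> (g1 \<otimes>\<^bsub>G\<^esub> g2) x = \<phi> g1 (\<phi> g2 x)"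
  using group_action.composition_rule[OF action] by blast

lemma \<phi>_one: "x \<in> X \<Longrightarrow> \<phi> \<one>\<^bsub>G\<^esub> x = x"
  using fun_cong[OF group_action.id_eq_one[OF action], of x] by simp

lemma \<phi>_inv:
  assumes "g \<in> carrier G" "x \<in> X"
  shows "\<phi> (inv\<^bsub>G\<^esub> g) (\<phi> g x) = x" "\<phi> g (\<phi> (inv\<^bsub>G\<^esub> g) x) = x"
proof -
  interpret group G by (rule group_G)
  show "\<phi> (inv\<^bsub>G\<^esub> g) (\<phi> g x) = x" "\<phi> g (\<phi> (inv\<^bsub>G\<^esub> g) x) = x"
    using \<phi>_mult[of "inv\<^bsub>G\<^esub> g" g x] \<phi>_mult[of g "inv\<^bsub>G\<^esub> g" x] \<phi>_one assms by simp_all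
qed

lemma inv_carrier: "g \<in> carrier G \<Longrightarrow> inv\<^bsub>G\<^esub> g \<in> carrier G"
  using group.inv_closed[OF group_G] .

lemma \<phi>_inj: "g \<in> carrier G \<Longrightarrow> x \<in> X \<Longrightarrow> y \<in> X \<Longrightarrow> \<phi> g x = \<phi> g y \<longleftrightarrow> x = y"
  using \<phi>_inv(1) by metis

lemma R_\<phi>:
  assumes g: "g \<in> carrier G" and X: "a \<in> X" "b \<in> X" "c \<in> X"
  shows "R (\<phi> g a) (\<phi> g b) (\<phi> g c) \<longleftrightarrow> R a b c"
proof -
  have mono: "R (\<phi> k x) (\<phi> k y) (\<phi> k z)" if "k \<in> carrier G" "x \<in> X" "y \<in> X" "z \<in> X" "R x y z" for k x y z
    using monotone that unfolding monotone_action_def by blast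
  show ?thesis
    using mono[OF g X] mono[OF inv_carrier[OF g] \<phi>_closed[OF g X(1)] \<phi>_closed[OF g X(2)] \<phi>_closed[OF g X(3)]]
    unfolding \<phi>_inv(1)[OF g X(1)] \<phi>_inv(1)[OF g X(2)] \<phi>_inv(1)[OF g X(3)] by blast
qed

lemma adj_\<phi>:
  assumes g: "g \<in> carrier G" and ab: "adj a b"
  shows "adj (\<phi> g a) (\<phi> g b)"
proof -
  have X: "a \<in> X" "b \<in> X" "a \<noteq> b" using adjD[OF ab] by blast+
  have gX: "\<phi> g a \<in> X" "\<phi> g b \<in> X" using \<phi>_closed[OF g] X by blast+
  have "y = \<phi> g a \<or> y = \<phi> g b" if y: "y \<in> X" "R (\<phi> g a) y (\<phi> g b)" for y
  proof -
    let ?y = "\<phi> (inv\<^bsub>G\<^esub> g) y"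
    have y': "?y \<in> X" "\<phi> g ?y = y"
      using \<phi>_closed[OF inv_carrier[OF g] y(1)] \<phi>_inv(2)[OF g y(1)] by blast+
    have "R a ?y b" using R_\<phi>[OF g X(1) y'(1) X(2)] y(2) y'(2) by simp
    then have "?y = a \<or> ?y = b" using adj_between[OF ab y'(1)] by blast
    then show ?thesis using y'(2) by metis
  qed
  then have "interval X R (\<phi> g a) (\<phi> g b) = {\<phi> g a, \<phi> g b}"
    unfolding interval_def using R_left R_right gX by blast
  then show ?thesis
    using gX \<phi>_inj[OF g X(1,2)] X(3) by (simp add: adjacent_def)
qed

lemma rays_\<phi>:
  assumes g: "g \<in> carrier G" and r: "r \<in> rays X R"
  shows "\<phi> g \<circ> r \<in> rays X R"
  using \<phi>_closed[OF g] \<phi>_inj[OF g] adj_\<phi>[OF g] rayD[OF r] by (auto simp: rays_def inj_def)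

lemma ray_equiv_\<phi>:
  assumes g: "g \<in> carrier G" and rs: "(r, s) \<in> ray_equiv X R"
  shows "(\<phi> g \<circ> r, \<phi> g \<circ> s) \<in> ray_equiv X R"
proof -
  have r: "r \<in> rays X R" "s \<in> rays X R" "infinite (range r \<inter> range s)"
    using rs by (auto simp: ray_equiv_def)
  have "inj_on (\<phi> g) (range r \<inter> range s)"
    using \<phi>_inj[OF g] rayD(1)[OF r(1)] by (auto simp: inj_on_def)
  then have "infinite (\<phi> g ` (range r \<inter> range s))" using r(3) finite_imageD by blast
  moreover have "\<phi> g ` (range r \<inter> range s) \<subseteq> range (\<phi> g \<circ> r) \<inter> range (\<phi> g \<circ> s)"
    by (auto simp: image_comp[symmetric])
  ultimately have "infinite (range (\<phi> g \<circ> r) \<inter> range (\<phi> g \<circ> s))"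
    using infinite_super by blast
  then show ?thesis using rays_\<phi>[OF g] r by (simp add: ray_equiv_def)
qed

lemma \<phi>_inv_ray:
  assumes "g \<in> carrier G" "r \<in> rays X R"
  shows "\<phi> (inv\<^bsub>G\<^esub> g) \<circ> (\<phi> g \<circ> r) = r" "\<phi> g \<circ> (\<phi> (inv\<^bsub>G\<^esub> g) \<circ> r) = r"
  using \<phi>_inv[OF assms(1)] rayD(1)[OF assms(2)] by auto

lemma Ends_\<phi>:
  assumes g: "g \<in> carrier G" and \<xi>: "\<xi> \<in> Ends X R"
  shows "(\<lambda>r. \<phi> g \<circ> r) ` \<xi> \<in> Ends X R"
proof -
  obtain r where r: "r \<in> \<xi>" using EndsD(1)[OF \<xi>] by blast
  then have r': "r \<in> rays X R" using EndsD(2)[OF \<xi>] by blast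
  have "(\<lambda>r. \<phi> g \<circ> r) ` \<xi> = ray_equiv X R `` {\<phi> g \<circ> r}"
  proof
    show "(\<lambda>r. \<phi> g \<circ> r) ` \<xi> \<subseteq> ray_equiv X R `` {\<phi> g \<circ> r}"
      using ray_equiv_\<phi>[OF g] EndsD(3)[OF \<xi> r] by blast
    show "ray_equiv X R `` {\<phi> g \<circ> r} \<subseteq> (\<lambda>r. \<phi> g \<circ> r) ` \<xi>"
    proof
      fix s assume "s \<in> ray_equiv X R `` {\<phi> g \<circ> r}"
      then have s: "(\<phi> g \<circ> r, s) \<in> ray_equiv X R" by blast
      then have sr: "s \<in> rays X R" by (simp add: ray_equiv_def)
      have "(r, \<phi> (inv\<^bsub>G\<^esub> g) \<circ> s) \<in> ray_equiv X R"
        using ray_equiv_\<phi>[OF inv_carrier[OF g] s] unfolding \<phi>_inv_ray(1)[OF g r'] .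
      then have "\<phi> (inv\<^bsub>G\<^esub> g) \<circ> s \<in> \<xi>" using EndsD(3)[OF \<xi> r] by blast
      then show "s \<in> (\<lambda>r. \<phi> g \<circ> r) ` \<xi>"
        by (rule image_eqI[rotated]) (rule \<phi>_inv_ray(2)[OF g sr, symmetric])
    qed
  qed
  then show ?thesis
    unfolding Ends_def using rays_\<phi>[OF g r'] by (simp add: quotientI)
qed

lemma hat_action_closed:
  assumes g: "g \<in> carrier G" and p: "p \<in> hat X R"
  shows "hat_action \<phi> g p \<in> hat X R"
  using p
proof (cases rule: hat_cases)
  case (1 x)
  then show ?thesis using \<phi>_closed[OF g] by (simp add: hat_def)
next
  case (2 \<xi> r)
  then show ?thesis using Ends_\<phi>[OF g] by (simp add: hat_def)
qed

lemma hat_action_side: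
  assumes g: "g \<in> carrier G" and ab: "adj a b" and p: "p \<in> hat X R"
  shows "hat_action \<phi> g p \<in> hat_side (\<phi> g a) (\<phi> g b) \<longleftrightarrow> p \<in> hat_side a b"
  using p
proof (cases rule: hat_cases)
  case (1 x)
  then show ?thesis
    using R_\<phi>[OF g 1(2) adjD(1)[OF ab] adjD(2)[OF ab]] Inl_hat_side \<phi>_closed[OF g 1(2)] by simp
next
  case (2 \<xi> r)
  have "\<phi> g \<circ> r \<in> (\<lambda>r. \<phi> g \<circ> r) ` \<xi>" using 2(3) by blast
  from Inr_hat_side[OF Ends_\<phi>[OF g 2(2)] this adj_\<phi>[OF g ab]]
  have "hat_action \<phi> g p \<in> hat_side (\<phi> g a) (\<phi> g b) \<longleftrightarrow> toward (\<phi> g \<circ> r) (\<phi> g a) (\<phi> g b)"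
    unfolding 2(1) by simp
  also have "\<dots> \<longleftrightarrow> toward r a b"
    using R_\<phi>[OF g rayD(1)[OF 2(4)] adjD(1)[OF ab] adjD(2)[OF ab]] by simp
  finally show ?thesis
    using Inr_hat_side[OF 2(2,3) ab] 2(1) by blast
qed

lemma hat_action_mult:
  assumes g: "g1 \<in> carrier G" "g2 \<in> carrier G" and p: "p \<in> hat X R"
  shows "hat_action \<phi> (g1 \<otimes>\<^bsub>G\<^esub> g2) p = hat_action \<phi> g1 (hat_action \<phi> g2 p)"
  using p
proof (cases rule: hat_cases)
  case (1 x)
  then show ?thesis using \<phi>_mult[OF g] by simp
next
  case (2 \<xi> r)
  have "\<phi> (g1 \<otimes>\<^bsub>G\<^esub> g2) \<circ> s = \<phi> g1 \<circ> (\<phi> g2 \<circ> s)" if "s \<in> \<xi>" for s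
  proof -
    have "s \<in> rays X R" using EndsD(2)[OF 2(2)] that by blast
    then show ?thesis using \<phi>_mult[OF g] rayD(1) by auto
  qed
  then show ?thesis unfolding 2(1) by (simp add: image_image)
qed

lemma hat_action_one:
  assumes p: "p \<in> hat X R"
  shows "hat_action \<phi> \<one>\<^bsub>G\<^esub> p = p"
  using p
proof (cases rule: hat_cases)
  case (1 x)
  then show ?thesis using \<phi>_one by simp
next
  case (2 \<xi> r)
  have "\<phi> \<one>\<^bsub>G\<^esub> \<circ> s = s" if "s \<in> \<xi>" for s
  proof -
    have "s \<in> rays X R" using EndsD(2)[OF 2(2)] that by blast
    then show ?thesis using \<phi>_one rayD(1) by auto
  qed
  then show ?thesis unfolding 2(1) by simp
qed

text \<open>If \<open>g\<close> moves the ends \<open>u\<close>, \<open>v\<close> of an edge to different sides of the edge \<open>(a, b)\<close>, then it maps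
  the one edge to the other. Hence edge stabilizers are open as soon as the orbit maps of \<open>u\<close> and \<open>v\<close>
  are continuous.\<close>

lemma sides_locally_constant:
  assumes T: "topspace T = carrier G"
    and cont: "T = discrete_topology (carrier G) \<or>
      continuous_map (prod_topology T (hat_topology X R)) (hat_topology X R) (\<lambda>(g, x). hat_action \<phi> g x)"
    and ab: "adj a b" and g0: "g0 \<in> carrier G"
  shows "\<exists>U. openin T U \<and> g0 \<in> U \<and>
    (\<forall>g\<in>U. \<forall>p\<in>hat X R. hat_action \<phi> g p \<in> hat_side a b \<longleftrightarrow> hat_action \<phi> g0 p \<in> hat_side a b)"
  using cont
proof
  assume "T = discrete_topology (carrier G)"
  then show ?thesis using g0 by (intro exI[of _ "{g0}"]) simp
next
  assume c: "continuous_map (prod_topology T (hat_topology X R)) (hat_topology X R) (\<lambda>(g, x). hat_action \<phi> g x)"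
  define u where "u = \<phi> (inv\<^bsub>G\<^esub> g0) a"
  define v where "v = \<phi> (inv\<^bsub>G\<^esub> g0) b"
  have uv: "adj u v" unfolding u_def v_def by (rule adj_\<phi>[OF inv_carrier[OF g0] ab])
  have g0uv: "\<phi> g0 u = a" "\<phi> g0 v = b"
    unfolding u_def v_def using \<phi>_inv(2)[OF g0] adjD[OF ab] by blast+
  have top: "topspace (hat_topology X R) = hat X R"
    by (simp add: hat_topology_def)
  have orbit: "continuous_map T (hat_topology X R) (\<lambda>g. hat_action \<phi> g p)" if "p \<in> hat X R" for p
  proof -
    have "continuous_map T (prod_topology T (hat_topology X R)) (\<lambda>g. (g, p))"
      using that top by (intro continuous_map_pairedI continuous_map_id[unfolded id_def]) simp_all
    from continuous_map_compose[OF this c] show ?thesis by (simp add: o_def)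
  qed
  have side_open: "openin (hat_topology X R) (hat_side c d)" if "adj c d" for c d
    unfolding hat_topology_eq using that by (intro topology_generated_by_Basis) (auto simp: sides_def)
  have X: "u \<in> X" "v \<in> X" using adjD[OF uv] by blast+
  have hat: "Inl u \<in> hat X R" "Inl v \<in> hat X R" using X by (auto simp: hat_def)
  define U where "U = {g \<in> topspace T. hat_action \<phi> g (Inl u) \<in> hat_side a b} \<inter>
    {g \<in> topspace T. hat_action \<phi> g (Inl v) \<in> hat_side b a}"
  have "openin T U"
    unfolding U_def
    by (intro openin_Int openin_continuous_map_preimage[OF orbit] side_open hat ab adj_sym)
  moreover have "g0 \<in> U"
    unfolding U_def T using g0 g0uv Inl_hat_side R_left adjD[OF ab] by simp
  \<comment> \<open>Every \<open>g\<close> in \<open>U\<close> carries (u, v) to (a, b), so the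
    preimage of \<open>hat_side a b\<close> is \<open>hat_side u v\<close>, as it is for
    \<open>g0\<close>.\<close>
  moreover have "hat_action \<phi> g p \<in> hat_side a b \<longleftrightarrow> hat_action \<phi> g0 p \<in> hat_side a b"
    if gU: "g \<in> U" and p: "p \<in> hat X R" for g p
  proof -
    have g: "g \<in> carrier G" using gU by (simp add: U_def T)
    have "R (\<phi> g u) a b" "R (\<phi> g v) b a"
      using gU Inl_hat_side \<phi>_closed[OF g] X by (simp_all add: U_def)
    then have "\<phi> g u = a" "\<phi> g v = b"
      using crossing_edge[OF adj_\<phi>[OF g uv] ab] by blast+
    then show ?thesis
      using hat_action_side[OF g uv p] hat_action_side[OF g0 uv p] g0uv by simp
  qed
  ultimately show ?thesis by blast
qed

end

theorem corollary1p5: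
  fixes X :: "'a set" and R :: "'a \<Rightarrow> 'a \<Rightarrow> 'a \<Rightarrow> bool"
    and G :: "('g, 'm) monoid_scheme" and T :: "'g topology"
    and \<phi> :: "'g \<Rightarrow> 'a \<Rightarrow> 'a"
  assumes "Z_tree X R"
    and "topological_group G T"
    and "monotone_action G X R \<phi>"
    and "\<And>g. g \<in> carrier G \<Longrightarrow>
           homeomorphic_map (shadow_topology X R) (shadow_topology X R) (\<phi> g)"
    and "T = discrete_topology (carrier G) \<or>
         continuous_map (prod_topology T (hat_topology X R)) (hat_topology X R)
           (\<lambda>(g, x). hat_action \<phi> g x)"
  shows "Rosenthal_representable G T (hat_topology X R) (hat_action \<phi>)"
proof -
  interpret monotone_action_space X R G \<phi>
    by unfold_locales (fact assms)+
  interpret group G by (rule group_G)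
  have T: "topspace T = carrier G"
    using assms(2) by (simp add: topological_group_def)
  interpret nested_action "hat X R" sides G T "hat_action \<phi>"
  proof unfold_locales
    show "A \<subseteq> hat X R" if "A \<in> sides" for A
      using that hat_side_subset by (auto simp: sides_def)
    show "crossing_free (hat X R) A B" if "A \<in> sides" "B \<in> sides" for A B
      using that hat_sides_crossing_free unfolding sides_def by blast
    show "hat X R - A \<in> sides" if "A \<in> sides" for A
      using that hat_side_complement adj_sym unfolding sides_def by blast
    show "\<exists>A\<in>sides. p \<in> A \<and> q \<notin> A" if pq: "p \<in> hat X R" "q \<in> hat X R" "p \<noteq> q" for p q
    proof -
      obtain a b where "adj a b" "p \<in> hat_side a b" "q \<notin> hat_side a b"
        by (rule hat_separated[OF pq])
      then show ?thesis by (auto simp: sides_def)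
    qed
    show "topspace T = carrier G" by (rule T)
    show "{p \<in> hat X R. hat_action \<phi> g p \<in> A} \<in> sides" if g: "g \<in> carrier G" and A: "A \<in> sides" for g A
    proof -
      obtain a b where ab: "adj a b" "A = hat_side a b" using A by (auto simp: sides_def)
      \<comment> \<open>The preimage of a side belongs to the edge translated by the inverse of
        \<open>g\<close>.\<close>
      let ?a = "\<phi> (inv\<^bsub>G\<^esub> g) a" and ?b = "\<phi> (inv\<^bsub>G\<^esub> g) b"
      have adj': "adj ?a ?b" by (rule adj_\<phi>[OF inv_carrier[OF g] ab(1)])
      have "\<phi> g ?a = a" "\<phi> g ?b = b" using \<phi>_inv(2)[OF g] adjD[OF ab(1)] by blast+
      then have "{p \<in> hat X R. hat_action \<phi> g p \<in> A} = hat_side ?a ?b"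
        using hat_action_side[OF g adj'] hat_side_subset unfolding ab(2) by auto
      then show ?thesis using adj' by (auto simp: sides_def)
    qed
    show "\<exists>U. openin T U \<and> g0 \<in> U \<and>
        (\<forall>g\<in>U. \<forall>p\<in>hat X R. hat_action \<phi> g p \<in> A \<longleftrightarrow> hat_action \<phi> g0 p \<in> A)"
      if A: "A \<in> sides" and g0: "g0 \<in> carrier G" for A g0
    proof -
      obtain a b where ab: "adj a b" "A = hat_side a b" using A by (auto simp: sides_def)
      show ?thesis unfolding ab(2) by (rule sides_locally_constant[OF T assms(5) ab(1) g0])
    qed
  qed (use group_G hat_action_closed hat_action_mult hat_action_one in auto)
  show ?thesis
    using Rosenthal_representable unfolding \<tau>_def hat_topology_eq[symmetric] .
qed

end
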